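(* Let $K$ be a field, $\delta\in K$, $r\ge p\ge0$ and let $D_r$ be the Brauer algebra with parameter $\delta$. Let $V$ be an $\mathfrak S_p$-module. Then the restriction $(\mathrm{Inf}_p^rV)\downarrow^{D_r}_{\mathfrak S_r}$ is isomorphic, as an $\mathfrak S_r$-module, to the induction product $V\cdot M_{r-p}$, where $M_{r-p}$ is the species of perfect matchings of sets of cardinality $r-p$.
   Context: For $r,s\ge 0$ let $D(r,s)$ be the set of perfect matchings of $[r]\amalg[s]$, drawn with $r$ points on the top edge and $s$ points on the bottom edge of a rectangle. For $x\in D(r,s)$, $y\in D(s,t)$ stack $x$ on top of $y$; $c(x,y)$ is the number of closed loops produced, $x\circ y\in D(r,t)$ is the result after deleting loops, and $x\cdot y=\delta^{c(x,y)}x\circ y$. The Brauer algebra $D_r$ is the $K$-vector space with basis $D(r,r)$ and this product; it contains $K\mathfrak S_r$ as the span of the diagrams all of whose strands join the top edge to the bottom edge. The propagating number $\mathrm{pr}(x)$ is the number of strands joining the top edge to the bottom edge, and $D(r,s;p)=\{x\in D(r,s):\mathrm{pr}(x)=p\}$. $KD(p,r;p)$ is a $K\mathfrak S_p$-$D_r$ bimodule under the product $x\cdot y$, where diagrams with propagating number less than $p$ are set to zero. Inflation: for a (right) $K\mathfrak S_p$-module $V$, $\mathrm{Inf}_p^rV=V\otimes_{K\mathfrak S_p}KD(p,r;p)$, a right $D_r$-module. $M_{m}$, viewed as an $\mathfrak S_m$-module, is the permutation module on the set of perfect matchings of $\{1,\dots,m\}$ (zero if $m$ is odd). For an $\mathfrak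 S_p$-module $F$ and an $\mathfrak S_m$-module $G$, $F\cdot G=(F\otimes G)\uparrow_{\mathfrak S_p\times\mathfrak S_m}^{\mathfrak S_{p+m}}$. *)

theory Defs
  imports
    "HOL-Algebra.Free_Abelian_Groups"
    "HOL-Algebra.Sym_Groups"
    "HOL-Algebra.Algebraic_Closure_Type"
    "HOL-Library.Disjoint_Sets"
    "HOL-Library.Poly_Mapping"
begin

section \<open>Right modules and bimodules\<close>

text \<open>
  The library's \<open>module\<close> record is reused for modules over rings that need not be commutative.
  For a right module the field \<open>smult\<close> is still written with the scalar first, so that
  \<open>a \<odot>\<^bsub>M\<^esub> x\<close> stands for $x \cdot a$; this is why the factors are swapped in \<open>smult_assoc\<close>.
  The fields \<open>mult\<close> and \<open>one\<close> of a module record carry no meaning here.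
\<close>

locale right_module = R?: ring R + M?: abelian_group M
  for R :: "('a, 'r) ring_scheme" (structure) and M :: "('a, 'b, 'm) module_scheme" (structure) +
  assumes smult_closed:
      "\<lbrakk>a \<in> carrier R; x \<in> carrier M\<rbrakk> \<Longrightarrow> a \<odot>\<^bsub>M\<^esub> x \<in> carrier M"
    and smult_l_distr:
      "\<lbrakk>a \<in> carrier R; b \<in> carrier R; x \<in> carrier M\<rbrakk>
        \<Longrightarrow> (a \<oplus> b) \<odot>\<^bsub>M\<^esub> x = a \<odot>\<^bsub>M\<^esub> x \<oplus>\<^bsub>M\<^esub> b \<odot>\<^bsub>M\<^esub> x"
    and smult_r_distr:
      "\<lbrakk>a \<in> carrier R; x \<in> carrier M; y \<in> carrier M\<rbrakk>
        \<Longrightarrow> a \<odot>\<^bsub>M\<^esub> (x \<oplus>\<^bsub>M\<^esub> y) = a \<odot>\<^bsub>M\<^esub> x \<oplus>\<^bsub>M\<^esub> a \<odot>\<^bsub>M\<^esub> y"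
    and smult_assoc:
      "\<lbrakk>a \<in> carrier R; b \<in> carrier R; x \<in> carrier M\<rbrakk>
        \<Longrightarrow> (a \<otimes> b) \<odot>\<^bsub>M\<^esub> x = b \<odot>\<^bsub>M\<^esub> (a \<odot>\<^bsub>M\<^esub> x)"
    and smult_one:
      "x \<in> carrier M \<Longrightarrow> \<one> \<odot>\<^bsub>M\<^esub> x = x"

definition module_hom ::
    "('a, 'r) ring_scheme \<Rightarrow> ('a, 'b, 'm) module_scheme \<Rightarrow> ('a, 'c, 'n) module_scheme \<Rightarrow> ('b \<Rightarrow> 'c) set"
  where "module_hom R M N = {f. f \<in> carrier M \<rightarrow> carrier N
    \<and> (\<forall>x\<in>carrier M. \<forall>y\<in>carrier M. f (x \<oplus>\<^bsub>M\<^esub> y) = f x \<oplus>\<^bsub>N\<^esub> f y)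
    \<and> (\<forall>a\<in>carrier R. \<forall>x\<in>carrier M. f (a \<odot>\<^bsub>M\<^esub> x) = a \<odot>\<^bsub>N\<^esub> f x)}"

definition modules_isomorphic ::
    "('a, 'r) ring_scheme \<Rightarrow> ('a, 'b, 'm) module_scheme \<Rightarrow> ('a, 'c, 'n) module_scheme \<Rightarrow> bool"
  where "modules_isomorphic R M N
    \<longleftrightarrow> (\<exists>f\<in>module_hom R M N. bij_betw f (carrier M) (carrier N))"

definition restrict_scalars :: "('a \<Rightarrow> 'b) \<Rightarrow> ('b, 'm) module \<Rightarrow> ('a, 'm) module"
  where "restrict_scalars h M =
    \<lparr>carrier = carrier M, monoid.mult = monoid.mult M, one = one M, zero = zero M, add = add M,
     module.smult = (\<lambda>a. module.smult M (h a))\<rparr>"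

text \<open>A bimodule: \<open>smult\<close> is the left action, \<open>rsmult\<close> the right action.\<close>

record ('a, 'b, 'm) bimodule = "('a, 'm) module" +
  rsmult :: "'m \<Rightarrow> 'b \<Rightarrow> 'm"


section \<open>Tensor products\<close>

text \<open>
  For a right \<open>R\<close>-module \<open>V\<close> and a left \<open>R\<close>-module \<open>W\<close>, the tensor product is the free abelian
  group on \<open>carrier V \<times> carrier W\<close> modulo the subgroup generated by the usual relators.
\<close>

definition tensor_free ::
    "('a, 'v, 'm) module_scheme \<Rightarrow> ('a, 'w, 'n) module_scheme \<Rightarrow> ('v \<times> 'w \<Rightarrow>\<^sub>0 int) monoid"
  where "tensor_free V W = free_Abelian_group (carrier V \<times> carrier W)"

definition tensor_relators ::
    "('a, 'r) ring_scheme \<Rightarrow> ('a, 'v, 'm) module_scheme \<Rightarrow> ('a, 'w, 'n) module_scheme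
      \<Rightarrow> ('v \<times> 'w \<Rightarrow>\<^sub>0 int) set"
  where "tensor_relators R V W =
    {frag_of (v \<oplus>\<^bsub>V\<^esub> v', w) - frag_of (v, w) - frag_of (v', w) | v v' w.
       v \<in> carrier V \<and> v' \<in> carrier V \<and> w \<in> carrier W} \<union>
    {frag_of (v, w \<oplus>\<^bsub>W\<^esub> w') - frag_of (v, w) - frag_of (v, w') | v w w'.
       v \<in> carrier V \<and> w \<in> carrier W \<and> w' \<in> carrier W} \<union>
    {frag_of (a \<odot>\<^bsub>V\<^esub> v, w) - frag_of (v, a \<odot>\<^bsub>W\<^esub> w) | a v w.
       a \<in> carrier R \<and> v \<in> carrier V \<and> w \<in> carrier W}"

definition tensor_kernel ::
    "('a, 'r) ring_scheme \<Rightarrow> ('a, 'v, 'm) module_scheme \<Rightarrow> ('a, 'w, 'n) module_scheme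
      \<Rightarrow> ('v \<times> 'w \<Rightarrow>\<^sub>0 int) set"
  where "tensor_kernel R V W = generate (tensor_free V W) (tensor_relators R V W)"

text \<open>
  The tensor product with a right action: \<open>act b (v, w)\<close> is (a representative of) the image of
  $v \otimes w$ under \<open>b\<close>. It is extended additively to the free abelian group and then passes to
  cosets: adding the kernel to the image of a coset yields the coset of the image of any
  representative.
\<close>

definition tensor_module ::
    "('a, 'r) ring_scheme \<Rightarrow> ('a, 'v, 'm) module_scheme \<Rightarrow> ('a, 'w, 'n) module_scheme
      \<Rightarrow> ('b \<Rightarrow> 'v \<times> 'w \<Rightarrow> ('v \<times> 'w \<Rightarrow>\<^sub>0 int)) \<Rightarrow> ('b, ('v \<times> 'w \<Rightarrow>\<^sub>0 int) set) module"
  where "tensor_module R V W act =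
    (let F = tensor_free V W; N = tensor_kernel R V W; Q = F Mod N in
      \<lparr>carrier = carrier Q, monoid.mult = undefined, one = undefined, zero = one Q, add = monoid.mult Q,
       module.smult = (\<lambda>b S. N <#>\<^bsub>F\<^esub> (frag_extend (act b) ` S))\<rparr>)"

definition tensor ::
    "('a, 'r) ring_scheme \<Rightarrow> ('a, 'v, 'm) module_scheme \<Rightarrow> ('a, 'b, 'w) bimodule
      \<Rightarrow> ('b, ('v \<times> 'w \<Rightarrow>\<^sub>0 int) set) module"
  where "tensor R V W = tensor_module R V W (\<lambda>b (v, w). frag_of (v, rsmult W w b))"


section \<open>Linear extension and group algebras\<close>

text \<open>
  \<open>'x \<Rightarrow>\<^sub>0 'k\<close> is the free \<open>'k\<close>-module with basis \<open>'x\<close>; the functions below extend a function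
  given on basis elements linearly, respectively bilinearly.
\<close>

definition lin_ext :: "('x \<Rightarrow> 'z \<Rightarrow>\<^sub>0 'k::comm_ring_1) \<Rightarrow> ('x \<Rightarrow>\<^sub>0 'k) \<Rightarrow> ('z \<Rightarrow>\<^sub>0 'k)"
  where "lin_ext b f =
    (\<Sum>x\<in>Poly_Mapping.keys f. Poly_Mapping.map ((*) (Poly_Mapping.lookup f x)) (b x))"

definition bilin_ext ::
    "('x \<Rightarrow> 'y \<Rightarrow> 'z \<Rightarrow>\<^sub>0 'k::comm_ring_1) \<Rightarrow> ('x \<Rightarrow>\<^sub>0 'k) \<Rightarrow> ('y \<Rightarrow>\<^sub>0 'k) \<Rightarrow> ('z \<Rightarrow>\<^sub>0 'k)"
  where "bilin_ext b f g = lin_ext (\<lambda>x. lin_ext (b x) g) f"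

definition group_algebra :: "('g, 'm) monoid_scheme \<Rightarrow> ('g \<Rightarrow>\<^sub>0 'k::comm_ring_1) ring"
  where "group_algebra G =
    \<lparr>carrier = {f. Poly_Mapping.keys f \<subseteq> carrier G},
     monoid.mult = bilin_ext (\<lambda>g h. Poly_Mapping.single (g \<otimes>\<^bsub>G\<^esub> h) 1),
     one = Poly_Mapping.single \<one>\<^bsub>G\<^esub> 1, zero = 0, add = (+)\<rparr>"

text \<open>The ground ring inside the group algebra, as the multiples of the unit.\<close>

definition scalar_embed :: "('g, 'm) monoid_scheme \<Rightarrow> 'k::comm_ring_1 \<Rightarrow> ('g \<Rightarrow>\<^sub>0 'k)"
  where "scalar_embed G c = Poly_Mapping.single \<one>\<^bsub>G\<^esub> c"

text \<open>
  The external tensor product $V \otimes_K W$ of a right $KG$-module and a right $KH$-module, with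
  $(v \otimes w)(g, h) = vg \otimes wh$. Since $K$ is commutative, \<open>W\<close> also serves as the
  left $K$-module.
\<close>

definition external_tensor ::
    "('g, 'm) monoid_scheme \<Rightarrow> ('h, 'n) monoid_scheme
      \<Rightarrow> ('g \<Rightarrow>\<^sub>0 'k::comm_ring_1, 'v) module \<Rightarrow> ('h \<Rightarrow>\<^sub>0 'k, 'w) module
      \<Rightarrow> ('g \<times> 'h \<Rightarrow>\<^sub>0 'k, ('v \<times> 'w \<Rightarrow>\<^sub>0 int) set) module"
  where "external_tensor G H V W =
    tensor_module (ring_of_type_algebra :: 'k ring)
      (restrict_scalars (scalar_embed G) V) (restrict_scalars (scalar_embed H) W)
      (\<lambda>f (v, w). \<Sum>(g, h)\<in>Poly_Mapping.keys f.
         frag_of (Poly_Mapping.single g (Poly_Mapping.lookup f (g, h)) \<odot>\<^bsub>V\<^esub> v,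
                  Poly_Mapping.single h 1 \<odot>\<^bsub>W\<^esub> w))"

text \<open>Induction $U \otimes_{KH} KG$ along a homomorphism \<open>\<iota> : H \<rightarrow> G\<close>.\<close>

definition induction_bimodule ::
    "('g, 'm) monoid_scheme \<Rightarrow> ('h \<Rightarrow> 'g) \<Rightarrow> ('h \<Rightarrow>\<^sub>0 'k::comm_ring_1, 'g \<Rightarrow>\<^sub>0 'k, 'g \<Rightarrow>\<^sub>0 'k) bimodule"
  where "induction_bimodule G \<iota> =
    \<lparr>carrier = carrier (group_algebra G), monoid.mult = undefined, one = undefined, zero = 0, add = (+),
     module.smult = (\<lambda>a x. lin_ext (\<lambda>h. Poly_Mapping.single (\<iota> h) 1) a \<otimes>\<^bsub>group_algebra G\<^esub> x),
     rsmult = monoid.mult (group_algebra G)\<rparr>"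

definition induced_module ::
    "('g, 'm) monoid_scheme \<Rightarrow> ('h, 'n) monoid_scheme \<Rightarrow> ('h \<Rightarrow> 'g)
      \<Rightarrow> ('h \<Rightarrow>\<^sub>0 'k::comm_ring_1, 'u) module
      \<Rightarrow> ('g \<Rightarrow>\<^sub>0 'k, ('u \<times> ('g \<Rightarrow>\<^sub>0 'k) \<Rightarrow>\<^sub>0 int) set) module"
  where "induced_module G H \<iota> U = tensor (group_algebra H) U (induction_bimodule G \<iota>)"


section \<open>Symmetric groups\<close>

abbreviation sym_algebra :: "nat \<Rightarrow> ((nat \<Rightarrow> nat) \<Rightarrow>\<^sub>0 'k::comm_ring_1) ring"
  where "sym_algebra n \<equiv> group_algebra (sym_group n)"

text \<open>
  The embedding of $S_p \times S_m$ into $S_{p+m}$; permutations of \<open>{1..n}\<close> fix \<open>0\<close>, so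
  the case \<open>i = 0\<close> is harmless.
\<close>

definition block_perm :: "nat \<Rightarrow> (nat \<Rightarrow> nat) \<times> (nat \<Rightarrow> nat) \<Rightarrow> nat \<Rightarrow> nat"
  where "block_perm p = (\<lambda>(\<sigma>, \<tau>) i. if i \<le> p then \<sigma> i else p + \<tau> (i - p))"

definition induction_product ::
    "nat \<Rightarrow> nat \<Rightarrow> ((nat \<Rightarrow> nat) \<Rightarrow>\<^sub>0 'k::comm_ring_1, 'v) module
      \<Rightarrow> ((nat \<Rightarrow> nat) \<Rightarrow>\<^sub>0 'k, 'w) module
      \<Rightarrow> ((nat \<Rightarrow> nat) \<Rightarrow>\<^sub>0 'k,
          (('v \<times> 'w \<Rightarrow>\<^sub>0 int) set \<times> ((nat \<Rightarrow> nat) \<Rightarrow>\<^sub>0 'k) \<Rightarrow>\<^sub>0 int) set) module"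
  where "induction_product p m F G =
    induced_module (sym_group (p + m)) (sym_group p \<times>\<times> sym_group m) (block_perm p)
      (external_tensor (sym_group p) (sym_group m) F G)"

definition perfect_matchings :: "'x set \<Rightarrow> 'x set set set"
  where "perfect_matchings A = {x. partition_on A x \<and> (\<forall>e\<in>x. card e = 2)}"

text \<open>
  The right action of \<open>\<sigma>\<close> on matchings is the left action of its inverse, i.e. each edge is
  replaced by its preimage.
\<close>

definition matching_module ::
    "nat \<Rightarrow> ((nat \<Rightarrow> nat) \<Rightarrow>\<^sub>0 'k::comm_ring_1, nat set set \<Rightarrow>\<^sub>0 'k) module"
  where "matching_module m =
    \<lparr>carrier = {f. Poly_Mapping.keys f \<subseteq> perfect_matchings {1..m}},
     monoid.mult = undefined, one = undefined, zero = 0, add = (+),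
     module.smult = (\<lambda>a f. bilin_ext (\<lambda>x \<sigma>. Poly_Mapping.single ((\<lambda>e. \<sigma> -` e) ` x) 1) f a)\<rparr>"


section \<open>Brauer diagrams\<close>

text \<open>\<open>Inl i\<close> is the \<open>i\<close>-th point on the top edge, \<open>Inr j\<close> the \<open>j\<close>-th point on the bottom edge.\<close>

type_synonym diagram = "(nat + nat) set set"

definition diagrams :: "nat \<Rightarrow> nat \<Rightarrow> diagram set"
  where "diagrams r s = perfect_matchings (Inl ` {1..r} \<union> Inr ` {1..s})"

definition propagating :: "diagram \<Rightarrow> nat"
  where "propagating x = card {e \<in> x. \<exists>i j. e = {Inl i, Inr j}}"

definition diagrams_pr :: "nat \<Rightarrow> nat \<Rightarrow> nat \<Rightarrow> diagram set"
  where "diagrams_pr r s p = {x \<in> diagrams r s. propagating x = p}"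

text \<open>
  Stacking \<open>x\<close> on top of \<open>y\<close> gives a graph on three rows of points. In it the outer points have
  degree one and the middle points have degree two (counting parallel edges), so its connected
  components are the strands of the composite diagram and the closed loops, the latter being
  the components that lie entirely in the middle row.
\<close>

datatype point = Top nat | Mid nat | Bot nat

definition stack_edges :: "diagram \<Rightarrow> diagram \<Rightarrow> point set set"
  where "stack_edges x y = (`) (case_sum Top Mid) ` x \<union> (`) (case_sum Mid Bot) ` y"

definition stack_components :: "diagram \<Rightarrow> diagram \<Rightarrow> point set set"
  where "stack_components x y =
    \<Union>(stack_edges x y) // {(u, v). {u, v} \<in> stack_edges x y}\<^sup>*"

definition loops :: "diagram \<Rightarrow> diagram \<Rightarrow> nat"
  where "loops x y = card {C \<in> stack_components x y. C \<subseteq> range Mid}"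

definition diagram_comp :: "diagram \<Rightarrow> diagram \<Rightarrow> diagram"
  where "diagram_comp x y = (\<lambda>C. case_sum Top Bot -` C) ` stack_components x y - {{}}"

definition brauer_mult ::
    "'k::comm_ring_1 \<Rightarrow> (diagram \<Rightarrow>\<^sub>0 'k) \<Rightarrow> (diagram \<Rightarrow>\<^sub>0 'k) \<Rightarrow> (diagram \<Rightarrow>\<^sub>0 'k)"
  where "brauer_mult \<delta> =
    bilin_ext (\<lambda>x y. Poly_Mapping.single (diagram_comp x y) (\<delta> ^ loops x y))"

text \<open>
  With this convention the product of the diagrams of \<open>\<sigma>\<close> and \<open>\<tau>\<close> is the diagram of \<open>\<sigma> \<circ> \<tau>\<close>.
\<close>

definition perm_diagram :: "nat \<Rightarrow> (nat \<Rightarrow> nat) \<Rightarrow> diagram"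
  where "perm_diagram n \<sigma> = (\<lambda>i. {Inl (\<sigma> i), Inr i}) ` {1..n}"

definition brauer_algebra :: "'k::comm_ring_1 \<Rightarrow> nat \<Rightarrow> (diagram \<Rightarrow>\<^sub>0 'k) ring"
  where "brauer_algebra \<delta> r =
    \<lparr>carrier = {f. Poly_Mapping.keys f \<subseteq> diagrams r r}, monoid.mult = brauer_mult \<delta>,
     one = Poly_Mapping.single (perm_diagram r id) 1, zero = 0, add = (+)\<rparr>"

text \<open>The inclusion of the group algebra of $S_n$ into the Brauer algebra.\<close>

definition sym_to_brauer :: "nat \<Rightarrow> ((nat \<Rightarrow> nat) \<Rightarrow>\<^sub>0 'k::comm_ring_1) \<Rightarrow> (diagram \<Rightarrow>\<^sub>0 'k)"
  where "sym_to_brauer n = lin_ext (\<lambda>\<sigma>. Poly_Mapping.single (perm_diagram n \<sigma>) 1)"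


section \<open>Inflation\<close>

definition truncate_pr :: "nat \<Rightarrow> (diagram \<Rightarrow>\<^sub>0 'k::comm_ring_1) \<Rightarrow> (diagram \<Rightarrow>\<^sub>0 'k)"
  where "truncate_pr p =
    lin_ext (\<lambda>x. if propagating x < p then 0 else Poly_Mapping.single x 1)"

definition diagram_bimodule ::
    "'k::comm_ring_1 \<Rightarrow> nat \<Rightarrow> nat
      \<Rightarrow> ((nat \<Rightarrow> nat) \<Rightarrow>\<^sub>0 'k, diagram \<Rightarrow>\<^sub>0 'k, diagram \<Rightarrow>\<^sub>0 'k) bimodule"
  where "diagram_bimodule \<delta> p r =
    \<lparr>carrier = {f. Poly_Mapping.keys f \<subseteq> diagrams_pr p r p},
     monoid.mult = undefined, one = undefined, zero = 0, add = (+),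
     module.smult = (\<lambda>a f. truncate_pr p (brauer_mult \<delta> (sym_to_brauer p a) f)),
     rsmult = (\<lambda>f d. truncate_pr p (brauer_mult \<delta> f d))\<rparr>"

definition inflation ::
    "'k::comm_ring_1 \<Rightarrow> nat \<Rightarrow> nat \<Rightarrow> ((nat \<Rightarrow> nat) \<Rightarrow>\<^sub>0 'k, 'v) module
      \<Rightarrow> (diagram \<Rightarrow>\<^sub>0 'k, ('v \<times> (diagram \<Rightarrow>\<^sub>0 'k) \<Rightarrow>\<^sub>0 int) set) module"
  where "inflation \<delta> p r V = tensor (sym_algebra p) V (diagram_bimodule \<delta> p r)"


section \<open>Basic facts\<close>

lemma lookup_lin_ext:
  "Poly_Mapping.lookup (lin_ext b f) z =
    (\<Sum>x\<in>Poly_Mapping.keys f. Poly_Mapping.lookup f x * Poly_Mapping.lookup (b x) z)"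
  by (simp add: lin_ext_def lookup_sum Poly_Mapping.map.rep_eq when_def)
     (rule sum.cong, auto)

lemma lookup_lin_ext_superset:
  assumes "finite A" "Poly_Mapping.keys f \<subseteq> A"
  shows "Poly_Mapping.lookup (lin_ext b f) z =
    (\<Sum>x\<in>A. Poly_Mapping.lookup f x * Poly_Mapping.lookup (b x) z)"
  unfolding lookup_lin_ext using assms
  by (intro sum.mono_neutral_left) (auto simp: in_keys_iff)

lemma lin_ext_add: "lin_ext b (f + g) = lin_ext b f + lin_ext b g"
proof (rule poly_mapping_eqI)
  fix z
  let ?A = "Poly_Mapping.keys f \<union> Poly_Mapping.keys g"
  have "Poly_Mapping.keys (f + g) \<subseteq> ?A" by (rule keys_add)
  then show "Poly_Mapping.lookup (lin_ext b (f + g)) z = Poly_Mapping.lookup (lin_ext b f + lin_ext b g) z"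
    by (simp add: lookup_add lookup_lin_ext_superset[of ?A] sum.distrib distrib_right)
qed

lemma lin_ext_add_fun: "lin_ext (\<lambda>x. b x + c x) f = lin_ext b f + lin_ext c f"
  by (rule poly_mapping_eqI) (simp add: lookup_add lookup_lin_ext sum.distrib distrib_left)

lemma lin_ext_zero [simp]: "lin_ext b 0 = 0"
  by (simp add: lin_ext_def)

lemma lin_ext_single [simp]: "lin_ext b (Poly_Mapping.single x 1) = b x"
  by (rule poly_mapping_eqI) (simp add: lookup_lin_ext_superset[of "{x}"])

lemma lin_ext_id: "lin_ext (\<lambda>x. Poly_Mapping.single x 1) f = f"
  by (rule poly_mapping_eqI)
     (auto simp: lookup_lin_ext lookup_single when_def in_keys_iff if_distrib cong: if_cong)

lemma lin_ext_cong:
  assumes "\<And>x. x \<in> Poly_Mapping.keys f \<Longrightarrow> b x = c x"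
  shows "lin_ext b f = lin_ext c f"
  using assms by (simp add: lin_ext_def)

lemma keys_lin_ext:
  assumes "\<And>x. x \<in> Poly_Mapping.keys f \<Longrightarrow> Poly_Mapping.keys (b x) \<subseteq> A"
  shows "Poly_Mapping.keys (lin_ext b f) \<subseteq> A"
proof
  fix z assume "z \<in> Poly_Mapping.keys (lin_ext b f)"
  then have "(\<Sum>x\<in>Poly_Mapping.keys f. Poly_Mapping.lookup f x * Poly_Mapping.lookup (b x) z) \<noteq> 0"
    by (simp add: in_keys_iff lookup_lin_ext)
  then obtain x where "x \<in> Poly_Mapping.keys f" "Poly_Mapping.lookup (b x) z \<noteq> 0"
    by (metis (no_types, lifting) mult_zero_right sum.neutral)
  with assms[of x] show "z \<in> A" by (metis in_keys_iff subsetD)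
qed

lemma lin_ext_lin_ext: "lin_ext b (lin_ext c f) = lin_ext (\<lambda>x. lin_ext b (c x)) f"
proof (rule poly_mapping_eqI)
  fix z
  let ?A = "(\<Union>x\<in>Poly_Mapping.keys f. Poly_Mapping.keys (c x))"
  have fin: "finite ?A" by simp
  have k: "Poly_Mapping.keys (lin_ext c f) \<subseteq> ?A" by (rule keys_lin_ext) auto
  have k2: "Poly_Mapping.lookup (lin_ext b (c x)) z = (\<Sum>w\<in>?A. Poly_Mapping.lookup (c x) w * Poly_Mapping.lookup (b w) z)"
    if "x \<in> Poly_Mapping.keys f" for x
    by (rule lookup_lin_ext_superset) (use that in auto)
  show "Poly_Mapping.lookup (lin_ext b (lin_ext c f)) z = Poly_Mapping.lookup (lin_ext (\<lambda>x. lin_ext b (c x)) f) z"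
    unfolding lookup_lin_ext_superset[OF fin k] lookup_lin_ext[of _ f]
    by (simp add: k2 sum_distrib_left sum_distrib_right lookup_lin_ext[of c f] mult.assoc)
       (rule sum.swap)
qed

lemma ring_group_algebra:
  assumes "group G"
  shows "ring (group_algebra G :: (_ \<Rightarrow>\<^sub>0 'k::comm_ring_1) ring)" (is "ring ?A")
proof -
  interpret group G by fact
  have closed: "bilin_ext (\<lambda>g h. Poly_Mapping.single (g \<otimes>\<^bsub>G\<^esub> h) 1) f g \<in> carrier ?A"
    if "f \<in> carrier ?A" "g \<in> carrier ?A" for f g
    using that unfolding bilin_ext_def group_algebra_def
    by simp (intro keys_lin_ext, auto)
  show ?thesis
  proof (intro ringI abelian_groupI monoidI)
    fix f g h assume *: "f \<in> carrier ?A" "g \<in> carrier ?A" "h \<in> carrier ?A"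
    show "f \<otimes>\<^bsub>?A\<^esub> g \<otimes>\<^bsub>?A\<^esub> h = f \<otimes>\<^bsub>?A\<^esub> (g \<otimes>\<^bsub>?A\<^esub> h)"
      using * by (auto simp: group_algebra_def bilin_ext_def lin_ext_lin_ext m_assoc subset_iff
        intro!: lin_ext_cong)
    show "f \<oplus>\<^bsub>?A\<^esub> g \<in> carrier ?A"
      using * keys_add[of f g] by (auto simp: group_algebra_def)
  next
    fix f assume "f \<in> carrier ?A"
    then show "\<exists>y\<in>carrier ?A. y \<oplus>\<^bsub>?A\<^esub> f = \<zero>\<^bsub>?A\<^esub>"
      by (intro bexI[of _ "-f"]) (auto simp: group_algebra_def in_keys_iff subset_iff)
    show "\<one>\<^bsub>?A\<^esub> \<otimes>\<^bsub>?A\<^esub> f = f" using \<open>f \<in> carrier ?A\<close>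
      by (auto simp: group_algebra_def bilin_ext_def subset_iff
        intro!: trans[OF lin_ext_cong lin_ext_id])
    show "f \<otimes>\<^bsub>?A\<^esub> \<one>\<^bsub>?A\<^esub> = f" using \<open>f \<in> carrier ?A\<close>
      by (auto simp: group_algebra_def bilin_ext_def subset_iff
        intro!: trans[OF lin_ext_cong lin_ext_id])
  qed (use closed in \<open>auto simp: group_algebra_def bilin_ext_def lin_ext_add lin_ext_add_fun add.assoc add.commute\<close>)
qed


lemma right_module_matching:
  "right_module (sym_algebra m) (matching_module m :: (_, _ \<Rightarrow>\<^sub>0 'k::comm_ring_1) module)"
   (is "right_module ?A ?M")
proof -
  have act: "(\<lambda>e. \<sigma> -` e) ` x \<in> perfect_matchings {1..m}"
    if x: "x \<in> perfect_matchings {1..m}" and s: "\<sigma> permutes {1..m}" for x \<sigma>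
  proof -
    have U: "\<Union>((\<lambda>e. \<sigma> -` e) ` x) = \<sigma> -` \<Union>x" by blast
    have P: "\<Union>x = {1..m}" "disjoint x" "{} \<notin> x"
      using x unfolding perfect_matchings_def partition_on_def by blast+
    have "disjoint ((\<lambda>e. \<sigma> -` e) ` x)"
    proof (rule disjointI)
      fix c d assume "c \<in> (\<lambda>e. \<sigma> -` e) ` x" "d \<in> (\<lambda>e. \<sigma> -` e) ` x" "c \<noteq> d"
      then obtain e e' where e: "c = \<sigma> -` e" "d = \<sigma> -` e'" "e \<in> x" "e' \<in> x" "e \<noteq> e'" by blast
      then have "e \<inter> e' = {}" using P(2) by (meson disjointD)
      then show "c \<inter> d = {}" using e by blast
    qed
    moreover have "{} \<notin> (\<lambda>e. \<sigma> -` e) ` x"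
    proof
      assume "{} \<in> (\<lambda>e. \<sigma> -` e) ` x"
      then obtain e where "e \<in> x" "\<sigma> -` e = {}" by blast
      then show False
        using P(3) surj_image_vimage_eq[OF permutes_surj[OF s], of e] by (metis image_empty)
    qed
    ultimately have "partition_on (\<sigma> -` {1..m}) ((\<lambda>e. \<sigma> -` e) ` x)"
      unfolding partition_on_def U P(1) by blast
    moreover have "\<sigma> -` {1..m} = {1..m}" using permutes_in_image[OF s] by blast
    moreover have "card (\<sigma> -` e) = 2" if "e \<in> x" for e
      using that x permutes_inj[OF s] permutes_surj[OF s]
      by (auto simp: perfect_matchings_def card_vimage_inj)
    ultimately show ?thesis by (auto simp: perfect_matchings_def)
  qed
  interpret ring ?A by (rule ring_group_algebra[OF sym_group_is_group])
  have ab: "abelian_group ?M"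
  proof (rule abelian_groupI)
    fix f g assume *: "f \<in> carrier ?M" "g \<in> carrier ?M"
    then show "f \<oplus>\<^bsub>?M\<^esub> g \<in> carrier ?M"
      using keys_add[of f g] by (auto simp: matching_module_def)
  next
    fix f assume "f \<in> carrier ?M"
    then show "\<exists>y\<in>carrier ?M. y \<oplus>\<^bsub>?M\<^esub> f = \<zero>\<^bsub>?M\<^esub>"
      by (intro bexI[of _ "-f"]) (auto simp: matching_module_def in_keys_iff subset_iff)
  qed (auto simp: matching_module_def add.assoc add.commute)
  show ?thesis
  proof (intro right_module.intro right_module_axioms.intro ab ring_axioms)
    fix a x assume "a \<in> carrier ?A" "x \<in> carrier ?M"
    then show "a \<odot>\<^bsub>?M\<^esub> x \<in> carrier ?M"
      unfolding bilin_ext_def group_algebra_def matching_module_def sym_group_def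
      by simp (intro keys_lin_ext, use act in auto)
  next
    fix x assume "x \<in> carrier ?M"
    then show "\<one>\<^bsub>?A\<^esub> \<odot>\<^bsub>?M\<^esub> x = x"
      by (simp add: bilin_ext_def group_algebra_def matching_module_def sym_group_def lin_ext_id)
  next
    fix a b x
    show "(a \<otimes>\<^bsub>?A\<^esub> b) \<odot>\<^bsub>?M\<^esub> x = b \<odot>\<^bsub>?M\<^esub> (a \<odot>\<^bsub>?M\<^esub> x)"
      by (simp add: bilin_ext_def group_algebra_def matching_module_def sym_group_def lin_ext_lin_ext image_image vimage_comp comp_def)
  qed (simp_all add: bilin_ext_def group_algebra_def matching_module_def lin_ext_add lin_ext_add_fun)
qed

lemma stack_components_perm:
  assumes s: "\<sigma> permutes {1..r}" and t: "\<tau> permutes {1..r}"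
  shows "stack_components (perm_diagram r \<sigma>) (perm_diagram r \<tau>)
    = (\<lambda>j. {Top (\<sigma> (\<tau> j)), Mid (\<tau> j), Bot j}) ` {1..r}"
proof -
  let ?C = "\<lambda>j. {Top (\<sigma> (\<tau> j)), Mid (\<tau> j), Bot j}"
  let ?E = "stack_edges (perm_diagram r \<sigma>) (perm_diagram r \<tau>)"
  let ?R = "{(u, v). {u, v} \<in> ?E}"
  have E: "?E = (\<lambda>j. {Top (\<sigma> (\<tau> j)), Mid (\<tau> j)}) ` {1..r} \<union> (\<lambda>j. {Mid (\<tau> j), Bot j}) ` {1..r}"
  proof -
    have "?E = (\<lambda>i. {Top (\<sigma> i), Mid i}) ` (\<tau> ` {1..r}) \<union> (\<lambda>j. {Mid (\<tau> j), Bot j}) ` {1..r}"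
      by (simp only: permutes_image[OF t]) (simp add: stack_edges_def perm_diagram_def image_image)
    then show ?thesis by (simp only: image_image)
  qed
  have V: "\<Union>?E = \<Union>(?C ` {1..r})" unfolding E by auto
  have inj: "\<sigma> i = \<sigma> j \<longleftrightarrow> i = j" "\<tau> i = \<tau> j \<longleftrightarrow> i = j" for i j
    using permutes_inj[OF s] permutes_inj[OF t] by (auto dest: injD)
  have closed: "v \<in> ?C j" if "(u, v) \<in> ?R" "u \<in> ?C j" for u v j
  proof -
    from that(1) obtain i where
      "{u, v} = {Top (\<sigma> (\<tau> i)), Mid (\<tau> i)} \<or> {u, v} = {Mid (\<tau> i), Bot i}"
      unfolding E by blast
    then have uv: "u \<in> ?C i" "v \<in> ?C i" by blast+
    then have "i = j" using that(2) by (auto simp: inj)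
    with uv show ?thesis by simp
  qed
  have cls: "?R\<^sup>* `` {u} = ?C j" if j: "j \<in> {1..r}" "u \<in> ?C j" for u j
  proof
    show "?R\<^sup>* `` {u} \<subseteq> ?C j"
    proof
      fix v assume "v \<in> ?R\<^sup>* `` {u}"
      then have "(u, v) \<in> ?R\<^sup>*" by blast
      then show "v \<in> ?C j"
      proof induction
        case base
        show ?case by (rule j(2))
      next
        case (step y z)
        show ?case by (rule closed[OF step.hyps(2) step.IH])
      qed
    qed
    have "(Top (\<sigma> (\<tau> j)), Mid (\<tau> j)) \<in> ?R" "(Mid (\<tau> j), Bot j) \<in> ?R"
         "(Mid (\<tau> j), Top (\<sigma> (\<tau> j))) \<in> ?R" "(Bot j, Mid (\<tau> j)) \<in> ?R"
      using j unfolding E by (auto simp: insert_commute)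
    then have "(x, y) \<in> ?R\<^sup>*" if "x \<in> ?C j" "y \<in> ?C j" for x y
      using that by (auto intro: r_into_rtrancl rtrancl_trans[OF r_into_rtrancl r_into_rtrancl])
    then show "?C j \<subseteq> ?R\<^sup>* `` {u}" using j by auto
  qed
  show ?thesis
    unfolding stack_components_def V quotient_def
  proof (intro equalityI subsetI)
    fix C assume "C \<in> ?C ` {1..r}"
    then obtain j where j: "j \<in> {1..r}" "C = ?C j" by auto
    then have "C = ?R\<^sup>* `` {Bot j}" using cls[of j "Bot j"] by auto
    then show "C \<in> (\<Union>u\<in>\<Union>(?C ` {1..r}). {?R\<^sup>* `` {u}})" using j by blast
  next
    fix C assume "C \<in> (\<Union>u\<in>\<Union>(?C ` {1..r}). {?R\<^sup>* `` {u}})"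
    then obtain u j where "j \<in> {1..r}" "u \<in> ?C j" "C = ?R\<^sup>* `` {u}" by blast
    then show "C \<in> ?C ` {1..r}" using cls by blast
  qed
qed

lemma perm_diagram_comp:
  assumes s: "\<sigma> permutes {1..r}" and t: "\<tau> permutes {1..r}"
  shows "diagram_comp (perm_diagram r \<sigma>) (perm_diagram r \<tau>) = perm_diagram r (\<sigma> \<circ> \<tau>)"
    and "loops (perm_diagram r \<sigma>) (perm_diagram r \<tau>) = 0"
proof -
  have "case_sum Top Bot -` {Top (\<sigma> (\<tau> j)), Mid (\<tau> j), Bot j} = {Inl (\<sigma> (\<tau> j)), Inr j}" for j
    by (auto split: sum.splits)
  then show "diagram_comp (perm_diagram r \<sigma>) (perm_diagram r \<tau>) = perm_diagram r (\<sigma> \<circ> \<tau>)"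
    unfolding diagram_comp_def stack_components_perm[OF assms]
    by (auto simp: image_image perm_diagram_def)
  have "{C \<in> stack_components (perm_diagram r \<sigma>) (perm_diagram r \<tau>). C \<subseteq> range Mid} = {}"
    unfolding stack_components_perm[OF assms] by auto
  then show "loops (perm_diagram r \<sigma>) (perm_diagram r \<tau>) = 0"
    unfolding loops_def by (metis card.empty)
qed

lemma perm_diagram_in:
  assumes "\<sigma> permutes {1..r}" shows "perm_diagram r \<sigma> \<in> diagrams r r"
proof -
  have "\<Union>(perm_diagram r \<sigma>) = Inl ` (\<sigma> ` {1..r}) \<union> Inr ` {1..r}"
    by (auto simp: perm_diagram_def)
  moreover have "disjoint (perm_diagram r \<sigma>)"
    using permutes_inj[OF assms] by (auto simp: disjoint_def perm_diagram_def dest: injD)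
  ultimately show ?thesis
    unfolding diagrams_def perfect_matchings_def partition_on_def permutes_image[OF assms]
    by (auto simp: perm_diagram_def)
qed

lemma sym_to_brauer_hom:
  "sym_to_brauer r \<in> ring_hom (sym_algebra r) (brauer_algebra (\<delta>::'k::comm_ring_1) r)"
proof (rule ring_hom_memI)
  fix f :: "(nat \<Rightarrow> nat) \<Rightarrow>\<^sub>0 'k" assume f: "f \<in> carrier (sym_algebra r)"
  then show "sym_to_brauer r f \<in> carrier (brauer_algebra \<delta> r)"
    unfolding group_algebra_def brauer_algebra_def sym_to_brauer_def sym_group_def
    by simp (intro keys_lin_ext, use perm_diagram_in in auto)
  fix g :: "(nat \<Rightarrow> nat) \<Rightarrow>\<^sub>0 'k" assume g: "g \<in> carrier (sym_algebra r)"
  show "sym_to_brauer r (f \<otimes>\<^bsub>sym_algebra r\<^esub> g)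
    = sym_to_brauer r f \<otimes>\<^bsub>brauer_algebra \<delta> r\<^esub> sym_to_brauer r g"
    using f g
    by (auto simp: group_algebra_def brauer_algebra_def sym_to_brauer_def sym_group_def
      brauer_mult_def bilin_ext_def lin_ext_lin_ext perm_diagram_comp subset_iff intro!: lin_ext_cong)
qed (auto simp: group_algebra_def brauer_algebra_def sym_to_brauer_def sym_group_def lin_ext_add)

end

theory Submission
  imports Defs
begin

text \<open>
  A diagram in $D(p,r;p)$ has all its $p$ top points on propagating strands, so it is obtained from
  one whose strands are vertical, and whose remaining $r-p$ bottom points carry a perfect matching
  $\mu$, by a permutation $\tau$ of the bottom row; the pair $(\mu, \tau)$ is unique up to
  $\mathfrak S_{r-p}$. The isomorphism sends $(v \otimes \mu) \otimes \tau$ to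
  $v \otimes x_\mu \tau$, where $x_\mu$ is the diagram with vertical strands and matching $\mu$.
  It is compatible with the balancing relations because
  $x_\mu \cdot (\sigma, \rho) = \sigma \cdot x_{\mu\rho}$ for
  $(\sigma, \rho) \in \mathfrak S_p \times \mathfrak S_{r-p}$, and its inverse sends
  $v \otimes x_\mu \tau$ to $(v \otimes \mu) \otimes \tau$. Permutation diagrams create no loops
  and do not change propagating numbers, so neither $\delta$ nor the truncation plays a role.
\<close>

section \<open>Tensor products\<close>

text \<open>The tensor products here are quotients of free abelian groups, so no bases are at hand:
  a map out of one comes only from a balanced map, and two maps are compared on elementary tensors
  and then, being merely additive, on monomials with an arbitrary coefficient in each argument.
  Scalars are moved across tensor signs like other ring elements; they act as multiples of the unit
  of a group algebra.

  Two consequences shape the construction. The induction product is a tensor product of a tensor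
  product, so the forward map is lifted twice, the permutation being a parameter of the first lift.
  The inverse has no formula without choices: a pair (mu, tau) is picked for each diagram, and the
  relation over K[S_p x S_{r-p}] makes the result independent of the pick. Equivariance is checked
  for the forward map alone. Parity causes no case distinction: for odd r-p there are no matchings,
  and D(p,r;p) is empty as well.\<close>

definition elem_tensor ::
    "('a, 'r) ring_scheme \<Rightarrow> ('a, 'v, 'm) module_scheme \<Rightarrow> ('a, 'w, 'n) module_scheme
      \<Rightarrow> 'v \<Rightarrow> 'w \<Rightarrow> ('v \<times> 'w \<Rightarrow>\<^sub>0 int) set"
  where "elem_tensor R V W v w = tensor_kernel R V W #>\<^bsub>tensor_free V W\<^esub> frag_of (v, w)"

text \<open>The middle-linear maps known from tensor products over noncommutative rings. Of the
  codomain only the addition enters, which allows it to be a module over a ring other than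
  \<open>R\<close>.\<close>

definition balanced ::
    "('a, 'r) ring_scheme \<Rightarrow> ('a, 'v, 'm) module_scheme \<Rightarrow> ('a, 'w, 'n) module_scheme
      \<Rightarrow> ('b, 'c, 'k) module_scheme \<Rightarrow> ('v \<Rightarrow> 'w \<Rightarrow> 'c) \<Rightarrow> bool"
  where "balanced R V W A \<beta> \<longleftrightarrow>
    (\<forall>v\<in>carrier V. \<forall>w\<in>carrier W. \<beta> v w \<in> carrier A) \<and>
    (\<forall>v\<in>carrier V. \<forall>v'\<in>carrier V. \<forall>w\<in>carrier W. \<beta> (v \<oplus>\<^bsub>V\<^esub> v') w = \<beta> v w \<oplus>\<^bsub>A\<^esub> \<beta> v' w) \<and>
    (\<forall>v\<in>carrier V. \<forall>w\<in>carrier W. \<forall>w'\<in>carrier W. \<beta> v (w \<oplus>\<^bsub>W\<^esub> w') = \<beta> v w \<oplus>\<^bsub>A\<^esub> \<beta> v w') \<and>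
    (\<forall>a\<in>carrier R. \<forall>v\<in>carrier V. \<forall>w\<in>carrier W. \<beta> (a \<odot>\<^bsub>V\<^esub> v) w = \<beta> v (a \<odot>\<^bsub>W\<^esub> w))"

lemma balancedI:
  assumes "\<And>v w. v \<in> carrier V \<Longrightarrow> w \<in> carrier W \<Longrightarrow> \<beta> v w \<in> carrier A"
    and "\<And>v v' w. v \<in> carrier V \<Longrightarrow> v' \<in> carrier V \<Longrightarrow> w \<in> carrier W
      \<Longrightarrow> \<beta> (v \<oplus>\<^bsub>V\<^esub> v') w = \<beta> v w \<oplus>\<^bsub>A\<^esub> \<beta> v' w"
    and "\<And>v w w'. v \<in> carrier V \<Longrightarrow> w \<in> carrier W \<Longrightarrow> w' \<in> carrier W
      \<Longrightarrow> \<beta> v (w \<oplus>\<^bsub>W\<^esub> w') = \<beta> v w \<oplus>\<^bsub>A\<^esub> \<beta> v w'"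
    and "\<And>a v w. a \<in> carrier R \<Longrightarrow> v \<in> carrier V \<Longrightarrow> w \<in> carrier W
      \<Longrightarrow> \<beta> (a \<odot>\<^bsub>V\<^esub> v) w = \<beta> v (a \<odot>\<^bsub>W\<^esub> w)"
  shows "balanced R V W A \<beta>"
  using assms by (simp add: balanced_def)

lemma hom_add_monoidI:
  assumes "\<And>x. x \<in> carrier M \<Longrightarrow> h x \<in> carrier N"
    and "\<And>x y. x \<in> carrier M \<Longrightarrow> y \<in> carrier M \<Longrightarrow> h (x \<oplus>\<^bsub>M\<^esub> y) = h x \<oplus>\<^bsub>N\<^esub> h y"
  shows "h \<in> hom (add_monoid M) (add_monoid N)"
  using assms by (auto simp: hom_def)

lemma
  assumes "h \<in> hom (add_monoid M) (add_monoid N)"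
  shows hom_add_closed: "x \<in> carrier M \<Longrightarrow> h x \<in> carrier N"
    and hom_add_add: "x \<in> carrier M \<Longrightarrow> y \<in> carrier M \<Longrightarrow> h (x \<oplus>\<^bsub>M\<^esub> y) = h x \<oplus>\<^bsub>N\<^esub> h y"
  using assms by (auto simp: hom_def)

lemma hom_add_comp:
  assumes "h \<in> hom (add_monoid M) (add_monoid N)" "k \<in> hom (add_monoid N) (add_monoid P)"
  shows "(\<lambda>x. k (h x)) \<in> hom (add_monoid M) (add_monoid P)"
  using assms by (auto simp: hom_def Pi_iff)

lemma hom_add_sum:
  assumes "abelian_group N" "h \<in> hom (add_monoid M) (add_monoid N)" "k \<in> hom (add_monoid M) (add_monoid N)"
  shows "(\<lambda>x. h x \<oplus>\<^bsub>N\<^esub> k x) \<in> hom (add_monoid M) (add_monoid N)"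
proof -
  interpret N: abelian_group N by fact
  show ?thesis
    using assms(2,3) by (auto simp: hom_def Pi_iff N.a_ac)
qed

text \<open>Closure of both carriers under the scalars is what puts the relators into the free
  abelian group; from there on the quotient has its universal property. As no further module axioms
  are demanded, none has to be proved for the diagram bimodule, the external tensor product or the
  induction bimodule.\<close>

locale tensor_pair =
  fixes R :: "('a, 'r) ring_scheme" and V :: "('a, 'v, 'm) module_scheme"
    and W :: "('a, 'w, 'n) module_scheme"
  assumes V: "abelian_group V" and W: "abelian_group W"
    and smult_V: "a \<in> carrier R \<Longrightarrow> v \<in> carrier V \<Longrightarrow> a \<odot>\<^bsub>V\<^esub> v \<in> carrier V"
    and smult_W: "a \<in> carrier R \<Longrightarrow> w \<in> carrier W \<Longrightarrow> a \<odot>\<^bsub>W\<^esub> w \<in> carrier W"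
begin

sublocale V: abelian_group V by (rule V)
sublocale W: abelian_group W by (rule W)

abbreviation "F \<equiv> tensor_free V W"
abbreviation "K \<equiv> tensor_kernel R V W"
abbreviation "T \<equiv> tensor_module R V W"
abbreviation "et \<equiv> elem_tensor R V W"

sublocale F: comm_group F
  unfolding tensor_free_def by (rule abelian_free_Abelian_group)

lemma relators_closed: "tensor_relators R V W \<subseteq> carrier F"
proof -
  have "x - y \<in> carrier F" if "x \<in> carrier F" "y \<in> carrier F" for x y
    using that keys_diff[of x y] by (auto simp: tensor_free_def)
  moreover have "frag_of (v, w) \<in> carrier F" if "v \<in> carrier V" "w \<in> carrier W" for v w
    using that by (simp add: tensor_free_def)
  ultimately show ?thesis
    unfolding tensor_relators_def using smult_V smult_W by auto
qed

lemma subgroup_kernel: "subgroup K F"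
  unfolding tensor_kernel_def by (rule F.generate_is_subgroup[OF relators_closed])

sublocale K: normal K F
  using subgroup_kernel by (simp add: F.normal_iff_subgroup)

lemma
  shows carrier_tensor_Mod: "carrier (T act) = carrier (F Mod K)"
    and add_tensor_Mod: "add (T act) = monoid.mult (F Mod K)"
    and zero_tensor_Mod: "zero (T act) = one (F Mod K)"
  by (simp_all add: tensor_module_def Let_def)

lemma abelian_group_tensor: "abelian_group (T act)"
proof -
  interpret Q: comm_group "F Mod K"
    by (rule F.abelian_FactGroup[OF subgroup_kernel])
  show ?thesis
    by (rule abelian_groupI; unfold carrier_tensor_Mod add_tensor_Mod zero_tensor_Mod)
      (auto simp: Q.m_ac simp del: mult_FactGroup one_FactGroup intro: Q.l_inv_ex)
qed

lemma frag_of_closed: "v \<in> carrier V \<Longrightarrow> w \<in> carrier W \<Longrightarrow> frag_of (v, w) \<in> carrier F"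
  by (simp add: tensor_free_def)

lemma mult_F: "x \<otimes>\<^bsub>F\<^esub> y = x + y"
  by (simp add: tensor_free_def)

lemma carrier_tensor: "carrier (T act) = (\<lambda>x. K #>\<^bsub>F\<^esub> x) ` carrier F"
  by (simp add: tensor_module_def Let_def carrier_FactGroup)

lemma add_tensor:
  "x \<in> carrier F \<Longrightarrow> y \<in> carrier F \<Longrightarrow> (K #>\<^bsub>F\<^esub> x) \<oplus>\<^bsub>T act\<^esub> (K #>\<^bsub>F\<^esub> y) = K #>\<^bsub>F\<^esub> (x + y)"
  by (simp add: tensor_module_def Let_def K.rcos_sum mult_F)

lemma coset_eqI:
  assumes "x \<in> carrier F" "y \<in> carrier F" "x - y \<in> K"
  shows "K #>\<^bsub>F\<^esub> x = K #>\<^bsub>F\<^esub> y"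
proof -
  have "x = (x - y) \<otimes>\<^bsub>F\<^esub> y" by (simp add: mult_F)
  then have "x \<in> K #>\<^bsub>F\<^esub> y"
    using assms(3) by (auto simp: r_coset_def)
  then show ?thesis
    using F.repr_independence[OF _ assms(2) subgroup_kernel] by simp
qed

lemma relator_in_kernel: "x \<in> tensor_relators R V W \<Longrightarrow> x \<in> K"
  unfolding tensor_kernel_def by (rule generate.incl)

lemma elem_tensor_closed: "v \<in> carrier V \<Longrightarrow> w \<in> carrier W \<Longrightarrow> et v w \<in> carrier (T act)"
  by (auto simp: elem_tensor_def carrier_tensor frag_of_closed)

lemma plus_closed: "x \<in> carrier F \<Longrightarrow> y \<in> carrier F \<Longrightarrow> x + y \<in> carrier F"
  using F.m_closed[of x y] by (simp add: mult_F)

lemma balanced_elem_tensor: "balanced R V W (T act) et"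
proof (rule balancedI)
  fix v v' w assume *: "v \<in> carrier V" "v' \<in> carrier V" "w \<in> carrier W"
  have "frag_of (v \<oplus>\<^bsub>V\<^esub> v', w) - (frag_of (v, w) + frag_of (v', w)) \<in> K"
    using * by (intro relator_in_kernel) (auto simp: tensor_relators_def diff_diff_eq)
  then show "et (v \<oplus>\<^bsub>V\<^esub> v') w = et v w \<oplus>\<^bsub>T act\<^esub> et v' w"
    using * unfolding elem_tensor_def
    by (simp add: add_tensor frag_of_closed coset_eqI plus_closed)
next
  fix v w w' assume *: "v \<in> carrier V" "w \<in> carrier W" "w' \<in> carrier W"
  have "frag_of (v, w \<oplus>\<^bsub>W\<^esub> w') - (frag_of (v, w) + frag_of (v, w')) \<in> K"
    using * by (intro relator_in_kernel) (auto simp: tensor_relators_def diff_diff_eq)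
  then show "et v (w \<oplus>\<^bsub>W\<^esub> w') = et v w \<oplus>\<^bsub>T act\<^esub> et v w'"
    using * unfolding elem_tensor_def
    by (simp add: add_tensor frag_of_closed coset_eqI plus_closed)
next
  fix a v w assume *: "a \<in> carrier R" "v \<in> carrier V" "w \<in> carrier W"
  have "frag_of (a \<odot>\<^bsub>V\<^esub> v, w) - frag_of (v, a \<odot>\<^bsub>W\<^esub> w) \<in> K"
    using * by (intro relator_in_kernel) (auto simp: tensor_relators_def)
  then show "et (a \<odot>\<^bsub>V\<^esub> v) w = et v (a \<odot>\<^bsub>W\<^esub> w)"
    using * unfolding elem_tensor_def
    by (simp add: frag_of_closed coset_eqI smult_V smult_W)
qed (rule elem_tensor_closed)

text \<open>Balancedness says that each of the three kinds of relator is killed, and the kernel of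
  \<open>h\<close> is a subgroup, so it contains all that they generate. This serves to factor a map
  through the quotient and also to see that an action on representatives respects cosets.\<close>

lemma kernel_vanish:
  assumes A: "abelian_group A" and h: "h \<in> hom F (add_monoid A)"
    and b: "balanced R V W A (\<lambda>v w. h (frag_of (v, w)))" and x: "x \<in> K"
  shows "h x = \<zero>\<^bsub>A\<^esub>"
proof -
  interpret A: abelian_group A by fact
  interpret h: group_hom F "add_monoid A" h
    by (intro group_hom.intro group_hom_axioms.intro F.is_group A.a_group h)
  have diff: "h (x - y) = h x \<ominus>\<^bsub>A\<^esub> h y" if "x \<in> carrier F" "y \<in> carrier F" for x y
  proof -
    have *: "x - y \<in> carrier F"
      using that keys_diff[of x y] by (auto simp: tensor_free_def)
    have "h x = h ((x - y) \<otimes>\<^bsub>F\<^esub> y)" by (simp add: mult_F)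
    then have "h x = h (x - y) \<oplus>\<^bsub>A\<^esub> h y"
      using * that by simp
    moreover have "h (x - y) \<in> carrier A" "h y \<in> carrier A"
      using h.hom_closed * that by auto
    ultimately show ?thesis by (simp add: A.minus_eq A.a_assoc A.r_neg)
  qed
  have "subgroup (kernel F (add_monoid A) h) F" by (rule h.subgroup_kernel)
  moreover have "tensor_relators R V W \<subseteq> kernel F (add_monoid A) h"
  proof
    fix x assume x: "x \<in> tensor_relators R V W"
    then have "x \<in> carrier F" using relators_closed by auto
    moreover have "h x = \<zero>\<^bsub>A\<^esub>"
    proof -
      have *: "h (frag_of (v, w)) \<in> carrier A" if "v \<in> carrier V" "w \<in> carrier W" for v w
        using b that by (auto simp: balanced_def)
      have d: "frag_of x - frag_of y \<in> carrier F" if "frag_of x \<in> carrier F" "frag_of y \<in> carrier F" for x y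
        using that keys_diff[of "frag_of x" "frag_of y"] by (auto simp: tensor_free_def)
      have e: "c \<ominus>\<^bsub>A\<^esub> a \<ominus>\<^bsub>A\<^esub> b = \<zero>\<^bsub>A\<^esub>" if "c = a \<oplus>\<^bsub>A\<^esub> b" "a \<in> carrier A" "b \<in> carrier A" for a b c
      proof -
        have "c \<ominus>\<^bsub>A\<^esub> a = b"
          using that by (simp add: A.minus_eq A.a_comm[of a b] A.a_assoc A.r_neg)
        with that show ?thesis by (simp add: A.minus_eq A.r_neg)
      qed
      have e2: "c \<ominus>\<^bsub>A\<^esub> a = \<zero>\<^bsub>A\<^esub>" if "c = a" "a \<in> carrier A" for a c
        using that by (simp add: A.minus_eq A.r_neg)
      from x consider
          (1) v v' w where "x = frag_of (v \<oplus>\<^bsub>V\<^esub> v', w) - frag_of (v, w) - frag_of (v', w)"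
            "v \<in> carrier V" "v' \<in> carrier V" "w \<in> carrier W"
        | (2) v w w' where "x = frag_of (v, w \<oplus>\<^bsub>W\<^esub> w') - frag_of (v, w) - frag_of (v, w')"
            "v \<in> carrier V" "w \<in> carrier W" "w' \<in> carrier W"
        | (3) a v w where "x = frag_of (a \<odot>\<^bsub>V\<^esub> v, w) - frag_of (v, a \<odot>\<^bsub>W\<^esub> w)"
            "a \<in> carrier R" "v \<in> carrier V" "w \<in> carrier W"
        unfolding tensor_relators_def by blast
      then show ?thesis
      proof cases
        case 1
        then have "h (frag_of (v \<oplus>\<^bsub>V\<^esub> v', w)) = h (frag_of (v, w)) \<oplus>\<^bsub>A\<^esub> h (frag_of (v', w))"
          using b by (auto simp: balanced_def)
        then show ?thesis using 1 by (simp add: diff frag_of_closed d e *)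
      next
        case 2
        then have "h (frag_of (v, w \<oplus>\<^bsub>W\<^esub> w')) = h (frag_of (v, w)) \<oplus>\<^bsub>A\<^esub> h (frag_of (v, w'))"
          using b by (auto simp: balanced_def)
        then show ?thesis using 2 by (simp add: diff frag_of_closed d e *)
      next
        case 3
        then have "h (frag_of (a \<odot>\<^bsub>V\<^esub> v, w)) = h (frag_of (v, a \<odot>\<^bsub>W\<^esub> w))"
          using b by (auto simp: balanced_def)
        then show ?thesis using 3 by (simp add: diff frag_of_closed smult_V smult_W e2 *)
      qed
    qed
    ultimately show "x \<in> kernel F (add_monoid A) h" by (simp add: kernel_def)
  qed
  ultimately have "K \<subseteq> kernel F (add_monoid A) h"
    unfolding tensor_kernel_def by (intro F.generate_subgroup_incl)
  then show ?thesis using x by (auto simp: kernel_def)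
qed

text \<open>Existence half of the universal property; uniqueness is \<open>tensor_ext\<close>. The
  factorization is through \<open>F Mod K\<close>, which shares carrier and addition with
  \<open>T act\<close> for every \<open>act\<close>.\<close>

lemma tensor_lift:
  assumes A: "abelian_group A" and b: "balanced R V W A \<beta>"
  obtains h where "h \<in> hom (add_monoid (T act)) (add_monoid A)"
    "\<And>v w. v \<in> carrier V \<Longrightarrow> w \<in> carrier W \<Longrightarrow> h (et v w) = \<beta> v w"
proof -
  interpret A: abelian_group A by fact
  have "(\<lambda>(v, w). \<beta> v w) ` (carrier V \<times> carrier W) \<subseteq> carrier (add_monoid A)"
    using b by (auto simp: balanced_def)
  then obtain h where h: "h \<in> hom F (add_monoid A)"
    and hf: "\<And>x. x \<in> carrier V \<times> carrier W \<Longrightarrow> h (frag_of x) = (\<lambda>(v, w). \<beta> v w) x"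
    using comm_group.free_Abelian_group_universal[OF A.a_comm_group] unfolding tensor_free_def by metis
  interpret h: group_hom F "add_monoid A" h
    by (intro group_hom.intro group_hom_axioms.intro F.is_group A.a_group h)
  have "balanced R V W A (\<lambda>v w. h (frag_of (v, w)))"
    using b by (simp add: balanced_def hf smult_V smult_W)
  then have "K \<subseteq> kernel F (add_monoid A) h"
    using kernel_vanish[OF A h] K.subset by (auto simp: kernel_def)
  then obtain g where g: "g \<in> hom (F Mod K) (add_monoid A)"
    and gh: "\<And>x. x \<in> carrier F \<Longrightarrow> g (K #>\<^bsub>F\<^esub> x) = h x"
    using h.FactGroup_universal_kernel[OF K.normal_axioms] by metis
  show thesis
  proof
    show "g \<in> hom (add_monoid (T act)) (add_monoid A)"
      using g by (simp add: hom_def carrier_tensor_Mod add_tensor_Mod)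
    show "g (et v w) = \<beta> v w" if "v \<in> carrier V" "w \<in> carrier W" for v w
      using that by (simp add: elem_tensor_def gh frag_of_closed hf)
  qed
qed

lemma zero_tensor_coset: "K #>\<^bsub>F\<^esub> 0 = \<zero>\<^bsub>T act\<^esub>"
  using F.coset_join2[OF F.one_closed subgroup_kernel subgroup.one_closed[OF subgroup_kernel]]
  by (simp add: tensor_module_def Let_def) (simp add: tensor_free_def)

text \<open>The cosets of the free generators generate the quotient, so an additive map out of it is
  determined by its values there.\<close>

lemma tensor_ext:
  assumes A: "abelian_group A"
    and h: "h \<in> hom (add_monoid (T act)) (add_monoid A)"
    and k: "k \<in> hom (add_monoid (T act)) (add_monoid A)"
    and eq: "\<And>v w. v \<in> carrier V \<Longrightarrow> w \<in> carrier W \<Longrightarrow> h (et v w) = k (et v w)"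
    and x: "x \<in> carrier (T act)"
  shows "h x = k x"
proof -
  interpret A: abelian_group A by fact
  interpret T: abelian_group "T act" by (rule abelian_group_tensor)
  obtain y where y: "y \<in> carrier F" "x = K #>\<^bsub>F\<^esub> y"
    using x by (auto simp: carrier_tensor)
  have "Poly_Mapping.keys y \<subseteq> carrier V \<times> carrier W"
    using y by (simp add: tensor_free_def)
  then have "y \<in> carrier F \<and> h (K #>\<^bsub>F\<^esub> y) = k (K #>\<^bsub>F\<^esub> y)"
  proof (induction y rule: frag_induction)
    case zero
    show ?case
      using zero_tensor_coset[of act] hom_one[OF h T.a_group A.a_group] hom_one[OF k T.a_group A.a_group] F.one_closed
      by (simp add: tensor_free_def)
  next
    case (diff a b)
    then have F: "a \<in> carrier F" "b \<in> carrier F" "a - b \<in> carrier F"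
      using keys_diff[of a b] by (auto simp: tensor_free_def)
    then have T: "K #>\<^bsub>F\<^esub> a \<in> carrier (T act)" "K #>\<^bsub>F\<^esub> b \<in> carrier (T act)"
        "K #>\<^bsub>F\<^esub> (a - b) \<in> carrier (T act)"
      by (auto simp: carrier_tensor)
    \<comment> \<open>The induction principle closes under differences, while the maps are known to
      respect sums. Writing \<open>a = (a - b) + b\<close> turns one into the other, and the common
      value at \<open>b\<close> is cancelled.\<close>
    have e: "K #>\<^bsub>F\<^esub> a = (K #>\<^bsub>F\<^esub> (a - b)) \<oplus>\<^bsub>T act\<^esub> (K #>\<^bsub>F\<^esub> b)"
      by (simp add: add_tensor F)
    have "h (K #>\<^bsub>F\<^esub> (a - b)) \<oplus>\<^bsub>A\<^esub> h (K #>\<^bsub>F\<^esub> b) = k (K #>\<^bsub>F\<^esub> (a - b)) \<oplus>\<^bsub>A\<^esub> h (K #>\<^bsub>F\<^esub> b)"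
      using hom_add_add[OF h T(3,2)] hom_add_add[OF k T(3,2)] diff e by simp
    then show ?case
      using hom_add_closed[OF h] hom_add_closed[OF k] T F by (simp add: A.add.r_cancel)
  next
    case (one a)
    then show ?case using eq by (auto simp: elem_tensor_def frag_of_closed)
  qed
  with y show ?thesis by simp
qed

text \<open>The module record defines the action on a coset as a union over its representatives, for
  any \<open>act\<close> whatsoever. If the class of \<open>act b (v, w)\<close> is balanced in
  \<open>v\<close> and \<open>w\<close>, the additive extension maps the kernel into itself, and the
  union collapses to the coset of the image of a single representative.\<close>

lemma tensor_smult:
  assumes act: "\<And>v w. v \<in> carrier V \<Longrightarrow> w \<in> carrier W \<Longrightarrow> act b (v, w) \<in> carrier F"
    and bal: "balanced R V W (T act) (\<lambda>v w. K #>\<^bsub>F\<^esub> act b (v, w))"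
  shows tensor_smult_hom: "(\<lambda>x. b \<odot>\<^bsub>T act\<^esub> x) \<in> hom (add_monoid (T act)) (add_monoid (T act))"
    and tensor_smult_elem: "\<And>v w. v \<in> carrier V \<Longrightarrow> w \<in> carrier W
      \<Longrightarrow> b \<odot>\<^bsub>T act\<^esub> et v w = K #>\<^bsub>F\<^esub> act b (v, w)"
proof -
  let ?e = "frag_extend (act b)"
  have e: "?e x \<in> carrier F" if "x \<in> carrier F" for x
  proof -
    have "Poly_Mapping.keys (act b y) \<subseteq> carrier V \<times> carrier W" if "y \<in> Poly_Mapping.keys x" for y
    proof -
      have "y \<in> carrier V \<times> carrier W"
        using that \<open>x \<in> carrier F\<close> by (auto simp: tensor_free_def)
      then show ?thesis
        using act[of "fst y" "snd y"] by (simp add: tensor_free_def mem_Times_iff)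
    qed
    then show ?thesis
      using keys_frag_extend[of "act b" x] by (fastforce simp: tensor_free_def)
  qed
  let ?h = "\<lambda>x. K #>\<^bsub>F\<^esub> ?e x"
  have h: "?h \<in> hom F (add_monoid (T act))"
  proof (rule homI)
    fix x y assume "x \<in> carrier F" "y \<in> carrier F"
    then show "?h (x \<otimes>\<^bsub>F\<^esub> y) = ?h x \<otimes>\<^bsub>add_monoid (T act)\<^esub> ?h y"
      by (simp add: mult_F frag_extend_add add_tensor e)
  qed (auto simp: carrier_tensor e)
  have "balanced R V W (T act) (\<lambda>v w. ?h (frag_of (v, w)))"
    using bal by simp
  then have z: "?h x = \<zero>\<^bsub>T act\<^esub>" if "x \<in> K" for x
    using kernel_vanish[OF abelian_group_tensor h _ that] by simp
  \<comment> \<open>\<open>?e x\<close> lies in its own coset, and that coset is the zero of the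
    quotient, namely \<open>K\<close>.\<close>
  have eK: "?e x \<in> K" if "x \<in> K" for x
  proof -
    have "x \<in> carrier F" using that K.subset by auto
    moreover have "K #>\<^bsub>F\<^esub> ?e x = K"
      using z[OF that] by (simp add: tensor_module_def Let_def)
    ultimately show ?thesis
      using F.rcos_self[OF e subgroup_kernel] by metis
  qed
  have s: "b \<odot>\<^bsub>T act\<^esub> (K #>\<^bsub>F\<^esub> x) = K #>\<^bsub>F\<^esub> ?e x" if x: "x \<in> carrier F" for x
  proof -
    have "K <#>\<^bsub>F\<^esub> (?e ` (K #>\<^bsub>F\<^esub> x)) = K #>\<^bsub>F\<^esub> ?e x"
    proof (intro equalityI subsetI)
      fix y assume "y \<in> K <#>\<^bsub>F\<^esub> (?e ` (K #>\<^bsub>F\<^esub> x))"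
      then obtain n m where n: "n \<in> K" "m \<in> K" "y = n + ?e (m + x)"
        by (auto simp: set_mult_def r_coset_def mult_F)
      then have "y = (n + ?e m) + ?e x" by (simp add: frag_extend_add add.assoc)
      moreover have "n + ?e m \<in> K"
        using subgroup.m_closed[OF subgroup_kernel n(1) eK[OF n(2)]] by (simp add: mult_F)
      ultimately show "y \<in> K #>\<^bsub>F\<^esub> ?e x" by (auto simp: r_coset_def mult_F)
    next
      fix y assume "y \<in> K #>\<^bsub>F\<^esub> ?e x"
      moreover have "x \<in> K #>\<^bsub>F\<^esub> x" by (rule F.rcos_self[OF x subgroup_kernel])
      ultimately show "y \<in> K <#>\<^bsub>F\<^esub> (?e ` (K #>\<^bsub>F\<^esub> x))"
        by (auto simp: r_coset_def[of F K "?e x"] set_mult_def)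
    qed
    then show ?thesis by (simp add: tensor_module_def Let_def)
  qed
  show "(\<lambda>x. b \<odot>\<^bsub>T act\<^esub> x) \<in> hom (add_monoid (T act)) (add_monoid (T act))"
    by (rule hom_add_monoidI)
      (auto simp: carrier_tensor s e add_tensor plus_closed frag_extend_add)
  show "b \<odot>\<^bsub>T act\<^esub> et v w = K #>\<^bsub>F\<^esub> act b (v, w)" if "v \<in> carrier V" "w \<in> carrier W" for v w
    using that by (simp add: elem_tensor_def s frag_of_closed)
qed

lemma
  assumes "v \<in> carrier V" "w \<in> carrier W"
  shows et_add_left: "v' \<in> carrier V \<Longrightarrow> et (v \<oplus>\<^bsub>V\<^esub> v') w = et v w \<oplus>\<^bsub>T act\<^esub> et v' w"
    and et_add_right: "w' \<in> carrier W \<Longrightarrow> et v (w \<oplus>\<^bsub>W\<^esub> w') = et v w \<oplus>\<^bsub>T act\<^esub> et v w'"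
    and et_smult: "a \<in> carrier R \<Longrightarrow> et (a \<odot>\<^bsub>V\<^esub> v) w = et v (a \<odot>\<^bsub>W\<^esub> w)"
  using balanced_elem_tensor[of act] assms by (auto simp: balanced_def)

lemma et_hom_left: "w \<in> carrier W \<Longrightarrow> (\<lambda>v. et v w) \<in> hom (add_monoid V) (add_monoid (T act))"
  by (rule hom_add_monoidI) (simp_all add: elem_tensor_closed et_add_left)

lemma et_hom_right: "v \<in> carrier V \<Longrightarrow> et v \<in> hom (add_monoid W) (add_monoid (T act))"
  by (rule hom_add_monoidI) (simp_all add: elem_tensor_closed et_add_right)

lemma et_zero_left: "w \<in> carrier W \<Longrightarrow> et \<zero>\<^bsub>V\<^esub> w = \<zero>\<^bsub>T act\<^esub>"
  using hom_one[OF et_hom_left V.a_group abelian_group.a_group[OF abelian_group_tensor]] by simp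

lemma et_zero_right: "v \<in> carrier V \<Longrightarrow> et v \<zero>\<^bsub>W\<^esub> = \<zero>\<^bsub>T act\<^esub>"
  using hom_one[OF et_hom_right W.a_group abelian_group.a_group[OF abelian_group_tensor]] by simp

text \<open>The action on an external tensor product takes values in sums of generators; this turns
  their class into a finite sum of elementary tensors.\<close>

lemma coset_sum:
  assumes "finite I" "\<And>i. i \<in> I \<Longrightarrow> f i \<in> carrier F"
  shows "sum f I \<in> carrier F" "K #>\<^bsub>F\<^esub> (sum f I) = (\<Oplus>\<^bsub>T act\<^esub>i\<in>I. K #>\<^bsub>F\<^esub> f i)"
proof -
  interpret T: abelian_group "T act" by (rule abelian_group_tensor)
  have "sum f I \<in> carrier F \<and> K #>\<^bsub>F\<^esub> (sum f I) = (\<Oplus>\<^bsub>T act\<^esub>i\<in>I. K #>\<^bsub>F\<^esub> f i)"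
    using assms
  proof (induction I)
    case empty
    then show ?case using zero_tensor_coset F.one_closed by (simp add: tensor_free_def)
  next
    case (insert i I)
    have "(\<lambda>i. K #>\<^bsub>F\<^esub> f i) \<in> I \<rightarrow> carrier (T act)" "K #>\<^bsub>F\<^esub> f i \<in> carrier (T act)"
      using insert.prems by (auto simp: carrier_tensor)
    then have "(\<Oplus>\<^bsub>T act\<^esub>i\<in>insert i I. K #>\<^bsub>F\<^esub> f i) = (K #>\<^bsub>F\<^esub> f i) \<oplus>\<^bsub>T act\<^esub> (\<Oplus>\<^bsub>T act\<^esub>i\<in>I. K #>\<^bsub>F\<^esub> f i)"
      using insert.hyps by (intro T.finsum_insert)
    moreover have "sum f I \<in> carrier F" "K #>\<^bsub>F\<^esub> sum f I = (\<Oplus>\<^bsub>T act\<^esub>i\<in>I. K #>\<^bsub>F\<^esub> f i)" "f i \<in> carrier F"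
      using insert by simp_all
    ultimately show ?case
      using insert.hyps by (simp add: add_tensor[of "f i" "sum f I" act, symmetric] plus_closed)
  qed
  then show "sum f I \<in> carrier F" "K #>\<^bsub>F\<^esub> (sum f I) = (\<Oplus>\<^bsub>T act\<^esub>i\<in>I. K #>\<^bsub>F\<^esub> f i)" by auto
qed

text \<open>The bimodule case: \<open>f\<close> is right multiplication by \<open>b\<close>, and its
  commuting with the left scalars is the condition for it to descend to the tensor product.\<close>

lemma tensor_smult_right:
  assumes act: "\<And>v w. act b (v, w) = frag_of (v, f w)"
    and f: "f \<in> hom (add_monoid W) (add_monoid W)"
    and com: "\<And>a w. a \<in> carrier R \<Longrightarrow> w \<in> carrier W \<Longrightarrow> f (a \<odot>\<^bsub>W\<^esub> w) = a \<odot>\<^bsub>W\<^esub> f w"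
  shows tensor_smult_right_hom: "(\<lambda>x. b \<odot>\<^bsub>T act\<^esub> x) \<in> hom (add_monoid (T act)) (add_monoid (T act))"
    and tensor_smult_right_elem: "\<And>v w. v \<in> carrier V \<Longrightarrow> w \<in> carrier W \<Longrightarrow> b \<odot>\<^bsub>T act\<^esub> et v w = et v (f w)"
proof -
  note fc = hom_add_closed[OF f]
  have "balanced R V W (T act) (\<lambda>v w. K #>\<^bsub>F\<^esub> act b (v, w))"
    unfolding act elem_tensor_def[symmetric]
    by (rule balancedI)
      (simp_all add: fc com elem_tensor_closed et_add_left et_add_right[of _ _ _ act] hom_add_add[OF f] et_smult)
  moreover have "act b (v, w) \<in> carrier F" if "v \<in> carrier V" "w \<in> carrier W" for v w
    using that by (simp add: act frag_of_closed fc)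
  ultimately show "(\<lambda>x. b \<odot>\<^bsub>T act\<^esub> x) \<in> hom (add_monoid (T act)) (add_monoid (T act))"
    and "\<And>v w. v \<in> carrier V \<Longrightarrow> w \<in> carrier W \<Longrightarrow> b \<odot>\<^bsub>T act\<^esub> et v w = et v (f w)"
    using tensor_smult[of act b] by (auto simp: act elem_tensor_def)
qed

end

text \<open>Linearity is demanded of \<open>g\<close> and transported to its inverse
  \<open>f\<close>. In the application \<open>g\<close> is known on all elementary tensors, whereas
  \<open>f\<close> is described only on tensors with a multiple of one diagram.\<close>

lemma modules_isomorphicI:
  assumes smult: "\<And>a y. a \<in> carrier R \<Longrightarrow> y \<in> carrier N \<Longrightarrow> a \<odot>\<^bsub>N\<^esub> y \<in> carrier N"
    and g: "g \<in> module_hom R N M"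
    and f: "f \<in> hom (add_monoid M) (add_monoid N)"
    and fg: "\<And>x. x \<in> carrier M \<Longrightarrow> g (f x) = x"
    and gf: "\<And>y. y \<in> carrier N \<Longrightarrow> f (g y) = y"
  shows "modules_isomorphic R M N"
proof -
  have fc: "f x \<in> carrier N" if "x \<in> carrier M" for x
    by (rule hom_add_closed[OF f that])
  have "f (a \<odot>\<^bsub>M\<^esub> x) = a \<odot>\<^bsub>N\<^esub> f x" if "a \<in> carrier R" "x \<in> carrier M" for a x
  proof -
    have "g (a \<odot>\<^bsub>N\<^esub> f x) = a \<odot>\<^bsub>M\<^esub> x"
      using g fc[OF that(2)] fg[OF that(2)] that(1) by (auto simp: module_hom_def)
    then show ?thesis
      using gf[OF smult[OF that(1) fc[OF that(2)]]] by simp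
  qed
  then have "f \<in> module_hom R M N"
    using fc hom_add_add[OF f] by (auto simp: module_hom_def)
  moreover have "bij_betw f (carrier M) (carrier N)"
    using g by (intro bij_betwI[where g = g]) (auto simp: fc fg gf module_hom_def)
  ultimately show ?thesis by (auto simp: modules_isomorphic_def)
qed

section \<open>Permutations acting on diagrams\<close>

lemma perfect_matchings_edgeE:
  assumes "x \<in> perfect_matchings A" "e \<in> x"
  obtains a b where "e = {a, b}" "a \<noteq> b" "a \<in> A" "b \<in> A"
proof -
  have "card e = 2" "e \<subseteq> A"
    using assms by (auto simp: perfect_matchings_def partition_on_def)
  with that show thesis by (auto simp: card_2_iff)
qed

lemma perfect_matchings_edge_unique:
  assumes "x \<in> perfect_matchings A" "e \<in> x" "e' \<in> x" "a \<in> e" "a \<in> e'"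
  shows "e = e'"
  using assms by (auto simp: perfect_matchings_def partition_on_def disjoint_def)

lemma perfect_matchings_vimage:
  assumes x: "x \<in> perfect_matchings A" and h: "bij h"
  shows "(\<lambda>e. h -` e) ` x \<in> perfect_matchings (h -` A)"
proof -
  have inj: "h -` e = h -` e' \<longleftrightarrow> e = e'" for e e'
    using surj_image_vimage_eq[OF bij_is_surj[OF h]] by metis
  have P: "\<Union>x = A" "disjoint x" "{} \<notin> x" "\<forall>e\<in>x. card e = 2"
    using x unfolding perfect_matchings_def partition_on_def by blast+
  have "\<Union>((\<lambda>e. h -` e) ` x) = h -` A" using P(1) by blast
  moreover have "disjoint ((\<lambda>e. h -` e) ` x)"
    using P(2) by (fastforce simp: disjoint_def)
  moreover have "{} \<notin> (\<lambda>e. h -` e) ` x"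
    using P(3) inj[of "{}"] by auto
  moreover have "card (h -` e) = 2" if "e \<in> x" for e
    using that P(4) h by (simp add: card_vimage_inj bij_is_inj bij_is_surj)
  ultimately show ?thesis by (auto simp: perfect_matchings_def partition_on_def)
qed

lemma bij_map_sum:
  assumes "bij f" "bij g" shows "bij (map_sum f g)"
proof (rule bijI)
  show "inj (map_sum f g)"
    using sum.inj_map[of f g] assms by (simp add: bij_is_inj)
  show "surj (map_sum f g)"
  proof (rule surjI)
    show "map_sum f g (map_sum (inv' f) (inv' g) x) = x" for x
      using assms by (cases x) (simp_all add: bij_is_surj surj_f_inv_f)
  qed
qed

text \<open>
  Permutations act on diagrams on the right by preimage on the bottom row, and on the left by
  preimage under the inverse on the top row.
\<close>

definition relabel :: "(nat \<Rightarrow> nat) \<Rightarrow> (nat \<Rightarrow> nat) \<Rightarrow> diagram \<Rightarrow> diagram"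
  where "relabel f g d = (\<lambda>e. map_sum f g -` e) ` d"

text \<open>Preimages reverse composition, so the relabelling applied last stands innermost. Hence
  bottom relabelling is a right action, and top relabelling by inverses is a left action.\<close>

lemma relabel_relabel: "relabel f g (relabel f' g' d) = relabel (f' \<circ> f) (g' \<circ> g) d"
proof -
  have "map_sum f g -` (map_sum f' g' -` e) = map_sum (f' \<circ> f) (g' \<circ> g) -` e" for e
    by (simp only: vimage_comp map_sum.comp)
  then show ?thesis by (simp add: relabel_def image_image)
qed

lemma relabel_id [simp]: "relabel id id d = d"
  by (simp add: relabel_def map_sum.id)

lemma relabel_in_diagrams:
  assumes "x \<in> diagrams r s" "\<sigma> permutes {1..r}" "\<tau> permutes {1..s}"
  shows "relabel \<sigma> \<tau> x \<in> diagrams r s"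
proof -
  have "bij (map_sum \<sigma> \<tau>)"
    using assms by (intro bij_map_sum permutes_bij)
  moreover have "map_sum \<sigma> \<tau> -` (Inl ` {1..r} \<union> Inr ` {1..s}) = Inl ` {1..r} \<union> Inr ` {1..s}"
  proof (rule Set.set_eqI)
    fix a show "a \<in> map_sum \<sigma> \<tau> -` (Inl ` {1..r} \<union> Inr ` {1..s}) \<longleftrightarrow> a \<in> Inl ` {1..r} \<union> Inr ` {1..s}"
      using permutes_in_image[OF assms(2)] permutes_in_image[OF assms(3)]
      by (cases a) (simp_all add: inj_image_mem_iff image_iff del: atLeastAtMost_iff)
  qed
  ultimately show ?thesis
    using perfect_matchings_vimage[of x _ "map_sum \<sigma> \<tau>"] assms(1)
    unfolding diagrams_def relabel_def by metis
qed

lemma map_sum_vimage_strand: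
  assumes "bij \<sigma>" "bij \<tau>"
  shows "map_sum \<sigma> \<tau> -` {Inl i, Inr j} = {Inl (inv' \<sigma> i), Inr (inv' \<tau> j)}"
proof (rule Set.set_eqI)
  fix a show "a \<in> map_sum \<sigma> \<tau> -` {Inl i, Inr j} \<longleftrightarrow> a \<in> {Inl (inv' \<sigma> i), Inr (inv' \<tau> j)}"
    using assms by (cases a) (auto simp: bij_inv_eq_iff bij_is_inj inv_f_f bij_is_surj surj_f_inv_f)
qed

text \<open>\<open>map_sum\<close> keeps the two rows apart, so an edge joins top to bottom exactly
  when its preimage does.\<close>

lemma propagating_relabel:
  assumes "bij \<sigma>" "bij \<tau>"
  shows "propagating (relabel \<sigma> \<tau> x) = propagating x"
proof -
  let ?h = "map_sum \<sigma> \<tau>"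
  have h: "bij ?h" by (rule bij_map_sum[OF assms])
  have edge: "e = {Inl (\<sigma> i), Inr (\<tau> j)}" if "?h -` e = {Inl i, Inr j}" for e i j
    using that surj_image_vimage_eq[OF bij_is_surj[OF h], of e] by simp
  have "{e \<in> relabel \<sigma> \<tau> x. \<exists>i j. e = {Inl i, Inr j}} = (\<lambda>e. ?h -` e) ` {e \<in> x. \<exists>i j. e = {Inl i, Inr j}}"
  proof (intro equalityI subsetI)
    fix e' assume "e' \<in> {e \<in> relabel \<sigma> \<tau> x. \<exists>i j. e = {Inl i, Inr j}}"
    then obtain e i j where "e \<in> x" "e' = ?h -` e" "?h -` e = {Inl i, Inr j}"
      by (auto simp: relabel_def)
    with edge[of e i j] show "e' \<in> (\<lambda>e. ?h -` e) ` {e \<in> x. \<exists>i j. e = {Inl i, Inr j}}" by blast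
  next
    fix e' assume "e' \<in> (\<lambda>e. ?h -` e) ` {e \<in> x. \<exists>i j. e = {Inl i, Inr j}}"
    then obtain i j where "{Inl i, Inr j} \<in> x" "e' = ?h -` {Inl i, Inr j}" by blast
    then show "e' \<in> {e \<in> relabel \<sigma> \<tau> x. \<exists>i j. e = {Inl i, Inr j}}"
      using map_sum_vimage_strand[OF assms, of i j] by (auto simp: relabel_def)
  qed
  moreover have "inj_on (\<lambda>e. ?h -` e) A" for A
    by (rule inj_onI) (metis surj_image_vimage_eq[OF bij_is_surj[OF h]])
  ultimately show ?thesis
    by (simp add: propagating_def card_image)
qed

lemma relabel_in_diagrams_pr:
  assumes "x \<in> diagrams_pr r s p" "\<sigma> permutes {1..r}" "\<tau> permutes {1..s}"
  shows "relabel \<sigma> \<tau> x \<in> diagrams_pr r s p"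
  using assms by (auto simp: diagrams_pr_def relabel_in_diagrams propagating_relabel permutes_bij)

lemma finite_diagrams_pr: "finite (diagrams_pr r s p)"
proof -
  have "diagrams_pr r s p \<subseteq> Pow (Pow (Inl ` {1..r} \<union> Inr ` {1..s}))"
    by (auto simp: diagrams_pr_def diagrams_def perfect_matchings_def partition_on_def)
  then show ?thesis by (rule finite_subset) simp
qed

section \<open>Stacking with a permutation diagram\<close>

text \<open>A partition of the vertices that no edge crosses consists of the components as soon as
  each block is connected to one of its own points. One such point is enough because the edge
  relation, and with it reachability, is symmetric.\<close>

lemma stack_components_eqI:
  assumes un: "\<Union>\<C> = \<Union>(stack_edges x y)"
    and dis: "\<And>C C' u. C \<in> \<C> \<Longrightarrow> C' \<in> \<C> \<Longrightarrow> u \<in> C \<Longrightarrow> u \<in> C' \<Longrightarrow> C = C'"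
    and cl: "\<And>e. e \<in> stack_edges x y \<Longrightarrow> \<exists>C\<in>\<C>. e \<subseteq> C"
    and con: "\<And>C. C \<in> \<C> \<Longrightarrow> \<exists>c\<in>C. \<forall>u\<in>C. (u, c) \<in> {(u, v). {u, v} \<in> stack_edges x y}\<^sup>*"
  shows "stack_components x y = \<C>"
proof -
  let ?R = "{(u, v). {u, v} \<in> stack_edges x y}"
  have "sym ?R" by (auto simp: sym_def insert_commute)
  then have sym: "sym (?R\<^sup>*)" by (rule sym_rtrancl)
  have cls: "?R\<^sup>* `` {u} = C" if C: "C \<in> \<C>" "u \<in> C" for u C
  proof
    have "v \<in> C" if "(u, v) \<in> ?R\<^sup>*" for v
      using that
    proof induction
      case (step v w)
      then obtain C' where "C' \<in> \<C>" "{v, w} \<subseteq> C'" using cl by blast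
      then show ?case using dis[OF C(1), of C' v] step by auto
    qed (rule C(2))
    then show "?R\<^sup>* `` {u} \<subseteq> C" by blast
    obtain c where c: "\<forall>v\<in>C. (v, c) \<in> ?R\<^sup>*" using con[OF C(1)] by blast
    have "(u, v) \<in> ?R\<^sup>*" if "v \<in> C" for v
      using c C(2) that symD[OF sym] by (meson rtrancl_trans)
    then show "C \<subseteq> ?R\<^sup>* `` {u}" by blast
  qed
  show ?thesis
    unfolding stack_components_def quotient_def
  proof (intro equalityI subsetI)
    fix C assume C: "C \<in> \<C>"
    then obtain c where "c \<in> C" using con by blast
    moreover from this have "c \<in> \<Union>(stack_edges x y)" using C un by blast
    ultimately show "C \<in> (\<Union>u\<in>\<Union>(stack_edges x y). {?R\<^sup>* `` {u}})" using cls[OF C] by blast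
  next
    fix C assume "C \<in> (\<Union>u\<in>\<Union>(stack_edges x y). {?R\<^sup>* `` {u}})"
    then obtain u where "u \<in> \<Union>\<C>" "C = ?R\<^sup>* `` {u}" unfolding un by blast
    then show "C \<in> \<C>" using cls by blast
  qed
qed

text \<open>A component with nonempty trace on the outer rows is not a loop. With all traces
  nonempty there are no loops, and discarding the empty trace changes nothing.\<close>

lemma diagram_comp_eqI:
  assumes "stack_components x y = C ` d"
    and "\<And>e. e \<in> d \<Longrightarrow> case_sum Top Bot -` C e = h e" "\<And>e. e \<in> d \<Longrightarrow> h e \<noteq> {}"
  shows "diagram_comp x y = h ` d" "loops x y = 0"
proof -
  show "diagram_comp x y = h ` d"
    unfolding diagram_comp_def assms(1) using assms(2,3) by (force simp: image_image)
  have "\<not> C e \<subseteq> range Mid" if e: "e \<in> d" for e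
  proof -
    obtain a where "case_sum Top Bot a \<in> C e"
      using assms(2,3)[OF e] by blast
    moreover have "case_sum Top Bot a \<notin> range Mid" by (cases a) auto
    ultimately show ?thesis by blast
  qed
  then have "{D \<in> stack_components x y. D \<subseteq> range Mid} = {}"
    unfolding assms(1) by blast
  then show "loops x y = 0" by (simp only: loops_def card.empty)
qed

lemma
  assumes x: "x \<in> diagrams r s" and t: "\<tau> permutes {1..s}"
  shows diagram_comp_perm_right: "diagram_comp x (perm_diagram s \<tau>) = relabel id \<tau> x"
    and loops_perm_right: "loops x (perm_diagram s \<tau>) = 0"
proof -
  let ?q = "case_sum Top Mid"
  \<comment> \<open>Stacking a permutation underneath only prolongs strands: the component of an
    edge \<open>e\<close> of \<open>x\<close> is \<open>e\<close> together with the bottom points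
    whose strand runs up to a point of \<open>e\<close>.\<close>
  let ?C = "\<lambda>e. ?q ` e \<union> Bot ` {j. Inr (\<tau> j) \<in> e}"
  let ?E = "stack_edges x (perm_diagram s \<tau>)"
  let ?R = "{(u, v). {u, v} \<in> ?E}"
  have E: "?E = (\<lambda>e. ?q ` e) ` x \<union> (\<lambda>j. {Mid (\<tau> j), Bot j}) ` {1..s}"
    by (simp add: stack_edges_def perm_diagram_def image_image)
  have q_inj: "?q a = ?q b \<longleftrightarrow> a = b" for a b :: "nat + nat"
    by (cases a; cases b) auto
  have q_Bot: "?q a \<noteq> Bot j" for a :: "nat + nat" and j by (cases a) auto
  have q_Mid: "Mid j = ?q (Inr j)" for j by simp
  have Inr_in: "j \<in> {1..s} \<longleftrightarrow> (\<exists>e\<in>x. Inr (\<tau> j) \<in> e)" for j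
  proof -
    have "\<Union>x = Inl ` {1..r} \<union> Inr ` {1..s}"
      using x by (auto simp: diagrams_def perfect_matchings_def partition_on_def)
    then have "(Inr (\<tau> j) \<in> \<Union>x) = (\<tau> j \<in> {1..s})" by auto
    then show ?thesis using permutes_in_image[OF t] by blast
  qed
  note uniq = perfect_matchings_edge_unique[OF x[unfolded diagrams_def]]
  have comps: "stack_components x (perm_diagram s \<tau>) = ?C ` x"
  proof (rule stack_components_eqI)
    show "\<Union>(?C ` x) = \<Union>?E"
    proof (intro equalityI subsetI)
      fix u assume "u \<in> \<Union>(?C ` x)"
      then show "u \<in> \<Union>?E" unfolding E using Inr_in by fastforce
    next
      fix u assume "u \<in> \<Union>?E"
      then consider e where "e \<in> x" "u \<in> ?q ` e" | j where "j \<in> {1..s}" "u = Mid (\<tau> j) \<or> u = Bot j"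
        unfolding E by blast
      then show "u \<in> \<Union>(?C ` x)"
      proof cases
        case 2
        then obtain e where "e \<in> x" "Inr (\<tau> j) \<in> e" using Inr_in by blast
        then show ?thesis using 2(2) by (force simp: q_Mid simp del: sum.case)
      qed blast
    qed
  next
    fix C C' u assume "C \<in> ?C ` x" "C' \<in> ?C ` x" and u: "u \<in> C" "u \<in> C'"
    then obtain e e' where e: "e \<in> x" "e' \<in> x" "C = ?C e" "C' = ?C e'" by blast
    \<comment> \<open>A common vertex in the rows of \<open>x\<close> is a common point of
      \<open>e\<close> and \<open>e'\<close>; a common bottom vertex \<open>Bot j\<close> gives the
      common point \<open>Inr (\<tau> j)\<close>. Edges of a matching that share a point
      coincide.\<close>
    have "\<exists>a. a \<in> e \<and> a \<in> e'"
      using u unfolding e by (auto simp: q_inj q_Bot q_Bot[symmetric])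
    then show "C = C'" using uniq e by blast
  next
    fix E' assume "E' \<in> ?E"
    then consider e where "e \<in> x" "E' = ?q ` e" | j where "j \<in> {1..s}" "E' = {Mid (\<tau> j), Bot j}"
      unfolding E by blast
    then show "\<exists>C\<in>?C ` x. E' \<subseteq> C"
    proof cases
      case 2
      then obtain e where "e \<in> x" "Inr (\<tau> j) \<in> e" using Inr_in by blast
      then have "E' \<subseteq> ?C e" using 2(2) by (auto simp: q_Mid simp del: sum.case)
      with \<open>e \<in> x\<close> show ?thesis by blast
    qed blast
  next
    fix C assume "C \<in> ?C ` x"
    then obtain e where e: "e \<in> x" "C = ?C e" by blast
    then obtain a b where ab: "e = {a, b}"
      using perfect_matchings_edgeE x unfolding diagrams_def by metis
    have "{?q b, ?q a} = ?q ` e" unfolding ab by auto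
    then have 1: "(?q b, ?q a) \<in> ?R" using e(1) unfolding E by auto
    \<comment> \<open>The centre of the component is the end \<open>a\<close> of its edge:
      \<open>b\<close> is one step away, and \<open>Bot j\<close> reaches it through
      \<open>Mid (\<tau> j)\<close>.\<close>
    have 2: "(u, ?q a) \<in> ?R\<^sup>*" if "u \<in> ?q ` e" for u
      using that 1 unfolding ab by blast
    have "(Bot j, ?q (Inr (\<tau> j))) \<in> ?R" if "Inr (\<tau> j) \<in> e" for j
    proof -
      have "j \<in> {1..s}" using Inr_in e that by blast
      then show ?thesis unfolding E by (auto simp: insert_commute)
    qed
    then have "(Bot j, ?q a) \<in> ?R\<^sup>*" if "Inr (\<tau> j) \<in> e" for j
      using 2[of "?q (Inr (\<tau> j))"] that by (meson converse_rtrancl_into_rtrancl imageI)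
    with 2 have "\<forall>u\<in>C. (u, ?q a) \<in> ?R\<^sup>*" unfolding e(2) by blast
    moreover have "?q a \<in> C" unfolding e(2) ab by blast
    ultimately show "\<exists>c\<in>C. \<forall>u\<in>C. (u, c) \<in> ?R\<^sup>*" by blast
  qed
  have v: "case_sum Top Bot -` ?C e = map_sum id \<tau> -` e" for e
  proof (rule Set.set_eqI)
    fix a show "a \<in> case_sum Top Bot -` ?C e \<longleftrightarrow> a \<in> map_sum id \<tau> -` e"
      using q_inj[of "Inl _"] by (cases a) (auto simp: q_Bot q_Bot[symmetric] image_iff split: sum.splits)
  qed
  have ne: "map_sum id \<tau> -` e \<noteq> {}" if "e \<in> x" for e
  proof -
    have "bij (map_sum id \<tau>)" using permutes_bij[OF t] by (intro bij_map_sum) auto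
    moreover have "e \<noteq> {}" using that x by (auto simp: diagrams_def perfect_matchings_def)
    ultimately show ?thesis by (metis bij_is_surj image_empty surj_image_vimage_eq)
  qed
  show "diagram_comp x (perm_diagram s \<tau>) = relabel id \<tau> x" "loops x (perm_diagram s \<tau>) = 0"
    unfolding relabel_def using diagram_comp_eqI[OF comps v ne] by auto
qed

text \<open>The same prolongation at the top. A strand of \<open>perm_diagram r \<sigma>\<close>
  runs from \<open>\<sigma> i\<close> on top to \<open>i\<close> below, so the top point
  \<open>k\<close> is attached to the edge containing \<open>Inl (inv' \<sigma> k)\<close>; this is
  the origin of the inverse.\<close>

lemma
  assumes x: "x \<in> diagrams r s" and t: "\<sigma> permutes {1..r}"
  shows diagram_comp_perm_left: "diagram_comp (perm_diagram r \<sigma>) x = relabel (inv' \<sigma>) id x"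
    and loops_perm_left: "loops (perm_diagram r \<sigma>) x = 0"
proof -
  let ?q = "case_sum Mid Bot"
  let ?C = "\<lambda>e. ?q ` e \<union> (\<lambda>i. Top (\<sigma> i)) ` {i. Inl i \<in> e}"
  let ?E = "stack_edges (perm_diagram r \<sigma>) x"
  let ?R = "{(u, v). {u, v} \<in> ?E}"
  have E: "?E = (\<lambda>e. ?q ` e) ` x \<union> (\<lambda>j. {Top (\<sigma> j), Mid j}) ` {1..r}"
    by (simp add: stack_edges_def perm_diagram_def image_image Un_commute)
  have s_inj: "\<sigma> i = \<sigma> j \<longleftrightarrow> i = j" for i j using permutes_inj[OF t] by (auto dest: injD)
  have q_inj: "?q a = ?q b \<longleftrightarrow> a = b" for a b :: "nat + nat"
    by (cases a; cases b) auto
  have q_Top: "?q a \<noteq> Top j" for a :: "nat + nat" and j by (cases a) auto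
  have q_Mid: "Mid j = ?q (Inl j)" for j by simp
  have Inl_in: "j \<in> {1..r} \<longleftrightarrow> (\<exists>e\<in>x. Inl j \<in> e)" for j
  proof -
    have "\<Union>x = Inl ` {1..r} \<union> Inr ` {1..s}"
      using x by (auto simp: diagrams_def perfect_matchings_def partition_on_def)
    then have "(Inl j \<in> \<Union>x) = (j \<in> {1..r})" by auto
    then show ?thesis by blast
  qed
  note uniq = perfect_matchings_edge_unique[OF x[unfolded diagrams_def]]
  have comps: "stack_components (perm_diagram r \<sigma>) x = ?C ` x"
  proof (rule stack_components_eqI)
    show "\<Union>(?C ` x) = \<Union>?E"
    proof (intro equalityI subsetI)
      fix u assume "u \<in> \<Union>(?C ` x)"
      then consider e where "e \<in> x" "u \<in> ?q ` e" | e j where "e \<in> x" "Inl j \<in> e" "u = Top (\<sigma> j)"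
        by blast
      then show "u \<in> \<Union>?E"
      proof cases
        case 2
        then have "j \<in> {1..r}" using Inl_in by blast
        then show ?thesis unfolding E 2(3) by blast
      qed (auto simp: E)
    next
      fix u assume "u \<in> \<Union>?E"
      then consider e where "e \<in> x" "u \<in> ?q ` e" | j where "j \<in> {1..r}" "u = Mid j \<or> u = Top (\<sigma> j)"
        unfolding E by blast
      then show "u \<in> \<Union>(?C ` x)"
      proof cases
        case 2
        then obtain e where "e \<in> x" "Inl j \<in> e" using Inl_in by blast
        then show ?thesis using 2(2) by (force simp: q_Mid simp del: sum.case)
      qed blast
    qed
  next
    fix C C' u assume "C \<in> ?C ` x" "C' \<in> ?C ` x" and u: "u \<in> C" "u \<in> C'"
    then obtain e e' where e: "e \<in> x" "e' \<in> x" "C = ?C e" "C' = ?C e'" by blast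
    have "\<exists>a. a \<in> e \<and> a \<in> e'"
      using u unfolding e by (auto simp: q_inj q_Top q_Top[symmetric] s_inj)
    then show "C = C'" using uniq e by blast
  next
    fix E' assume "E' \<in> ?E"
    then consider e where "e \<in> x" "E' = ?q ` e" | j where "j \<in> {1..r}" "E' = {Top (\<sigma> j), Mid j}"
      unfolding E by blast
    then show "\<exists>C\<in>?C ` x. E' \<subseteq> C"
    proof cases
      case 2
      then obtain e where "e \<in> x" "Inl j \<in> e" using Inl_in by blast
      then have "E' \<subseteq> ?C e" using 2(2) by (auto simp: q_Mid simp del: sum.case)
      with \<open>e \<in> x\<close> show ?thesis by blast
    qed blast
  next
    fix C assume "C \<in> ?C ` x"
    then obtain e where e: "e \<in> x" "C = ?C e" by blast
    then obtain a b where ab: "e = {a, b}"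
      using perfect_matchings_edgeE x unfolding diagrams_def by metis
    have "{?q b, ?q a} = ?q ` e" unfolding ab by auto
    then have 1: "(?q b, ?q a) \<in> ?R" using e(1) unfolding E by auto
    have 2: "(u, ?q a) \<in> ?R\<^sup>*" if "u \<in> ?q ` e" for u
      using that 1 unfolding ab by blast
    have "(Top (\<sigma> j), ?q (Inl j)) \<in> ?R" if "Inl j \<in> e" for j
    proof -
      have "j \<in> {1..r}" using Inl_in e that by blast
      then show ?thesis unfolding E by auto
    qed
    then have "(Top (\<sigma> j), ?q a) \<in> ?R\<^sup>*" if "Inl j \<in> e" for j
      using 2[of "?q (Inl j)"] that by (meson converse_rtrancl_into_rtrancl imageI)
    with 2 have "\<forall>u\<in>C. (u, ?q a) \<in> ?R\<^sup>*" unfolding e(2) by blast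
    moreover have "?q a \<in> C" unfolding e(2) ab by blast
    ultimately show "\<exists>c\<in>C. \<forall>u\<in>C. (u, c) \<in> ?R\<^sup>*" by blast
  qed
  have inv: "i = \<sigma> j \<longleftrightarrow> inv' \<sigma> i = j" for i j
    using permutes_inv_eq[OF t] by auto
  have v: "case_sum Top Bot -` ?C e = map_sum (inv' \<sigma>) id -` e" for e
  proof (rule Set.set_eqI)
    fix a show "a \<in> case_sum Top Bot -` ?C e \<longleftrightarrow> a \<in> map_sum (inv' \<sigma>) id -` e"
      using q_inj[of "Inr _"] by (cases a) (auto simp: inv q_Top q_Top[symmetric] image_iff split: sum.splits)
  qed
  have ne: "map_sum (inv' \<sigma>) id -` e \<noteq> {}" if "e \<in> x" for e
  proof -
    have "bij (map_sum (inv' \<sigma>) (id :: nat \<Rightarrow> nat))"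
      using permutes_bij[OF permutes_inv[OF t]] by (intro bij_map_sum) auto
    moreover have "e \<noteq> {}" using that x by (auto simp: diagrams_def perfect_matchings_def)
    ultimately show ?thesis by (metis bij_is_surj image_empty surj_image_vimage_eq)
  qed
  show "diagram_comp (perm_diagram r \<sigma>) x = relabel (inv' \<sigma>) id x" "loops (perm_diagram r \<sigma>) x = 0"
    unfolding relabel_def using diagram_comp_eqI[OF comps v ne] by auto
qed

section \<open>The diagrams x_mu and their orbits under bottom permutations\<close>

definition base_diagram :: "nat \<Rightarrow> nat set set \<Rightarrow> diagram"
  where "base_diagram p \<mu> = (\<lambda>i. {Inl i, Inr i}) ` {1..p} \<union> (\<lambda>e. (\<lambda>j. Inr (p + j)) ` e) ` \<mu>"

lemma base_diagram_strand: "i \<in> {1..p} \<Longrightarrow> {Inl i, Inr i} \<in> base_diagram p \<mu>"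
  by (auto simp: base_diagram_def)

lemma base_diagram_strand_unique:
  assumes "e \<in> base_diagram p \<mu>" "Inl i \<in> e" shows "e = {Inl i, Inr i}"
  using assms by (auto simp: base_diagram_def)

text \<open>The shifted matching is read off as the set of edges inside the bottom row, since every
  strand touches the top; the shift itself is injective.\<close>

lemma base_diagram_inject:
  assumes "base_diagram p \<mu> = base_diagram p \<mu>'" shows "\<mu> = \<mu>'"
proof -
  let ?s = "\<lambda>e. (\<lambda>j. Inr (p + j)) ` e :: (nat + nat) set"
  have "{e \<in> base_diagram p \<nu>. e \<subseteq> range Inr} = ?s ` \<nu>" for \<nu>
    by (auto simp: base_diagram_def)
  from this[of \<mu>] this[of \<mu>'] have eq: "?s ` \<mu> = ?s ` \<mu>'" unfolding assms by simp
  have "inj (\<lambda>j. Inr (p + j) :: nat + nat)" by (rule injI) simp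
  then have inj: "inj ?s" by (intro injI) (simp only: inj_image_eq_iff)
  show ?thesis by (rule inj_image_eq_iff[OF inj, THEN iffD1, OF eq])
qed

lemma base_diagram_in:
  assumes "\<mu> \<in> perfect_matchings {1..m}"
  shows "base_diagram p \<mu> \<in> diagrams_pr p (p + m) p"
proof -
  let ?s = "\<lambda>e. (\<lambda>j. Inr (p + j)) ` e :: (nat + nat) set"
  let ?x = "base_diagram p \<mu>"
  have P: "\<Union>\<mu> = {1..m}" "{} \<notin> \<mu>" "\<forall>e\<in>\<mu>. card e = 2"
    using assms unfolding perfect_matchings_def partition_on_def by blast+
  have inj: "inj (\<lambda>j. Inr (p + j) :: nat + nat)" by (rule injI) simp
  have pos: "j \<ge> 1" if "j \<in> e" "e \<in> \<mu>" for j e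
    using that P(1) by auto
  have "{1..p + m} = {1..p} \<union> (\<lambda>j. p + j) ` {1..m}" by (auto simp: image_add_atLeastAtMost)
  then have "Inr ` {1..p + m} = Inr ` {1..p} \<union> (\<lambda>j. Inr (p + j)) ` {1..m}"
    by (simp only: image_Un image_image)
  then have U: "\<Union>?x = Inl ` {1..p} \<union> Inr ` {1..p + m}"
  proof -
    have "\<Union>?x = Inl ` {1..p} \<union> (Inr ` {1..p} \<union> (\<lambda>j. Inr (p + j)) ` \<Union>\<mu>)"
      unfolding base_diagram_def by blast
    then show ?thesis by (simp only: P(1) \<open>Inr ` {1..p + m} = _\<close>)
  qed
  have "disjoint ?x"
  proof (rule disjointI)
    fix c d assume cd: "c \<in> ?x" "d \<in> ?x" "c \<noteq> d"
    \<comment> \<open>Points of \<open>\<mu>\<close> are at least 1, so their shifts exceed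
      \<open>p\<close>: a bottom point \<open>k \<le> p\<close> can only lie on a vertical strand,
      and one beyond \<open>p\<close> only on a shifted edge.\<close>
    have low: "e = {Inl k, Inr k}" if "e \<in> ?x" "Inr k \<in> e" "k \<le> p" for e k
      using that by (auto simp: base_diagram_def dest: pos)
    have high: "\<exists>e'\<in>\<mu>. k - p \<in> e' \<and> e = ?s e'" if "e \<in> ?x" "Inr k \<in> e" "k > p" for e k
      using that by (auto simp: base_diagram_def)
    show "c \<inter> d = {}"
    proof (rule ccontr)
      assume "c \<inter> d \<noteq> {}"
      then obtain a where a: "a \<in> c" "a \<in> d" by blast
      have "c = d"
      proof (cases a)
        case (Inl i)
        then show ?thesis
          using base_diagram_strand_unique[OF cd(1), of i] base_diagram_strand_unique[OF cd(2), of i] a by simp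
      next
        case (Inr k)
        show ?thesis
        proof (cases "k \<le> p")
          case True
          then show ?thesis using low[of c k] low[of d k] cd a Inr by simp
        next
          case False
          then obtain e e' where "e \<in> \<mu>" "k - p \<in> e" "c = ?s e" "e' \<in> \<mu>" "k - p \<in> e'" "d = ?s e'"
            using high[of c k] high[of d k] cd a Inr by auto
          then show ?thesis using perfect_matchings_edge_unique[OF assms] by metis
        qed
      qed
      with cd(3) show False ..
    qed
  qed
  moreover have "{} \<notin> ?x" using P(2) by (auto simp: base_diagram_def)
  moreover have "card e = 2" if "e \<in> ?x" for e
    using that P(3) card_image[OF inj_on_subset[OF inj subset_UNIV]]
    by (auto simp: base_diagram_def)
  ultimately have "?x \<in> diagrams p (p + m)"
    using U by (simp add: diagrams_def perfect_matchings_def partition_on_def)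
  moreover have "{e \<in> ?x. \<exists>i j. e = {Inl i, Inr j}} = (\<lambda>i. {Inl i, Inr i}) ` {1..p}"
    by (auto simp: base_diagram_def)
  moreover have "inj_on (\<lambda>i. {Inl i, Inr i} :: (nat + nat) set) {1..p}"
    by (rule inj_onI) (auto simp: doubleton_eq_iff)
  ultimately show ?thesis
    by (simp add: diagrams_pr_def propagating_def card_image)
qed

text \<open>The vertical strands use up the whole top row and the first \<open>p\<close> bottom
  points, so every other edge lies among the last \<open>m\<close> bottom points and can be shifted
  back.\<close>

lemma base_diagram_surj:
  assumes x: "x \<in> diagrams p (p + m)" and st: "\<And>i. i \<in> {1..p} \<Longrightarrow> {Inl i, Inr i} \<in> x"
  obtains \<mu> where "\<mu> \<in> perfect_matchings {1..m}" "x = base_diagram p \<mu>"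
proof
  let ?S = "(\<lambda>i. {Inl i, Inr i}) ` {1..p} :: diagram"
  let ?f = "\<lambda>j. Inr (p + j) :: nat + nat"
  let ?\<mu> = "(\<lambda>e. ?f -` e) ` (x - ?S)"
  have inj: "inj ?f" by (rule injI) simp
  have Ux: "\<Union>x = Inl ` {1..p} \<union> Inr ` {1..p + m}" and c2: "\<And>e. e \<in> x \<Longrightarrow> card e = 2"
    using x by (auto simp: diagrams_def perfect_matchings_def partition_on_def)
  note uniq = perfect_matchings_edge_unique[OF x[unfolded diagrams_def]]
  have sub: "e \<subseteq> ?f ` {1..m}" if e: "e \<in> x - ?S" for e
  proof
    fix a assume a: "a \<in> e"
    have ns: "a \<notin> {Inl i, Inr i}" if "i \<in> {1..p}" for i
      using uniq[of e "{Inl i, Inr i}" a] st[OF that] a e that by blast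
    have "a \<in> \<Union>x" using a e by blast
    then consider i where "i \<in> {1..p}" "a = Inl i" | j where "j \<in> {1..p + m}" "a = Inr j"
      unfolding Ux by blast
    then show "a \<in> ?f ` {1..m}"
    proof cases
      case 1
      then show ?thesis using ns[of i] by blast
    next
      case 2
      then have "j \<notin> {1..p}" using ns[of j] by blast
      with 2 have "a = ?f (j - p)" "j - p \<in> {1..m}" by auto
      then show ?thesis by blast
    qed
  qed
  have vim: "?f ` (?f -` e) = e" if "e \<in> x - ?S" for e
    using sub[OF that] by blast
  show "x = base_diagram p ?\<mu>"
  proof -
    have "(\<lambda>e. ?f ` e) ` ?\<mu> = (\<lambda>e. e) ` (x - ?S)"
      unfolding image_image by (intro image_cong refl vim)
    moreover have "?S \<subseteq> x" using st by blast
    ultimately show ?thesis by (auto simp: base_diagram_def)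
  qed
  have "\<Union>?\<mu> = {1..m}"
  proof (intro equalityI subsetI)
    fix j assume "j \<in> \<Union>?\<mu>"
    then obtain e where "e \<in> x - ?S" "?f j \<in> e" by blast
    then show "j \<in> {1..m}" using sub by fastforce
  next
    fix j assume j: "j \<in> {1..m}"
    then have "?f j \<in> \<Union>x" unfolding Ux by auto
    then obtain e where e: "e \<in> x" "?f j \<in> e" by blast
    moreover have "e \<notin> ?S" using e(2) j by auto
    ultimately show "j \<in> \<Union>?\<mu>" by blast
  qed
  moreover have "disjoint ?\<mu>"
  proof (rule disjointI)
    fix c d assume cd: "c \<in> ?\<mu>" "d \<in> ?\<mu>" "c \<noteq> d"
    obtain e where e: "c = ?f -` e" "e \<in> x" using cd(1) by (elim imageE DiffE)
    obtain e' where e': "d = ?f -` e'" "e' \<in> x" using cd(2) by (elim imageE DiffE)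
    show "c \<inter> d = {}"
    proof (rule equals0I)
      fix j assume "j \<in> c \<inter> d"
      then have "?f j \<in> e" "?f j \<in> e'" unfolding e(1) e'(1) by auto
      then have "e = e'" by (rule uniq[OF e(2) e'(2)])
      with cd(3) e e' show False by simp
    qed
  qed
  moreover have "card (?f -` e) = 2" if "e \<in> x - ?S" for e
    using that vim[OF that] c2[of e] card_image[OF inj_on_subset[OF inj subset_UNIV], of "?f -` e"] by simp
  then have c: "\<forall>e\<in>?\<mu>. card e = 2" by blast
  moreover have "{} \<notin> ?\<mu>"
  proof
    assume "{} \<in> ?\<mu>"
    with c have "card ({} :: nat set) = 2" by (rule bspec)
    then show False by simp
  qed
  ultimately show "?\<mu> \<in> perfect_matchings {1..m}"
    unfolding perfect_matchings_def partition_on_def by blast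
qed

text \<open>Pigeonhole: the \<open>p\<close> propagating strands have distinct top ends, and there
  are only \<open>p\<close> top points.\<close>

lemma diagrams_pr_strands:
  assumes x: "x \<in> diagrams_pr p s p" and i: "i \<in> {1..p}"
  shows "\<exists>j\<in>{1..s}. {Inl i, Inr j} \<in> x"
proof -
  let ?P = "{e \<in> x. \<exists>i j. e = {Inl i, Inr j}}"
  have xm: "x \<in> perfect_matchings (Inl ` {1..p} \<union> Inr ` {1..s})" and c: "card ?P = p"
    using x by (auto simp: diagrams_pr_def diagrams_def propagating_def)
  have Ux: "\<Union>x = Inl ` {1..p} \<union> Inr ` {1..s}"
    using xm by (auto simp: perfect_matchings_def partition_on_def)
  define top where "top e = (SOME i. Inl i \<in> e)" for e :: "(nat + nat) set"
  have top: "Inl (top e) \<in> e" if e: "e \<in> ?P" for e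
  proof -
    from e obtain i where "Inl i \<in> e" by auto
    then show ?thesis unfolding top_def by (rule someI)
  qed
  have "inj_on top ?P"
  proof (rule inj_onI)
    fix e e' assume e: "e \<in> ?P" "e' \<in> ?P" "top e = top e'"
    then show "e = e'"
      using perfect_matchings_edge_unique[OF xm, of e e' "Inl (top e)"] top[OF e(1)] top[OF e(2)] by simp
  qed
  moreover have "top ` ?P \<subseteq> {1..p}"
  proof
    fix k assume "k \<in> top ` ?P"
    then have "Inl k \<in> \<Union>x" using top by blast
    then show "k \<in> {1..p}" unfolding Ux by blast
  qed
  ultimately have "top ` ?P = {1..p}"
    using c by (intro card_subset_eq) (auto simp: card_image)
  then obtain e where "e \<in> ?P" "top e = i" using i by (blast elim: equalityE)
  then obtain j where j: "{Inl i, Inr j} \<in> x" using top[of e] by auto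
  then have "Inr j \<in> \<Union>x" by blast
  then have "j \<in> {1..s}" unfolding Ux by blast
  with j show ?thesis by blast
qed

text \<open>The complements of domain and image have equal size, and any bijection between them
  completes \<open>f\<close>.\<close>

lemma permutes_extend:
  fixes f :: "nat \<Rightarrow> nat"
  assumes f: "inj_on f {1..p}" "f ` {1..p} \<subseteq> {1..p + m}"
  obtains \<pi> where "\<pi> permutes {1..p + m}" "\<And>i. i \<in> {1..p} \<Longrightarrow> \<pi> i = f i"
proof -
  let ?B = "{1..p + m} - {1..p}" and ?C = "{1..p + m} - f ` {1..p}"
  have c: "card ?B = card ?C"
  proof -
    have "card ?B = card {1..p + m} - card {1..p}" by (rule card_Diff_subset) auto
    moreover have "card ?C = card {1..p + m} - card (f ` {1..p})"
      by (rule card_Diff_subset) (use f(2) in auto)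
    ultimately show ?thesis by (simp only: card_image[OF f(1)])
  qed
  have "\<exists>g. bij_betw g ?B ?C"
    by (rule finite_same_card_bij[OF _ _ c]) simp_all
  then obtain g where g: "bij_betw g ?B ?C" ..
  let ?\<pi> = "\<lambda>i. if i \<in> {1..p} then f i else if i \<in> ?B then g i else i"
  have "bij_betw ?\<pi> {1..p} (f ` {1..p})"
    by (subst bij_betw_cong[of "{1..p}" ?\<pi> f]) (simp_all add: inj_on_imp_bij_betw[OF f(1)] del: atLeastAtMost_iff One_nat_def)
  moreover have "bij_betw ?\<pi> ?B ?C"
    by (subst bij_betw_cong[of ?B ?\<pi> g]) (simp_all add: g del: atLeastAtMost_iff One_nat_def)
  ultimately have "bij_betw ?\<pi> ({1..p} \<union> ?B) (f ` {1..p} \<union> ?C)"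
    by (rule bij_betw_combine) blast
  moreover have "{1..p} \<union> ?B = {1..p + m}" "f ` {1..p} \<union> ?C = {1..p + m}"
    using f(2) by auto
  ultimately have "?\<pi> permutes {1..p + m}"
    by (intro bij_imp_permutes) auto
  then show thesis by (rule that) simp
qed

text \<open>If \<open>f i\<close> is the bottom end of the strand starting at \<open>i\<close>, a
  permutation \<open>\<pi>\<close> extending \<open>f\<close> straightens all strands, because the
  preimage of \<open>f i\<close> is \<open>i\<close>. The result is some x_mu, and
  \<open>\<tau>\<close> is the inverse of \<open>\<pi>\<close>.\<close>

lemma base_diagram_orbit:
  assumes x: "x \<in> diagrams_pr p (p + m) p"
  obtains \<mu> \<tau> where "\<mu> \<in> perfect_matchings {1..m}" "\<tau> permutes {1..p + m}"
    "x = relabel id \<tau> (base_diagram p \<mu>)"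
proof -
  obtain f where f: "\<And>i. i \<in> {1..p} \<Longrightarrow> f i \<in> {1..p + m} \<and> {Inl i, Inr (f i)} \<in> x"
    using diagrams_pr_strands[OF x] by metis
  have xm: "x \<in> perfect_matchings (Inl ` {1..p} \<union> Inr ` {1..p + m})" and xd: "x \<in> diagrams p (p + m)"
    using x by (auto simp: diagrams_pr_def diagrams_def)
  have "inj_on f {1..p}"
  proof (rule inj_onI)
    fix i i' assume i: "i \<in> {1..p}" "i' \<in> {1..p}" "f i = f i'"
    then have "{Inl i, Inr (f i)} = {Inl i', Inr (f i')}"
      using f[OF i(1)] f[OF i(2)]
        perfect_matchings_edge_unique[OF xm, of "{Inl i, Inr (f i)}" "{Inl i', Inr (f i')}" "Inr (f i)"] by simp
    then show "i = i'" by (auto simp: doubleton_eq_iff)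
  qed
  then obtain \<pi> where pi: "\<pi> permutes {1..p + m}" "\<And>i. i \<in> {1..p} \<Longrightarrow> \<pi> i = f i"
    using f permutes_extend[of f p m] by (metis image_subsetI)
  let ?y = "relabel id \<pi> x"
  have "?y \<in> diagrams p (p + m)"
    by (rule relabel_in_diagrams[OF xd permutes_id pi(1)])
  moreover have "{Inl i, Inr i} \<in> ?y" if "i \<in> {1..p}" for i
  proof -
    have "map_sum id \<pi> -` {Inl i, Inr (f i)} = {Inl i, Inr i}"
      using map_sum_vimage_strand[of id \<pi> i "f i"] pi(2)[OF that, symmetric]
      by (simp add: permutes_bij[OF pi(1)] permutes_inverses[OF pi(1)])
    then show ?thesis using f[OF that] by (auto simp: relabel_def image_iff)
  qed
  ultimately obtain \<mu> where mu: "\<mu> \<in> perfect_matchings {1..m}" "?y = base_diagram p \<mu>"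
    using base_diagram_surj by metis
  have "x = relabel id (inv' \<pi>) ?y"
    by (simp add: relabel_relabel permutes_inv_o[OF pi(1)])
  then show thesis
    using that[OF mu(1) permutes_inv[OF pi(1)]] mu(2) by simp
qed

lemma block_perm_permutes:
  assumes s: "\<sigma> permutes {1..p}" and r: "\<rho> permutes {1..m}"
  shows "block_perm p (\<sigma>, \<rho>) permutes {1..p + m}"
proof -
  have s': "\<sigma> i \<le> p" if "i \<le> p" for i
    using that permutes_in_image[OF s, of i] permutes_not_in[OF s, of i] by (cases "i \<in> {1..p}") auto
  have r': "\<rho> j \<in> {1..m} \<longleftrightarrow> j \<in> {1..m}" "inv' \<rho> j \<in> {1..m} \<longleftrightarrow> j \<in> {1..m}" for j
    using permutes_in_image[OF r] permutes_in_image[OF permutes_inv[OF r]] by blast+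
  show ?thesis
  proof (rule bij_imp_permutes)
    show "block_perm p (\<sigma>, \<rho>) x = x" if "x \<notin> {1..p + m}" for x
    proof (cases "x \<le> p")
      case True
      then show ?thesis using that permutes_not_in[OF s, of x] by (auto simp: block_perm_def)
    next
      case False
      then have "x - p \<notin> {1..m}" using that by auto
      then have "\<rho> (x - p) = x - p" by (rule permutes_not_in[OF r])
      then show ?thesis using False by (simp add: block_perm_def)
    qed
    show "bij_betw (block_perm p (\<sigma>, \<rho>)) {1..p + m} {1..p + m}"
    proof (rule bij_betw_imageI)
      have inj: "inj (block_perm p (\<sigma>, \<rho>))"
      proof (rule inj_on_inverseI)
        fix x
        \<comment> \<open>Points above \<open>p\<close> have to stay above \<open>p\<close>, or the
          test \<open>i \<le> p\<close> in \<open>block_perm\<close> would take the wrong branch for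
          the inverse. So \<open>\<rho>\<close> must keep positive numbers positive.\<close>
        have "\<rho> (x - p) \<ge> 1" if "x > p"
          using that r'(1)[of "x - p"] permutes_not_in[OF r, of "x - p"] by (cases "x - p \<in> {1..m}") auto
        then show "block_perm p (inv' \<sigma>, inv' \<rho>) (block_perm p (\<sigma>, \<rho>) x) = x"
          using s'[of x] by (auto simp: block_perm_def permutes_inverses[OF s] permutes_inverses[OF r])
      qed
      then show "inj_on (block_perm p (\<sigma>, \<rho>)) {1..p + m}" by (rule inj_on_subset) simp
      have "block_perm p (\<sigma>, \<rho>) ` {1..p + m} \<subseteq> {1..p + m}"
      proof (rule image_subsetI)
        fix x assume x: "x \<in> {1..p + m}"
        show "block_perm p (\<sigma>, \<rho>) x \<in> {1..p + m}"
        proof (cases "x \<le> p")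
          case True
          then have "\<sigma> x \<in> {1..p}" using x permutes_in_image[OF s, of x] by auto
          then show ?thesis using True by (auto simp: block_perm_def)
        next
          case False
          then have "\<rho> (x - p) \<in> {1..m}" using x r'(1)[of "x - p"] by auto
          then show ?thesis using False by (auto simp: block_perm_def)
        qed
      qed
      then show "block_perm p (\<sigma>, \<rho>) ` {1..p + m} = {1..p + m}"
        by (intro endo_inj_surj inj_on_subset[OF inj]) auto
    qed
  qed
qed

text \<open>Moving both ends of the vertical strands by the same \<open>\<sigma>\<close> permutes
  these strands among themselves, so only the matching changes, and it changes by
  \<open>\<rho>\<close>.\<close>

lemma relabel_base_diagram:
  assumes mu: "\<mu> \<in> perfect_matchings {1..m}" and s: "\<sigma> permutes {1..p}" and r: "\<rho> permutes {1..m}"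
  shows "relabel \<sigma> (block_perm p (\<sigma>, \<rho>)) (base_diagram p \<mu>) = base_diagram p ((\<lambda>e. \<rho> -` e) ` \<mu>)"
proof -
  let ?b = "block_perm p (\<sigma>, \<rho>)"
  have b: "?b permutes {1..p + m}" by (rule block_perm_permutes[OF s r])
  have "map_sum \<sigma> ?b -` {Inl i, Inr i} = {Inl (inv' \<sigma> i), Inr (inv' \<sigma> i)}" if "i \<in> {1..p}" for i
  proof -
    have "inv' \<sigma> i \<le> p" using that permutes_in_image[OF permutes_inv[OF s], of i] by auto
    then have "?b (inv' \<sigma> i) = i" by (simp add: block_perm_def permutes_inverses[OF s])
    then have "inv' ?b i = inv' \<sigma> i" using permutes_inv_eq[OF b] by auto
    then show ?thesis
      using map_sum_vimage_strand[OF permutes_bij[OF s] permutes_bij[OF b], of i i] by simp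
  qed
  then have "(\<lambda>e. map_sum \<sigma> ?b -` e) ` (\<lambda>i. {Inl i, Inr i}) ` {1..p}
      = (\<lambda>i. {Inl i, Inr i}) ` (inv' \<sigma> ` {1..p})"
    by (auto simp: image_image)
  moreover have "map_sum \<sigma> ?b -` ((\<lambda>j. Inr (p + j)) ` e) = (\<lambda>j. Inr (p + j)) ` (\<rho> -` e)" if e: "e \<in> \<mu>" for e
  proof (rule Set.set_eqI)
    fix a
    have e1: "e \<subseteq> {1..m}" using e mu by (auto simp: perfect_matchings_def partition_on_def)
    show "a \<in> map_sum \<sigma> ?b -` ((\<lambda>j. Inr (p + j)) ` e) \<longleftrightarrow> a \<in> (\<lambda>j. Inr (p + j)) ` (\<rho> -` e)"
    proof (cases a)
      case (Inr k)
      show ?thesis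
      proof (cases "k \<le> p")
        case True
        have "\<sigma> k \<le> p"
          using True permutes_in_image[OF s, of k] permutes_not_in[OF s, of k] by (cases "k \<in> {1..p}") auto
        then have "\<sigma> k \<noteq> p + j" if "j \<in> e" for j using that e1 by auto
        \<comment> \<open>Here \<open>k \<le> p\<close> forces \<open>j = 0\<close>, and
          \<open>\<rho>\<close> fixes 0, which is not a point of the matching.\<close>
        moreover have "\<not> (\<exists>j. k = p + j \<and> \<rho> j \<in> e)"
        proof
          assume "\<exists>j. k = p + j \<and> \<rho> j \<in> e"
          then have "\<rho> 0 \<in> e" using True by auto
          then show False using e1 permutes_not_in[OF r, of 0] by auto
        qed
        ultimately show ?thesis using True Inr by (auto simp: block_perm_def)
      next
        case False
        then obtain j where "k = p + j" "j > 0" using less_imp_add_positive[of p k] by auto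
        then show ?thesis using Inr by (auto simp: block_perm_def)
      qed
    qed auto
  qed
  then have "(\<lambda>e. map_sum \<sigma> ?b -` e) ` (\<lambda>e. (\<lambda>j. Inr (p + j)) ` e) ` \<mu>
      = (\<lambda>e. (\<lambda>j. Inr (p + j)) ` e) ` (\<lambda>e. \<rho> -` e) ` \<mu>"
    by (auto simp: image_image)
  ultimately show ?thesis
    unfolding relabel_def base_diagram_def image_Un permutes_image[OF permutes_inv[OF s]] by simp
qed

text \<open>The identity x_mu (sigma, rho) = sigma x_{mu rho} for single diagrams: top relabelling
  by \<open>inv' \<sigma>\<close> cancels the \<open>\<sigma>\<close> of
  \<open>relabel_base_diagram\<close>.\<close>

lemma relabel_base_diagram_left:
  assumes mu: "\<mu> \<in> perfect_matchings {1..m}" and s: "\<sigma> permutes {1..p}" and r: "\<rho> permutes {1..m}"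
  shows "relabel (inv' \<sigma>) id (base_diagram p ((\<lambda>e. \<rho> -` e) ` \<mu>))
    = relabel id (block_perm p (\<sigma>, \<rho>)) (base_diagram p \<mu>)"
  by (simp add: relabel_base_diagram[OF assms, symmetric] relabel_relabel permutes_inv_o[OF s])

text \<open>The permutation \<open>\<tau> \<circ> inv' \<tau>'\<close> carries x_mu to x_mu'. In
  both diagrams the first \<open>p\<close> strands are vertical, so it fixes the first
  \<open>p\<close> points and hence preserves the last \<open>m\<close>; shifted back, its action on
  these is \<open>\<rho>\<close>.\<close>

lemma base_diagram_stabilizer:
  assumes eq: "relabel id \<tau> (base_diagram p \<mu>) = relabel id \<tau>' (base_diagram p \<mu>')"
    and mu: "\<mu> \<in> perfect_matchings {1..m}"
    and t: "\<tau> permutes {1..p + m}" and t': "\<tau>' permutes {1..p + m}"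
  obtains \<rho> where "\<rho> permutes {1..m}" "\<tau> = block_perm p (id, \<rho>) \<circ> \<tau>'" "\<mu>' = (\<lambda>e. \<rho> -` e) ` \<mu>"
proof
  let ?\<alpha> = "\<tau> \<circ> inv' \<tau>'"
  let ?\<rho> = "\<lambda>j. ?\<alpha> (p + j) - p"
  have a: "?\<alpha> permutes {1..p + m}" by (rule permutes_compose[OF permutes_inv[OF t'] t])
  have "relabel id (inv' \<tau>') (relabel id \<tau> (base_diagram p \<mu>)) = base_diagram p \<mu>'"
    by (simp add: eq relabel_relabel permutes_inv_o[OF t'])
  then have a_base: "relabel id ?\<alpha> (base_diagram p \<mu>) = base_diagram p \<mu>'"
    by (simp add: relabel_relabel)
  have a_fix: "?\<alpha> i = i" if i: "i \<in> {1..p}" for i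
  proof -
    have "map_sum id ?\<alpha> -` {Inl i, Inr i} \<in> base_diagram p \<mu>'"
      using base_diagram_strand[OF i, of \<mu>] unfolding a_base[symmetric] relabel_def by blast
    then have "{Inl i, Inr (inv' ?\<alpha> i)} \<in> base_diagram p \<mu>'"
      using map_sum_vimage_strand[of id ?\<alpha> i i] permutes_bij[OF a] by simp
    then have "{Inl i, Inr (inv' ?\<alpha> i)} = {Inl i, Inr i}"
      by (rule base_diagram_strand_unique) simp
    then have "inv' ?\<alpha> i = i" by (auto simp: doubleton_eq_iff)
    then show ?thesis using permutes_inverses(1)[OF a, of i] by simp
  qed
  \<comment> \<open>Including 0, which is fixed as a point outside \<open>{1..p + m}\<close>, makes
    \<open>?\<rho> 0 = 0\<close> true even for \<open>p = 0\<close>.\<close>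
  have a_0: "?\<alpha> i = i" if "i \<le> p" for i
    using a_fix[of i] permutes_not_in[OF a, of 0] that by (cases "i = 0") auto
  \<comment> \<open>A value \<open>\<le> p\<close> would itself be a fixed point, so by injectivity
    it would equal \<open>i\<close>.\<close>
  have a_gt: "?\<alpha> i > p" if "i > p" for i
  proof (rule ccontr)
    assume "\<not> ?\<alpha> i > p"
    then have "?\<alpha> (?\<alpha> i) = ?\<alpha> i" by (intro a_0) simp
    then have "?\<alpha> i = i" by (rule injD[OF permutes_inj[OF a]])
    with that \<open>\<not> ?\<alpha> i > p\<close> show False by simp
  qed
  show r: "?\<rho> permutes {1..m}"
  proof (rule bij_imp_permutes)
    show "?\<rho> x = x" if "x \<notin> {1..m}" for x
    proof (cases "x = 0")
      case True
      then show ?thesis using a_0[of p] by simp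
    next
      case False
      then have "?\<alpha> (p + x) = p + x" using that by (intro permutes_not_in[OF a]) auto
      then show ?thesis by simp
    qed
    have "inj_on ?\<rho> {1..m}"
    proof (rule inj_onI)
      fix x y assume xy: "x \<in> {1..m}" "y \<in> {1..m}" "?\<rho> x = ?\<rho> y"
      then have "?\<alpha> (p + x) = ?\<alpha> (p + y)" using a_gt[of "p + x"] a_gt[of "p + y"] by auto
      then have "p + x = p + y" by (rule injD[OF permutes_inj[OF a]])
      then show "x = y" by simp
    qed
    moreover have "?\<rho> ` {1..m} \<subseteq> {1..m}"
    proof (rule image_subsetI)
      fix x assume x: "x \<in> {1..m}"
      then have "?\<alpha> (p + x) \<in> {1..p + m}" using permutes_in_image[OF a, of "p + x"] by auto
      then show "?\<rho> x \<in> {1..m}" using a_gt[of "p + x"] x by auto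
    qed
    ultimately show "bij_betw ?\<rho> {1..m} {1..m}"
      by (intro bij_betw_imageI endo_inj_surj) auto
  qed
  have block: "block_perm p (id, ?\<rho>) = ?\<alpha>"
  proof
    fix i show "block_perm p (id, ?\<rho>) i = ?\<alpha> i"
      using a_0[of i] a_gt[of i] by (cases "i \<le> p") (auto simp: block_perm_def)
  qed
  then show "\<tau> = block_perm p (id, ?\<rho>) \<circ> \<tau>'"
    by (simp add: fun_eq_iff permutes_inverses[OF t'])
  show "\<mu>' = (\<lambda>e. ?\<rho> -` e) ` \<mu>"
    using relabel_base_diagram[OF mu permutes_id r, of p] unfolding block a_base
    by (rule base_diagram_inject)
qed

section \<open>Linear extensions\<close>

lemma (in abelian_group) finsum_single:
  assumes "finite I" "i \<in> I" "f i \<in> carrier G" "\<And>j. j \<in> I - {i} \<Longrightarrow> f j = \<zero>"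
  shows "(\<Oplus>j\<in>I. f j) = f i"
proof -
  have fc: "f \<in> I \<rightarrow> carrier G" using assms(3,4) by (metis Diff_iff Pi_I singletonD zero_closed)
  then have "(\<Oplus>j\<in>I. f j) = (\<Oplus>j\<in>I. if i = j then f j else \<zero>)"
    using assms by (intro finsum_cong') auto
  also have "\<dots> = f i" by (rule finsum_singleton[OF assms(2,1) fc])
  finally show ?thesis .
qed

lemma poly_mapping_single_induct [consumes 1, case_names zero single add]:
  assumes "Poly_Mapping.keys f \<subseteq> S" and "P 0" and "\<And>x c. x \<in> S \<Longrightarrow> P (Poly_Mapping.single x c)"
    and "\<And>f g. Poly_Mapping.keys f \<subseteq> S \<Longrightarrow> Poly_Mapping.keys g \<subseteq> S \<Longrightarrow> P f \<Longrightarrow> P g \<Longrightarrow> P (f + g)"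
  shows "P (f :: 'x \<Rightarrow>\<^sub>0 'k::comm_monoid_add)"
proof -
  let ?s = "\<lambda>A. \<Sum>x\<in>A. Poly_Mapping.single x (Poly_Mapping.lookup f x)"
  have "Poly_Mapping.keys (?s A) \<subseteq> S \<and> P (?s A)" if "finite A" "A \<subseteq> S" for A
    using that
  proof (induction A)
    case (insert x A)
    have "Poly_Mapping.keys (Poly_Mapping.single x (Poly_Mapping.lookup f x)) \<subseteq> S"
      using insert.prems by (simp split: if_splits)
    then show ?case
      using insert assms(3)[of x] assms(4)[of "Poly_Mapping.single x (Poly_Mapping.lookup f x)" "?s A"]
        keys_add[of "Poly_Mapping.single x (Poly_Mapping.lookup f x)" "?s A"] by auto
  qed (simp add: assms(2))
  moreover have "?s (Poly_Mapping.keys f) = f"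
    by (rule poly_mapping_eqI)
      (simp add: lookup_sum lookup_single when_def in_keys_iff)
  ultimately show ?thesis using assms(1) by (metis finite_keys)
qed

text \<open>The maps to be compared are known to be additive only, so agreement on basis vectors is
  not enough and every multiple \<open>single x c\<close> has to be considered. The principle is
  applied to diagrams and matchings as well as to group algebra elements, \<open>S\<close> then
  being a set of permutations or of pairs of them.\<close>

lemma additive_single_ext:
  fixes h k :: "('x \<Rightarrow>\<^sub>0 'k::ab_group_add) \<Rightarrow> 'a"
  assumes A: "abelian_group A"
    and h: "\<And>f. Poly_Mapping.keys f \<subseteq> S \<Longrightarrow> h f \<in> carrier A"
      "\<And>f g. Poly_Mapping.keys f \<subseteq> S \<Longrightarrow> Poly_Mapping.keys g \<subseteq> S \<Longrightarrow> h (f + g) = h f \<oplus>\<^bsub>A\<^esub> h g"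
    and k: "\<And>f. Poly_Mapping.keys f \<subseteq> S \<Longrightarrow> k f \<in> carrier A"
      "\<And>f g. Poly_Mapping.keys f \<subseteq> S \<Longrightarrow> Poly_Mapping.keys g \<subseteq> S \<Longrightarrow> k (f + g) = k f \<oplus>\<^bsub>A\<^esub> k g"
    and eq: "\<And>x c. x \<in> S \<Longrightarrow> h (Poly_Mapping.single x c) = k (Poly_Mapping.single x c)"
    and f: "Poly_Mapping.keys f \<subseteq> S"
  shows "h f = k f"
proof -
  interpret A: abelian_group A by fact
  \<comment> \<open>The induction starts at 0, where additivity makes the value idempotent and hence
    neutral.\<close>
  have "h 0 \<oplus>\<^bsub>A\<^esub> h 0 = h 0" "k 0 \<oplus>\<^bsub>A\<^esub> k 0 = k 0"
    using h(2)[of 0 0] k(2)[of 0 0] by simp_all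
  then have "h 0 = \<zero>\<^bsub>A\<^esub>" "k 0 = \<zero>\<^bsub>A\<^esub>"
    using h(1)[of 0] k(1)[of 0] A.add.l_cancel_one by simp_all
  with f show ?thesis
    by (induction f rule: poly_mapping_single_induct) (simp_all add: eq h(2) k(2))
qed

lemma lookup_map_mult:
  "Poly_Mapping.lookup (Poly_Mapping.map ((*) (c :: 'k::comm_ring_1)) f) z = c * Poly_Mapping.lookup f z"
  by (simp add: Poly_Mapping.map.rep_eq when_def)

lemma map_mult_single:
  "Poly_Mapping.map ((*) (c :: 'k::comm_ring_1)) (Poly_Mapping.single x d) = Poly_Mapping.single x (c * d)"
  by simp

lemma lin_ext_single_scale: "lin_ext b (Poly_Mapping.single x c) = Poly_Mapping.map ((*) c) (b x)"
  by (rule poly_mapping_eqI) (simp add: lookup_lin_ext_superset[of "{x}"] lookup_map_mult)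

lemma lin_ext_scale: "lin_ext b (Poly_Mapping.map ((*) c) f) = Poly_Mapping.map ((*) c) (lin_ext b f)"
proof (rule poly_mapping_eqI)
  fix z
  have "Poly_Mapping.keys (Poly_Mapping.map ((*) c) f) \<subseteq> Poly_Mapping.keys f"
    by (auto simp: in_keys_iff lookup_map_mult)
  then show "Poly_Mapping.lookup (lin_ext b (Poly_Mapping.map ((*) c) f)) z
      = Poly_Mapping.lookup (Poly_Mapping.map ((*) c) (lin_ext b f)) z"
    by (simp add: lookup_lin_ext_superset[of "Poly_Mapping.keys f"] lookup_map_mult sum_distrib_left mult.assoc)
qed

lemma scale_lin_ext:
  "Poly_Mapping.map ((*) c) (lin_ext b f) = lin_ext (\<lambda>x. Poly_Mapping.map ((*) c) (b x)) f"
  by (rule poly_mapping_eqI)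
    (simp add: lookup_lin_ext lookup_map_mult sum_distrib_left mult.left_commute)

lemma group_algebra_simps [simp]:
  "carrier (group_algebra G) = {f. Poly_Mapping.keys f \<subseteq> carrier G}"
  "zero (group_algebra G) = 0" "add (group_algebra G) = (+)"
  by (simp_all add: group_algebra_def)

lemma group_algebra_mult:
  "f \<otimes>\<^bsub>group_algebra G\<^esub> g = lin_ext (\<lambda>x. lin_ext (\<lambda>y. Poly_Mapping.single (x \<otimes>\<^bsub>G\<^esub> y) 1) g) f"
  by (simp add: group_algebra_def bilin_ext_def)

lemma group_algebra_mult_single:
  "Poly_Mapping.single x c \<otimes>\<^bsub>group_algebra G\<^esub> Poly_Mapping.single y d = Poly_Mapping.single (x \<otimes>\<^bsub>G\<^esub> y) (c * d)"
  by (simp add: group_algebra_mult lin_ext_single_scale map_mult_single)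

lemma diagram_bimodule_simps [simp]:
  "carrier (diagram_bimodule \<delta> p r) = {f. Poly_Mapping.keys f \<subseteq> diagrams_pr p r p}"
  "zero (diagram_bimodule \<delta> p r) = 0" "add (diagram_bimodule \<delta> p r) = (+)"
  by (simp_all add: diagram_bimodule_def)

lemma matching_module_simps [simp]:
  "carrier (matching_module m) = {f. Poly_Mapping.keys f \<subseteq> perfect_matchings {1..m}}"
  "zero (matching_module m) = 0" "add (matching_module m) = (+)"
  by (simp_all add: matching_module_def)

lemma matching_module_smult_single:
  "Poly_Mapping.single \<sigma> c \<odot>\<^bsub>matching_module m\<^esub> f
    = Poly_Mapping.map ((*) c) (lin_ext (\<lambda>x. Poly_Mapping.single ((\<lambda>e. \<sigma> -` e) ` x) 1) f)"
  by (simp add: matching_module_def bilin_ext_def lin_ext_single_scale scale_lin_ext)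

lemma restrict_scalars_simps [simp]:
  "carrier (restrict_scalars h M) = carrier M" "zero (restrict_scalars h M) = zero M"
  "add (restrict_scalars h M) = add M" "a \<odot>\<^bsub>restrict_scalars h M\<^esub> x = h a \<odot>\<^bsub>M\<^esub> x"
  by (simp_all add: restrict_scalars_def)

lemma induction_bimodule_simps [simp]:
  "carrier (induction_bimodule G \<iota>) = {f. Poly_Mapping.keys f \<subseteq> carrier G}"
  "zero (induction_bimodule G \<iota>) = 0" "add (induction_bimodule G \<iota>) = (+)"
  "a \<odot>\<^bsub>induction_bimodule G \<iota>\<^esub> x = lin_ext (\<lambda>h. Poly_Mapping.single (\<iota> h) 1) a \<otimes>\<^bsub>group_algebra G\<^esub> x"
  "rsmult (induction_bimodule G \<iota>) x b = x \<otimes>\<^bsub>group_algebra G\<^esub> b"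
  by (simp_all add: induction_bimodule_def)

lemma abelian_group_restrict_scalars:
  "abelian_group M \<Longrightarrow> abelian_group (restrict_scalars h M)"
proof -
  assume "abelian_group M"
  then interpret abelian_group M .
  show ?thesis
    by (rule abelian_groupI) (auto simp: a_ac intro: add.l_inv_ex)
qed

lemma abelian_group_poly_mappingI:
  fixes M :: "('a, 'x \<Rightarrow>\<^sub>0 'k::ab_group_add, 'm) module_scheme"
  assumes "carrier M = {f. Poly_Mapping.keys f \<subseteq> S}" "zero M = 0" "add M = (+)"
  shows "abelian_group M"
proof (rule abelian_groupI)
  fix f g assume "f \<in> carrier M" "g \<in> carrier M"
  then show "f \<oplus>\<^bsub>M\<^esub> g \<in> carrier M"
    using keys_add[of f g] by (auto simp: assms)
next
  fix f assume "f \<in> carrier M"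
  then show "\<exists>y\<in>carrier M. y \<oplus>\<^bsub>M\<^esub> f = \<zero>\<^bsub>M\<^esub>"
    by (intro bexI[of _ "-f"]) (auto simp: assms in_keys_iff subset_iff)
qed (auto simp: assms add.assoc add.commute)

section \<open>The actions on KD(p,r;p) in terms of relabelling\<close>

definition left_relabel :: "((nat \<Rightarrow> nat) \<Rightarrow>\<^sub>0 'k::comm_ring_1) \<Rightarrow> (diagram \<Rightarrow>\<^sub>0 'k) \<Rightarrow> (diagram \<Rightarrow>\<^sub>0 'k)"
  where "left_relabel = bilin_ext (\<lambda>\<sigma> d. Poly_Mapping.single (relabel (inv' \<sigma>) id d) 1)"

definition right_relabel :: "(diagram \<Rightarrow>\<^sub>0 'k) \<Rightarrow> ((nat \<Rightarrow> nat) \<Rightarrow>\<^sub>0 'k::comm_ring_1) \<Rightarrow> (diagram \<Rightarrow>\<^sub>0 'k)"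
  where "right_relabel = bilin_ext (\<lambda>d \<tau>. Poly_Mapping.single (relabel id \<tau> d) 1)"

definition base_lin :: "nat \<Rightarrow> (nat set set \<Rightarrow>\<^sub>0 'k::comm_ring_1) \<Rightarrow> (diagram \<Rightarrow>\<^sub>0 'k)"
  where "base_lin p = lin_ext (\<lambda>\<mu>. Poly_Mapping.single (base_diagram p \<mu>) 1)"

lemmas relabel_defs = left_relabel_def right_relabel_def base_lin_def bilin_ext_def

lemma
  shows left_relabel_add_left: "left_relabel (a + b) f = left_relabel a f + left_relabel b f"
    and left_relabel_add: "left_relabel a (f + g) = left_relabel a f + left_relabel a g"
    and right_relabel_add: "right_relabel (f + g) a = right_relabel f a + right_relabel g a"
    and right_relabel_add_right: "right_relabel f (a + b) = right_relabel f a + right_relabel f b"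
    and base_lin_add: "base_lin p (u + v) = base_lin p u + base_lin p v"
  by (simp_all add: relabel_defs lin_ext_add lin_ext_add_fun)

text \<open>The hypotheses on the supports matter: a diagram with fewer than \<open>p\<close>
  propagating strands would be truncated on one side and merely relabelled on the other. Under them
  the product of two basis elements is again a basis element, with coefficient
  \<open>\<delta> ^ 0\<close>.\<close>

lemma diagram_bimodule_smult:
  assumes a: "Poly_Mapping.keys a \<subseteq> {\<sigma>. \<sigma> permutes {1..p}}" and f: "Poly_Mapping.keys f \<subseteq> diagrams_pr p r p"
  shows "a \<odot>\<^bsub>diagram_bimodule \<delta> p r\<^esub> f = left_relabel a f"
proof -
  have "lin_ext (\<lambda>x. if propagating x < p then 0 else Poly_Mapping.single x 1)
      (Poly_Mapping.single (diagram_comp (perm_diagram p \<sigma>) d) (\<delta> ^ loops (perm_diagram p \<sigma>) d))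
      = Poly_Mapping.single (relabel (inv' \<sigma>) id d) 1"
    if "\<sigma> \<in> Poly_Mapping.keys a" "d \<in> Poly_Mapping.keys f" for \<sigma> d
  proof -
    have s: "\<sigma> permutes {1..p}" and d: "d \<in> diagrams_pr p r p" using that a f by auto
    then have "d \<in> diagrams p r" by (simp add: diagrams_pr_def)
    moreover have "propagating (relabel (inv' \<sigma>) id d) = p"
      using relabel_in_diagrams_pr[OF d permutes_inv[OF s] permutes_id] by (simp add: diagrams_pr_def)
    ultimately show ?thesis
      using diagram_comp_perm_left[of d p r \<sigma>] loops_perm_left[of d p r \<sigma>] s by simp
  qed
  then show ?thesis
    by (simp add: diagram_bimodule_def truncate_pr_def brauer_mult_def sym_to_brauer_def relabel_defs
        lin_ext_lin_ext cong: lin_ext_cong)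
qed

lemma diagram_bimodule_rsmult:
  assumes a: "Poly_Mapping.keys a \<subseteq> {\<tau>. \<tau> permutes {1..r}}" and f: "Poly_Mapping.keys f \<subseteq> diagrams_pr p r p"
  shows "rsmult (diagram_bimodule \<delta> p r) f (sym_to_brauer r a) = right_relabel f a"
proof -
  have "lin_ext (\<lambda>x. if propagating x < p then 0 else Poly_Mapping.single x 1)
      (Poly_Mapping.single (diagram_comp d (perm_diagram r \<tau>)) (\<delta> ^ loops d (perm_diagram r \<tau>)))
      = Poly_Mapping.single (relabel id \<tau> d) 1"
    if "\<tau> \<in> Poly_Mapping.keys a" "d \<in> Poly_Mapping.keys f" for \<tau> d
  proof -
    have s: "\<tau> permutes {1..r}" and d: "d \<in> diagrams_pr p r p" using that a f by auto
    then have "d \<in> diagrams p r" by (simp add: diagrams_pr_def)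
    moreover have "propagating (relabel id \<tau> d) = p"
      using relabel_in_diagrams_pr[OF d permutes_id s] by (simp add: diagrams_pr_def)
    ultimately show ?thesis
      using diagram_comp_perm_right[of d p r \<tau>] loops_perm_right[of d p r \<tau>] s by simp
  qed
  then show ?thesis
    by (simp add: diagram_bimodule_def truncate_pr_def brauer_mult_def sym_to_brauer_def relabel_defs
        lin_ext_lin_ext cong: lin_ext_cong)
qed

lemma left_relabel_closed:
  assumes "Poly_Mapping.keys a \<subseteq> {\<sigma>. \<sigma> permutes {1..p}}" "Poly_Mapping.keys f \<subseteq> diagrams_pr p r q"
  shows "Poly_Mapping.keys (left_relabel a f) \<subseteq> diagrams_pr p r q"
  unfolding relabel_defs
  by (intro keys_lin_ext) (use assms in \<open>auto intro!: relabel_in_diagrams_pr permutes_inv permutes_id\<close>)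

lemma right_relabel_closed:
  assumes "Poly_Mapping.keys a \<subseteq> {\<tau>. \<tau> permutes {1..r}}" "Poly_Mapping.keys f \<subseteq> diagrams_pr p r q"
  shows "Poly_Mapping.keys (right_relabel f a) \<subseteq> diagrams_pr p r q"
  unfolding relabel_defs
  by (intro keys_lin_ext) (use assms in \<open>auto intro!: relabel_in_diagrams_pr permutes_id\<close>)

lemma base_lin_closed:
  assumes "Poly_Mapping.keys w \<subseteq> perfect_matchings {1..m}"
  shows "Poly_Mapping.keys (base_lin p w) \<subseteq> diagrams_pr p (p + m) p"
  unfolding base_lin_def
  by (intro keys_lin_ext) (use assms in \<open>auto intro!: base_diagram_in\<close>)

text \<open>The two actions concern different rows. This commutation lets the right action descend
  to the tensor product over \<open>sym_algebra p\<close>.\<close>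

lemma left_right_relabel: "left_relabel a (right_relabel f b) = right_relabel (left_relabel a f) b"
  by (simp add: relabel_defs lin_ext_lin_ext relabel_relabel)

lemma right_relabel_mult:
  "right_relabel f (a \<otimes>\<^bsub>sym_algebra r\<^esub> b) = right_relabel (right_relabel f a) b"
  by (simp add: relabel_defs group_algebra_mult lin_ext_lin_ext relabel_relabel sym_group_mult)

text \<open>The linear form of \<open>relabel_base_diagram_left\<close>. All of \<open>c\<close>
  sits with \<open>g\<close> while \<open>h\<close> has coefficient 1, which is how
  \<open>external_tensor\<close> distributes the coefficient of \<open>(g, h)\<close>.\<close>

lemma left_relabel_base:
  assumes w: "Poly_Mapping.keys w \<subseteq> perfect_matchings {1..m}"
    and g: "g permutes {1..p}" and h: "h permutes {1..m}"
  shows "left_relabel (Poly_Mapping.single g c)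
      (right_relabel (base_lin p (Poly_Mapping.single h 1 \<odot>\<^bsub>matching_module m\<^esub> w)) f)
    = right_relabel (base_lin p w)
      (Poly_Mapping.single (block_perm p (g, h)) c \<otimes>\<^bsub>sym_algebra r\<^esub> f)"
proof -
  have eq: "relabel (inv' g) \<tau> (base_diagram p ((\<lambda>e. h -` e) ` \<mu>))
      = relabel id (block_perm p (g, h) \<circ> \<tau>) (base_diagram p \<mu>)"
    if "\<mu> \<in> perfect_matchings {1..m}" for \<mu> \<tau>
    using arg_cong[OF relabel_base_diagram_left[OF that g h], of "relabel id \<tau>"]
    by (simp add: relabel_relabel)
  show ?thesis
    by (simp add: relabel_defs matching_module_smult_single group_algebra_mult sym_group_mult
        lin_ext_single_scale lin_ext_scale scale_lin_ext lin_ext_lin_ext relabel_relabel)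
      (use w in \<open>auto simp: eq intro!: lin_ext_cong\<close>)
qed

text \<open>On either side a scalar is a multiple of the identity permutation, and relabelling by
  the identity does nothing. This yields the balancing over the ground ring.\<close>

lemma base_lin_scalar:
  "left_relabel (Poly_Mapping.single id c) (right_relabel (base_lin p w) f)
    = right_relabel (base_lin p (Poly_Mapping.single id c \<odot>\<^bsub>matching_module m\<^esub> w)) f"
  by (simp add: relabel_defs matching_module_smult_single
        lin_ext_single_scale lin_ext_scale scale_lin_ext lin_ext_lin_ext lin_ext_id)

section \<open>Restriction of inflated modules\<close>

text \<open>Working with \<open>p + m\<close> keeps the shift by \<open>p\<close> free of
  subtraction; \<open>m\<close> becomes \<open>r - p\<close> at the very end.\<close>

locale inflation_restriction =
  fixes \<delta> :: "'k::comm_ring_1" and p m :: nat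
    and V :: "((nat \<Rightarrow> nat) \<Rightarrow>\<^sub>0 'k, 'v) module"
  assumes V: "right_module (sym_algebra p) V"
begin

sublocale V: right_module "sym_algebra p" V by (rule V)

declare One_nat_def [simp del]

abbreviation "Sp \<equiv> sym_group p"
abbreviation "Sm \<equiv> sym_group m"
abbreviation "r \<equiv> p + m"
abbreviation "S \<equiv> sym_group r"
abbreviation "H \<equiv> Sp \<times>\<times> Sm"
abbreviation "M \<equiv> matching_module m :: ((nat \<Rightarrow> nat) \<Rightarrow>\<^sub>0 'k, _) module"
abbreviation "B \<equiv> diagram_bimodule \<delta> p r"
abbreviation "Ext \<equiv> external_tensor Sp Sm V M"
abbreviation "Ind \<equiv> induction_product p m V M"
abbreviation "Infl \<equiv> inflation \<delta> p r V"
abbreviation "kG \<equiv> group_algebra S :: ((nat \<Rightarrow> nat) \<Rightarrow>\<^sub>0 'k) ring"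
abbreviation "kH \<equiv> group_algebra H :: ((nat \<Rightarrow> nat) \<times> (nat \<Rightarrow> nat) \<Rightarrow>\<^sub>0 'k) ring"
abbreviation "\<iota> \<equiv> lin_ext (\<lambda>h. Poly_Mapping.single (block_perm p h) (1 :: 'k))"

lemma carrier_sym [simp]: "carrier (sym_group n) = {\<sigma>. \<sigma> permutes {1..n}}"
  by (auto simp: sym_group_carrier)

lemma carrier_H: "carrier H = {\<sigma>. \<sigma> permutes {1..p}} \<times> {\<sigma>. \<sigma> permutes {1..m}}"
  by (simp add: DirProd_def)

sublocale M: right_module "sym_algebra m" M
  by (rule right_module_matching)

sublocale kG: ring kG
  by (rule ring_group_algebra[OF sym_group_is_group])

lemma single_closed: "x \<in> carrier G \<Longrightarrow> Poly_Mapping.single x c \<in> carrier (group_algebra G)"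
  by simp

lemma iota_closed: "a \<in> carrier kH \<Longrightarrow> \<iota> a \<in> carrier kG"
  by (simp, intro keys_lin_ext) (auto simp: carrier_H intro!: block_perm_permutes)

text \<open>The names \<open>L\<close>, \<open>E\<close> and \<open>I\<close> refer to the tensor products underlying \<open>Infl\<close>, \<open>Ext\<close> and \<open>Ind\<close>.\<close>

sublocale L: tensor_pair "sym_algebra p" V B
proof (rule tensor_pair.intro)
  show "abelian_group V" by (rule V.M.abelian_group_axioms)
  show "abelian_group B" by (rule abelian_group_poly_mappingI) simp_all
qed (simp_all add: V.smult_closed diagram_bimodule_smult left_relabel_closed)

section \<open>The external tensor product of V and the matching module\<close>

definition scalarsV where "scalarsV = restrict_scalars (scalar_embed Sp) V"
definition scalarsM where "scalarsM = restrict_scalars (scalar_embed Sm) M"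

lemma scalars_simps [simp]:
  "carrier scalarsV = carrier V" "zero scalarsV = zero V" "add scalarsV = add V"
  "carrier scalarsM = carrier M" "zero scalarsM = 0" "add scalarsM = (+)"
  "c \<odot>\<^bsub>scalarsV\<^esub> v = Poly_Mapping.single id c \<odot>\<^bsub>V\<^esub> v"
  "c \<odot>\<^bsub>scalarsM\<^esub> w = Poly_Mapping.single id c \<odot>\<^bsub>M\<^esub> w"
  by (simp_all add: scalarsV_def scalarsM_def scalar_embed_def sym_group_one)

lemma V_smult_zero: "v \<in> carrier V \<Longrightarrow> 0 \<odot>\<^bsub>V\<^esub> v = \<zero>\<^bsub>V\<^esub>"
  using V.smult_l_distr[of 0 0 v] V.smult_closed[of 0 v] V.M.add.l_cancel_one by simp

lemma single_V_closed [simp]: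
  "g permutes {1..p} \<Longrightarrow> v \<in> carrier V \<Longrightarrow> Poly_Mapping.single g c \<odot>\<^bsub>V\<^esub> v \<in> carrier V"
  by (rule V.smult_closed) simp_all

lemma single_M_closed:
  "h permutes {1..m} \<Longrightarrow> w \<in> carrier M \<Longrightarrow> Poly_Mapping.single h c \<odot>\<^bsub>M\<^esub> w \<in> carrier M"
  by (rule M.smult_closed) simp_all

sublocale E: tensor_pair "ring_of_type_algebra :: 'k ring" scalarsV scalarsM
proof (rule tensor_pair.intro)
  show "abelian_group scalarsV"
    unfolding scalarsV_def by (rule abelian_group_restrict_scalars) (rule V.M.abelian_group_axioms)
  show "abelian_group scalarsM"
    unfolding scalarsM_def by (rule abelian_group_restrict_scalars) (rule M.M.abelian_group_axioms)
  fix a :: 'k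
  show "a \<odot>\<^bsub>scalarsV\<^esub> v \<in> carrier scalarsV" if "v \<in> carrier scalarsV" for v
    using that by (simp add: permutes_id)
  show "a \<odot>\<^bsub>scalarsM\<^esub> w \<in> carrier scalarsM" if "w \<in> carrier scalarsM" for w
    using that single_M_closed[OF permutes_id] by simp
qed

abbreviation act_ext where
  "act_ext \<equiv> \<lambda>f (v, w). \<Sum>(g, h)\<in>Poly_Mapping.keys f.
         frag_of (Poly_Mapping.single g (Poly_Mapping.lookup f (g, h)) \<odot>\<^bsub>V\<^esub> v,
                  Poly_Mapping.single h 1 \<odot>\<^bsub>M\<^esub> w)"

lemma Ext_eq: "Ext = tensor_module (ring_of_type_algebra :: 'k ring) scalarsV scalarsM act_ext"
  by (simp only: external_tensor_def scalarsV_def scalarsM_def)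

sublocale Ext: abelian_group Ext
  unfolding Ext_eq by (rule E.abelian_group_tensor)

text \<open>The sum runs over the whole finite group and not over the support of \<open>a\<close>:
  with a fixed index set, additivity in \<open>v\<close>, in \<open>w\<close> and in
  \<open>a\<close> can be checked term by term. Off the support the first factor is multiplied by
  0.\<close>

lemma Ext_smult_sum:
  assumes a: "a \<in> carrier kH" and v: "v \<in> carrier V" and w: "w \<in> carrier M"
  shows "act_ext a (v, w) \<in> carrier E.F"
    and "E.K #>\<^bsub>E.F\<^esub> act_ext a (v, w) = (\<Oplus>\<^bsub>Ext\<^esub>x\<in>carrier H.
      E.et (Poly_Mapping.single (fst x) (Poly_Mapping.lookup a x) \<odot>\<^bsub>V\<^esub> v) (Poly_Mapping.single (snd x) 1 \<odot>\<^bsub>M\<^esub> w))"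
proof -
  let ?t = "\<lambda>x. frag_of (Poly_Mapping.single (fst x) (Poly_Mapping.lookup a x) \<odot>\<^bsub>V\<^esub> v,
    Poly_Mapping.single (snd x) 1 \<odot>\<^bsub>M\<^esub> w)"
  let ?e = "\<lambda>x. E.et (Poly_Mapping.single (fst x) (Poly_Mapping.lookup a x) \<odot>\<^bsub>V\<^esub> v)
    (Poly_Mapping.single (snd x) 1 \<odot>\<^bsub>M\<^esub> w)"
  have sub: "Poly_Mapping.keys a \<subseteq> carrier H" using a by simp
  have eq: "act_ext a (v, w) = (\<Sum>x\<in>Poly_Mapping.keys a. ?t x)"
    by (simp add: case_prod_unfold)
  have t: "?t x \<in> carrier E.F" if "x \<in> carrier H" for x
    using that v w by (intro E.frag_of_closed) (auto simp: carrier_H single_M_closed simp del: matching_module_simps)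
  then have t': "?t x \<in> carrier E.F" if "x \<in> Poly_Mapping.keys a" for x
    using that sub by blast
  show "act_ext a (v, w) \<in> carrier E.F"
    unfolding eq by (rule E.coset_sum(1)[OF finite_keys t'])
  have "E.K #>\<^bsub>E.F\<^esub> act_ext a (v, w) = (\<Oplus>\<^bsub>Ext\<^esub>x\<in>Poly_Mapping.keys a. ?e x)"
    unfolding eq Ext_eq elem_tensor_def by (rule E.coset_sum(2)[OF finite_keys t'])
  also have "\<dots> = (\<Oplus>\<^bsub>Ext\<^esub>x\<in>carrier H. ?e x)"
  proof (rule Ext.add.finprod_mono_neutral_cong_left)
    show "finite (carrier H)" by (simp add: carrier_H finite_permutations)
    show "?e x = \<zero>\<^bsub>Ext\<^esub>" if "x \<in> carrier H - Poly_Mapping.keys a" for x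
      using that w E.et_zero_left[of "Poly_Mapping.single (snd x) 1 \<odot>\<^bsub>M\<^esub> w" act_ext]
      by (auto simp: in_keys_iff V_smult_zero[OF v] Ext_eq carrier_H single_M_closed simp del: matching_module_simps)
    show "?e \<in> carrier H \<rightarrow> carrier Ext"
      using v w by (auto simp: Ext_eq carrier_H single_M_closed intro!: E.elem_tensor_closed simp del: matching_module_simps)
  qed (use sub in auto)
  finally show "E.K #>\<^bsub>E.F\<^esub> act_ext a (v, w) = (\<Oplus>\<^bsub>Ext\<^esub>x\<in>carrier H. ?e x)" .
qed

lemma E_et_closed: "v \<in> carrier V \<Longrightarrow> w \<in> carrier M \<Longrightarrow> E.et v w \<in> carrier Ext"
  unfolding Ext_eq by (rule E.elem_tensor_closed) simp_all

lemma Ext_balanced_smult: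
  assumes a: "a \<in> carrier kH"
  shows "balanced (ring_of_type_algebra :: 'k ring) scalarsV scalarsM Ext
    (\<lambda>v w. E.K #>\<^bsub>E.F\<^esub> act_ext a (v, w))"
proof -
  let ?\<beta> = "\<lambda>v w. \<Oplus>\<^bsub>Ext\<^esub>x\<in>carrier H.
      E.et (Poly_Mapping.single (fst x) (Poly_Mapping.lookup a x) \<odot>\<^bsub>V\<^esub> v) (Poly_Mapping.single (snd x) 1 \<odot>\<^bsub>M\<^esub> w)"
  have c: "(\<lambda>x. E.et (Poly_Mapping.single (fst x) (Poly_Mapping.lookup a x) \<odot>\<^bsub>V\<^esub> v)
      (Poly_Mapping.single (snd x) 1 \<odot>\<^bsub>M\<^esub> w)) \<in> carrier H \<rightarrow> carrier Ext"
    if "v \<in> carrier V" "w \<in> carrier M" for v w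
    using that by (auto simp: carrier_H single_M_closed intro!: E_et_closed simp del: matching_module_simps)
  note eq = Ext_smult_sum(2)[OF a]
  show ?thesis
  proof (rule balancedI)
    fix v w assume "v \<in> carrier scalarsV" "w \<in> carrier scalarsM"
    then show "E.K #>\<^bsub>E.F\<^esub> act_ext a (v, w) \<in> carrier Ext"
      using eq[of v w] c[of v w] Ext.finsum_closed by simp
  next
    fix v v' w assume *: "v \<in> carrier scalarsV" "v' \<in> carrier scalarsV" "w \<in> carrier scalarsM"
    then have v: "v \<in> carrier V" "v' \<in> carrier V" and w: "w \<in> carrier M" by simp_all
    have "?\<beta> (v \<oplus>\<^bsub>V\<^esub> v') w = ?\<beta> v w \<oplus>\<^bsub>Ext\<^esub> ?\<beta> v' w"
    proof (subst Ext.finsum_addf[OF c[OF v(1) w] c[OF v(2) w], symmetric], rule Ext.finsum_cong')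
      show "(\<lambda>x. E.et (Poly_Mapping.single (fst x) (Poly_Mapping.lookup a x) \<odot>\<^bsub>V\<^esub> v) (Poly_Mapping.single (snd x) 1 \<odot>\<^bsub>M\<^esub> w) \<oplus>\<^bsub>Ext\<^esub>
          E.et (Poly_Mapping.single (fst x) (Poly_Mapping.lookup a x) \<odot>\<^bsub>V\<^esub> v') (Poly_Mapping.single (snd x) 1 \<odot>\<^bsub>M\<^esub> w))
          \<in> carrier H \<rightarrow> carrier Ext"
        using c[OF v(1) w] c[OF v(2) w] by auto
      fix x assume "x \<in> carrier H"
      then have x: "fst x permutes {1..p}" "snd x permutes {1..m}" by (auto simp: carrier_H)
      show "E.et (Poly_Mapping.single (fst x) (Poly_Mapping.lookup a x) \<odot>\<^bsub>V\<^esub> (v \<oplus>\<^bsub>V\<^esub> v')) (Poly_Mapping.single (snd x) 1 \<odot>\<^bsub>M\<^esub> w)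
        = E.et (Poly_Mapping.single (fst x) (Poly_Mapping.lookup a x) \<odot>\<^bsub>V\<^esub> v) (Poly_Mapping.single (snd x) 1 \<odot>\<^bsub>M\<^esub> w) \<oplus>\<^bsub>Ext\<^esub>
          E.et (Poly_Mapping.single (fst x) (Poly_Mapping.lookup a x) \<odot>\<^bsub>V\<^esub> v') (Poly_Mapping.single (snd x) 1 \<odot>\<^bsub>M\<^esub> w)"
        using E.et_add_left[of "Poly_Mapping.single (fst x) (Poly_Mapping.lookup a x) \<odot>\<^bsub>V\<^esub> v"
            "Poly_Mapping.single (snd x) 1 \<odot>\<^bsub>M\<^esub> w"
            "Poly_Mapping.single (fst x) (Poly_Mapping.lookup a x) \<odot>\<^bsub>V\<^esub> v'" act_ext]
          v w x single_M_closed[OF x(2) w]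
        by (simp add: V.smult_r_distr Ext_eq)
    qed simp
    then show "E.K #>\<^bsub>E.F\<^esub> act_ext a (v \<oplus>\<^bsub>scalarsV\<^esub> v', w)
        = (E.K #>\<^bsub>E.F\<^esub> act_ext a (v, w)) \<oplus>\<^bsub>Ext\<^esub> (E.K #>\<^bsub>E.F\<^esub> act_ext a (v', w))"
      using v w by (simp only: eq V.M.add.m_closed scalars_simps)
  next
    fix v w w' assume *: "v \<in> carrier scalarsV" "w \<in> carrier scalarsM" "w' \<in> carrier scalarsM"
    then have v: "v \<in> carrier V" and w: "w \<in> carrier M" "w' \<in> carrier M" by simp_all
    have "?\<beta> v (w \<oplus>\<^bsub>M\<^esub> w') = ?\<beta> v w \<oplus>\<^bsub>Ext\<^esub> ?\<beta> v w'"
    proof (subst Ext.finsum_addf[OF c[OF v w(1)] c[OF v w(2)], symmetric], rule Ext.finsum_cong')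
      show "(\<lambda>x. E.et (Poly_Mapping.single (fst x) (Poly_Mapping.lookup a x) \<odot>\<^bsub>V\<^esub> v) (Poly_Mapping.single (snd x) 1 \<odot>\<^bsub>M\<^esub> w) \<oplus>\<^bsub>Ext\<^esub>
          E.et (Poly_Mapping.single (fst x) (Poly_Mapping.lookup a x) \<odot>\<^bsub>V\<^esub> v) (Poly_Mapping.single (snd x) 1 \<odot>\<^bsub>M\<^esub> w'))
          \<in> carrier H \<rightarrow> carrier Ext"
        using c[OF v w(1)] c[OF v w(2)] by auto
      fix x assume "x \<in> carrier H"
      then have x: "fst x permutes {1..p}" "snd x permutes {1..m}" by (auto simp: carrier_H)
      have "Poly_Mapping.single (snd x) 1 \<odot>\<^bsub>M\<^esub> (w \<oplus>\<^bsub>M\<^esub> w')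
          = Poly_Mapping.single (snd x) 1 \<odot>\<^bsub>M\<^esub> w \<oplus>\<^bsub>M\<^esub> Poly_Mapping.single (snd x) 1 \<odot>\<^bsub>M\<^esub> w'"
        using w x by (intro M.smult_r_distr) simp_all
      then show "E.et (Poly_Mapping.single (fst x) (Poly_Mapping.lookup a x) \<odot>\<^bsub>V\<^esub> v) (Poly_Mapping.single (snd x) 1 \<odot>\<^bsub>M\<^esub> (w \<oplus>\<^bsub>M\<^esub> w'))
        = E.et (Poly_Mapping.single (fst x) (Poly_Mapping.lookup a x) \<odot>\<^bsub>V\<^esub> v) (Poly_Mapping.single (snd x) 1 \<odot>\<^bsub>M\<^esub> w) \<oplus>\<^bsub>Ext\<^esub>
          E.et (Poly_Mapping.single (fst x) (Poly_Mapping.lookup a x) \<odot>\<^bsub>V\<^esub> v) (Poly_Mapping.single (snd x) 1 \<odot>\<^bsub>M\<^esub> w')"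
        using E.et_add_right[of "Poly_Mapping.single (fst x) (Poly_Mapping.lookup a x) \<odot>\<^bsub>V\<^esub> v"
            "Poly_Mapping.single (snd x) 1 \<odot>\<^bsub>M\<^esub> w" "Poly_Mapping.single (snd x) 1 \<odot>\<^bsub>M\<^esub> w'" act_ext]
          v x single_M_closed[OF x(2) w(1)] single_M_closed[OF x(2) w(2)]
        by (simp add: Ext_eq)
    qed simp
    then show "E.K #>\<^bsub>E.F\<^esub> act_ext a (v, w \<oplus>\<^bsub>scalarsM\<^esub> w')
        = (E.K #>\<^bsub>E.F\<^esub> act_ext a (v, w)) \<oplus>\<^bsub>Ext\<^esub> (E.K #>\<^bsub>E.F\<^esub> act_ext a (v, w'))"
      using eq[OF v w(1)] eq[OF v w(2)] eq[OF v M.M.add.m_closed[OF w]] by simp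
  next
    fix c v w assume *: "v \<in> carrier scalarsV" "w \<in> carrier scalarsM"
    then have v: "v \<in> carrier V" and w: "w \<in> carrier M" by simp_all
    let ?c\<^sub>1 = "Poly_Mapping.single id c \<odot>\<^bsub>V\<^esub> v" and ?c\<^sub>2 = "Poly_Mapping.single id c \<odot>\<^bsub>M\<^esub> w"
    have cl: "?c\<^sub>1 \<in> carrier V" "?c\<^sub>2 \<in> carrier M"
      by (rule single_V_closed[OF permutes_id v], rule single_M_closed[OF permutes_id w])
    have "?\<beta> ?c\<^sub>1 w = ?\<beta> v ?c\<^sub>2"
    proof (rule Ext.finsum_cong'[OF refl c[OF v cl(2)]])
      fix x assume "x \<in> carrier H"
      then have x: "fst x permutes {1..p}" "snd x permutes {1..m}" by (auto simp: carrier_H)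
      \<comment> \<open>Multiples of the identity commute with the other monomials, so the scalar
        \<open>c\<close> can be pulled out past \<open>g\<close> on one side and past
        \<open>h\<close> on the other, and then be moved across the tensor sign.\<close>
      have comm: "Poly_Mapping.single g b \<otimes>\<^bsub>sym_algebra n\<^esub> Poly_Mapping.single id c
          = Poly_Mapping.single id c \<otimes>\<^bsub>sym_algebra n\<^esub> Poly_Mapping.single g b" for n g and b :: 'k
        by (simp add: group_algebra_mult_single sym_group_mult mult.commute)
      have 1: "Poly_Mapping.single (fst x) b \<odot>\<^bsub>V\<^esub> ?c\<^sub>1 = Poly_Mapping.single id c \<odot>\<^bsub>V\<^esub> (Poly_Mapping.single (fst x) b \<odot>\<^bsub>V\<^esub> v)" for b
        using V.smult_assoc[of "Poly_Mapping.single (fst x) b" "Poly_Mapping.single id c" v]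
          V.smult_assoc[of "Poly_Mapping.single id c" "Poly_Mapping.single (fst x) b" v] v x comm
        by (simp add: permutes_id)
      have 2: "Poly_Mapping.single (snd x) 1 \<odot>\<^bsub>M\<^esub> ?c\<^sub>2 = Poly_Mapping.single id c \<odot>\<^bsub>M\<^esub> (Poly_Mapping.single (snd x) 1 \<odot>\<^bsub>M\<^esub> w)"
        using M.smult_assoc[of "Poly_Mapping.single (snd x) 1" "Poly_Mapping.single id c" w]
          M.smult_assoc[of "Poly_Mapping.single id c" "Poly_Mapping.single (snd x) 1" w] w x comm
        by (simp add: permutes_id)
      show "E.et (Poly_Mapping.single (fst x) (Poly_Mapping.lookup a x) \<odot>\<^bsub>V\<^esub> ?c\<^sub>1) (Poly_Mapping.single (snd x) 1 \<odot>\<^bsub>M\<^esub> w)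
        = E.et (Poly_Mapping.single (fst x) (Poly_Mapping.lookup a x) \<odot>\<^bsub>V\<^esub> v) (Poly_Mapping.single (snd x) 1 \<odot>\<^bsub>M\<^esub> ?c\<^sub>2)"
        using E.et_smult[of "Poly_Mapping.single (fst x) (Poly_Mapping.lookup a x) \<odot>\<^bsub>V\<^esub> v"
            "Poly_Mapping.single (snd x) 1 \<odot>\<^bsub>M\<^esub> w" c] v x single_M_closed[OF x(2) w]
        by (simp add: 1 2 ring_of_type_algebra_def)
    qed
    then show "E.K #>\<^bsub>E.F\<^esub> act_ext a (c \<odot>\<^bsub>scalarsV\<^esub> v, w) = E.K #>\<^bsub>E.F\<^esub> act_ext a (v, c \<odot>\<^bsub>scalarsM\<^esub> w)"
      using eq[OF v cl(2)] eq[OF cl(1) w] by simp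
  qed
qed

lemma Ext_smult_hom:
  "a \<in> carrier kH \<Longrightarrow> (\<lambda>U. a \<odot>\<^bsub>Ext\<^esub> U) \<in> hom (add_monoid Ext) (add_monoid Ext)"
  using E.tensor_smult_hom[of act_ext a] Ext_smult_sum(1)[of a] Ext_balanced_smult[of a]
  unfolding Ext_eq by simp

lemma Ext_smult_elem:
  assumes a: "a \<in> carrier kH" and v: "v \<in> carrier V" and w: "w \<in> carrier M"
  shows "a \<odot>\<^bsub>Ext\<^esub> E.et v w = (\<Oplus>\<^bsub>Ext\<^esub>x\<in>carrier H.
      E.et (Poly_Mapping.single (fst x) (Poly_Mapping.lookup a x) \<odot>\<^bsub>V\<^esub> v) (Poly_Mapping.single (snd x) 1 \<odot>\<^bsub>M\<^esub> w))"
  using E.tensor_smult_elem[of act_ext a v w] Ext_smult_sum[OF a] Ext_balanced_smult[OF a] v w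
  unfolding Ext_eq by simp

lemma Ext_smult_single:
  assumes g: "g permutes {1..p}" and h: "h permutes {1..m}" and v: "v \<in> carrier V" and w: "w \<in> carrier M"
  shows "Poly_Mapping.single (g, h) c \<odot>\<^bsub>Ext\<^esub> E.et v w
    = E.et (Poly_Mapping.single g c \<odot>\<^bsub>V\<^esub> v) (Poly_Mapping.single h 1 \<odot>\<^bsub>M\<^esub> w)"
proof -
  let ?a = "Poly_Mapping.single (g, h) c"
  let ?t = "\<lambda>x. E.et (Poly_Mapping.single (fst x) (Poly_Mapping.lookup ?a x) \<odot>\<^bsub>V\<^esub> v)
    (Poly_Mapping.single (snd x) 1 \<odot>\<^bsub>M\<^esub> w)"
  have gh: "(g, h) \<in> carrier H" using g h by (simp add: carrier_H)
  have "?a \<odot>\<^bsub>Ext\<^esub> E.et v w = (\<Oplus>\<^bsub>Ext\<^esub>x\<in>carrier H. ?t x)"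
    by (rule Ext_smult_elem[OF single_closed[OF gh] v w])
  also have "\<dots> = ?t (g, h)"
  proof (rule Ext.finsum_single)
    show "finite (carrier H)" by (simp add: carrier_H finite_permutations)
    show "?t (g, h) \<in> carrier Ext"
      using g h v w by (intro E_et_closed) (simp_all add: single_M_closed del: matching_module_simps)
    fix x assume "x \<in> carrier H - {(g, h)}"
    moreover from this have "Poly_Mapping.lookup ?a x = 0"
      by (auto simp: lookup_single)
    ultimately show "?t x = \<zero>\<^bsub>Ext\<^esub>"
      using w E.et_zero_left[of "Poly_Mapping.single (snd x) 1 \<odot>\<^bsub>M\<^esub> w" act_ext]
      by (auto simp: V_smult_zero[OF v] Ext_eq carrier_H single_M_closed simp del: matching_module_simps)
  qed (rule gh)
  finally show ?thesis by simp
qed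

text \<open>Together with \<open>Ext_smult_single\<close> this reduces identities about the action
  of \<open>kH\<close> on elementary tensors to single pairs \<open>(g, h)\<close> with a
  coefficient.\<close>

lemma Ext_smult_elem_add:
  assumes a: "a \<in> carrier kH" and b: "b \<in> carrier kH" and v: "v \<in> carrier V" and w: "w \<in> carrier M"
  shows "(a + b) \<odot>\<^bsub>Ext\<^esub> E.et v w = a \<odot>\<^bsub>Ext\<^esub> E.et v w \<oplus>\<^bsub>Ext\<^esub> b \<odot>\<^bsub>Ext\<^esub> E.et v w"
proof -
  let ?t = "\<lambda>a x. E.et (Poly_Mapping.single (fst x) (Poly_Mapping.lookup a x) \<odot>\<^bsub>V\<^esub> v)
    (Poly_Mapping.single (snd x) 1 \<odot>\<^bsub>M\<^esub> w)"
  have c: "?t a \<in> carrier H \<rightarrow> carrier Ext" for a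
    using v w by (auto simp: carrier_H single_M_closed intro!: E_et_closed simp del: matching_module_simps)
  have ab: "a + b \<in> carrier kH" using a b keys_add[of a b] by auto
  have "(\<Oplus>\<^bsub>Ext\<^esub>x\<in>carrier H. ?t (a + b) x) = (\<Oplus>\<^bsub>Ext\<^esub>x\<in>carrier H. ?t a x \<oplus>\<^bsub>Ext\<^esub> ?t b x)"
  proof (rule Ext.finsum_cong'[OF refl])
    show "(\<lambda>x. ?t a x \<oplus>\<^bsub>Ext\<^esub> ?t b x) \<in> carrier H \<rightarrow> carrier Ext"
      using c[of a] c[of b] by auto
    fix x assume "x \<in> carrier H"
    then have x: "fst x permutes {1..p}" "snd x permutes {1..m}" by (auto simp: carrier_H)
    show "?t (a + b) x = ?t a x \<oplus>\<^bsub>Ext\<^esub> ?t b x"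
      using E.et_add_left[of "Poly_Mapping.single (fst x) (Poly_Mapping.lookup a x) \<odot>\<^bsub>V\<^esub> v"
            "Poly_Mapping.single (snd x) 1 \<odot>\<^bsub>M\<^esub> w"
            "Poly_Mapping.single (fst x) (Poly_Mapping.lookup b x) \<odot>\<^bsub>V\<^esub> v" act_ext]
        V.smult_l_distr[of "Poly_Mapping.single (fst x) (Poly_Mapping.lookup a x)"
            "Poly_Mapping.single (fst x) (Poly_Mapping.lookup b x)" v]
        v x single_M_closed[OF x(2) w]
      by (simp add: lookup_add single_add Ext_eq)
  qed
  then show ?thesis
    using Ext.finsum_addf[OF c[of a] c[of b]]
    by (simp only: Ext_smult_elem[OF ab v w] Ext_smult_elem[OF a v w] Ext_smult_elem[OF b v w])
qed

lemma Ext_smult_closed: "a \<in> carrier kH \<Longrightarrow> U \<in> carrier Ext \<Longrightarrow> a \<odot>\<^bsub>Ext\<^esub> U \<in> carrier Ext"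
  by (rule hom_add_closed[OF Ext_smult_hom])

section \<open>The induced and the inflated module as tensor products\<close>

abbreviation IB :: "((nat \<Rightarrow> nat) \<times> (nat \<Rightarrow> nat) \<Rightarrow>\<^sub>0 'k, (nat \<Rightarrow> nat) \<Rightarrow>\<^sub>0 'k, (nat \<Rightarrow> nat) \<Rightarrow>\<^sub>0 'k) bimodule"
  where "IB \<equiv> induction_bimodule S (block_perm p)"

sublocale I: tensor_pair kH Ext IB
proof (rule tensor_pair.intro)
  show "abelian_group Ext" by (rule Ext.abelian_group_axioms)
  show "abelian_group IB" by (rule abelian_group_poly_mappingI) simp_all
  show "a \<odot>\<^bsub>IB\<^esub> f \<in> carrier IB" if "a \<in> carrier kH" "f \<in> carrier IB" for a f
    using kG.m_closed[OF iota_closed[OF that(1)], of f] that(2) by simp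
qed (rule Ext_smult_closed)

abbreviation act_right where "act_right W \<equiv> \<lambda>b (v, w). frag_of (v, rsmult W w b)"

lemma Ind_eq: "Ind = tensor_module kH Ext IB (act_right IB)"
  by (simp add: induction_product_def induced_module_def tensor_def)

lemma Infl_eq: "Infl = tensor_module (sym_algebra p) V B (act_right B)"
  by (simp add: inflation_def tensor_def)

sublocale Ind: abelian_group Ind
  unfolding Ind_eq by (rule I.abelian_group_tensor)

sublocale Infl: abelian_group Infl
  unfolding Infl_eq by (rule L.abelian_group_tensor)

lemma Ind_smult:
  assumes b: "b \<in> carrier kG"
  shows Ind_smult_hom: "(\<lambda>x. b \<odot>\<^bsub>Ind\<^esub> x) \<in> hom (add_monoid Ind) (add_monoid Ind)"
    and Ind_smult_elem: "\<And>U f. U \<in> carrier Ext \<Longrightarrow> f \<in> carrier kG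
      \<Longrightarrow> b \<odot>\<^bsub>Ind\<^esub> I.et U f = I.et U (f \<otimes>\<^bsub>kG\<^esub> b)"
proof -
  have h: "(\<lambda>f. f \<otimes>\<^bsub>kG\<^esub> b) \<in> hom (add_monoid IB) (add_monoid IB)"
  proof (rule hom_add_monoidI)
    fix f g assume fg: "f \<in> carrier IB" "g \<in> carrier IB"
    then show "f \<otimes>\<^bsub>kG\<^esub> b \<in> carrier IB" using kG.m_closed[of f b] b by simp
    show "(f \<oplus>\<^bsub>IB\<^esub> g) \<otimes>\<^bsub>kG\<^esub> b = f \<otimes>\<^bsub>kG\<^esub> b \<oplus>\<^bsub>IB\<^esub> g \<otimes>\<^bsub>kG\<^esub> b"
      using kG.l_distr[of f g b] b fg by simp
  qed
  have c: "(a \<odot>\<^bsub>IB\<^esub> f) \<otimes>\<^bsub>kG\<^esub> b = a \<odot>\<^bsub>IB\<^esub> (f \<otimes>\<^bsub>kG\<^esub> b)" if "a \<in> carrier kH" "f \<in> carrier IB" for a f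
    using kG.m_assoc[OF iota_closed[OF that(1)], of f b] b that(2) by simp
  show "(\<lambda>x. b \<odot>\<^bsub>Ind\<^esub> x) \<in> hom (add_monoid Ind) (add_monoid Ind)"
    unfolding Ind_eq by (rule I.tensor_smult_right_hom[OF _ h c]) simp_all
  show "b \<odot>\<^bsub>Ind\<^esub> I.et U f = I.et U (f \<otimes>\<^bsub>kG\<^esub> b)" if "U \<in> carrier Ext" "f \<in> carrier kG" for U f
    unfolding Ind_eq by (rule I.tensor_smult_right_elem[OF _ h c]) (use that in simp_all)
qed

text \<open>Restriction to the symmetric group means acting through \<open>sym_to_brauer\<close>,
  and for such elements the right action is a relabelling. The action of the remaining elements of
  the Brauer algebra is never examined.\<close>

lemma Infl_smult:
  assumes b: "b \<in> carrier kG"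
  shows Infl_smult_hom: "(\<lambda>x. sym_to_brauer r b \<odot>\<^bsub>Infl\<^esub> x) \<in> hom (add_monoid Infl) (add_monoid Infl)"
    and Infl_smult_elem: "\<And>v f. v \<in> carrier V \<Longrightarrow> f \<in> carrier B
      \<Longrightarrow> sym_to_brauer r b \<odot>\<^bsub>Infl\<^esub> L.et v f = L.et v (right_relabel f b)"
proof -
  let ?g = "\<lambda>f. rsmult B f (sym_to_brauer r b)"
  have g: "?g f = right_relabel f b" if "f \<in> carrier B" for f
    using that b by (intro diagram_bimodule_rsmult) simp_all
  have gc: "?g f \<in> carrier B" if "f \<in> carrier B" for f
    using right_relabel_closed[of b r f p p] that b g[OF that] by simp
  have h: "?g \<in> hom (add_monoid B) (add_monoid B)"
  proof (rule hom_add_monoidI)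
    fix f f' assume f: "f \<in> carrier B" "f' \<in> carrier B"
    then have "f \<oplus>\<^bsub>B\<^esub> f' \<in> carrier B" by (rule L.W.a_closed)
    then show "?g (f \<oplus>\<^bsub>B\<^esub> f') = ?g f \<oplus>\<^bsub>B\<^esub> ?g f'"
      by (simp only: g f) (simp add: right_relabel_add)
  qed (rule gc)
  have c: "?g (a \<odot>\<^bsub>B\<^esub> f) = a \<odot>\<^bsub>B\<^esub> ?g f" if a: "a \<in> carrier (sym_algebra p)" and f: "f \<in> carrier B" for a f
    using g[OF L.smult_W[OF a f]] g[OF f] gc[OF f] a f
    by (simp add: diagram_bimodule_smult left_right_relabel)
  show "(\<lambda>x. sym_to_brauer r b \<odot>\<^bsub>Infl\<^esub> x) \<in> hom (add_monoid Infl) (add_monoid Infl)"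
    unfolding Infl_eq by (rule L.tensor_smult_right_hom[OF _ h c]) simp_all
  show "sym_to_brauer r b \<odot>\<^bsub>Infl\<^esub> L.et v f = L.et v (right_relabel f b)" if "v \<in> carrier V" "f \<in> carrier B" for v f
    unfolding Infl_eq g[OF that(2), symmetric]
    by (rule L.tensor_smult_right_elem[OF _ h c]) (use that in simp_all)
qed

lemma L_et_closed: "v \<in> carrier V \<Longrightarrow> f \<in> carrier B \<Longrightarrow> L.et v f \<in> carrier Infl"
  unfolding Infl_eq by (rule L.elem_tensor_closed)

lemma I_et_closed: "U \<in> carrier Ext \<Longrightarrow> f \<in> carrier kG \<Longrightarrow> I.et U f \<in> carrier Ind"
  unfolding Ind_eq by (rule I.elem_tensor_closed) simp_all

section \<open>The map from the induction product to the inflation\<close>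

lemma base_relabel_closed: "w \<in> carrier M \<Longrightarrow> f \<in> carrier kG \<Longrightarrow> right_relabel (base_lin p w) f \<in> carrier B"
  using right_relabel_closed[OF _ base_lin_closed[of w m p], of f] by simp

text \<open>First of two lifts, with the group algebra element \<open>f\<close> as a parameter.
  Scalars from the ground ring are all that has to be balanced here; the relation over
  \<open>kH\<close> involves \<open>f\<close> and is left to the second lift.\<close>

lemma phi_ex:
  assumes f: "f \<in> carrier kG"
  shows "\<exists>h. h \<in> hom (add_monoid Ext) (add_monoid Infl) \<and>
    (\<forall>v\<in>carrier V. \<forall>w\<in>carrier M. h (E.et v w) = L.et v (right_relabel (base_lin p w) f))"
proof -
  have "balanced (ring_of_type_algebra :: 'k ring) scalarsV scalarsM Infl
    (\<lambda>v w. L.et v (right_relabel (base_lin p w) f))"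
  proof (rule balancedI)
    fix v w assume "v \<in> carrier scalarsV" "w \<in> carrier scalarsM"
    then have vw: "v \<in> carrier V" "w \<in> carrier M" by simp_all
    note x = base_relabel_closed[OF vw(2) f]
    show "L.et v (right_relabel (base_lin p w) f) \<in> carrier Infl"
      by (rule L_et_closed[OF vw(1) x])
    show "L.et (v \<oplus>\<^bsub>scalarsV\<^esub> v') (right_relabel (base_lin p w) f)
        = L.et v (right_relabel (base_lin p w) f) \<oplus>\<^bsub>Infl\<^esub> L.et v' (right_relabel (base_lin p w) f)"
      if "v' \<in> carrier scalarsV" for v'
      using L.et_add_left[OF vw(1) x] that unfolding Infl_eq by simp
    show "L.et v (right_relabel (base_lin p (w \<oplus>\<^bsub>scalarsM\<^esub> w')) f)
        = L.et v (right_relabel (base_lin p w) f) \<oplus>\<^bsub>Infl\<^esub> L.et v (right_relabel (base_lin p w') f)"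
      if "w' \<in> carrier scalarsM" for w'
      using L.et_add_right[OF vw(1) x base_relabel_closed[OF _ f, of w']] that
      unfolding Infl_eq by (simp add: base_lin_add right_relabel_add)
    show "L.et (c \<odot>\<^bsub>scalarsV\<^esub> v) (right_relabel (base_lin p w) f)
        = L.et v (right_relabel (base_lin p (c \<odot>\<^bsub>scalarsM\<^esub> w)) f)" for c
      using L.et_smult[OF vw(1) x, of "Poly_Mapping.single id c"] x
      by (simp add: permutes_id diagram_bimodule_smult base_lin_scalar[where m = m])
  qed
  from E.tensor_lift[OF Infl.abelian_group_axioms this, of act_ext] show ?thesis
    unfolding Ext_eq[symmetric] by (metis scalars_simps(1,4))
qed

text \<open>The lift is determined on \<open>carrier Ext\<close> by its values on elementary
  tensors, so the choice affects it only outside the carrier. Fixing one lift for each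
  \<open>f\<close> makes it a function of two variables.\<close>

definition phi where
  "phi f = (SOME h. h \<in> hom (add_monoid Ext) (add_monoid Infl) \<and>
    (\<forall>v\<in>carrier V. \<forall>w\<in>carrier M. h (E.et v w) = L.et v (right_relabel (base_lin p w) f)))"

lemma
  assumes "f \<in> carrier kG"
  shows phi_hom: "phi f \<in> hom (add_monoid Ext) (add_monoid Infl)"
    and phi_et: "v \<in> carrier V \<Longrightarrow> w \<in> carrier M \<Longrightarrow> phi f (E.et v w) = L.et v (right_relabel (base_lin p w) f)"
  using someI_ex[OF phi_ex[OF assms]] unfolding phi_def by auto

lemma Ext_ext:
  assumes "abelian_group A" "h \<in> hom (add_monoid Ext) (add_monoid A)" "k \<in> hom (add_monoid Ext) (add_monoid A)"
    and "\<And>v w. v \<in> carrier V \<Longrightarrow> w \<in> carrier M \<Longrightarrow> h (E.et v w) = k (E.et v w)" and "U \<in> carrier Ext"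
  shows "h U = k U"
  using E.tensor_ext[of A h act_ext k U] assms unfolding Ext_eq by simp

lemma phi_add:
  assumes f: "f \<in> carrier kG" and g: "g \<in> carrier kG" and U: "U \<in> carrier Ext"
  shows "phi (f + g) U = phi f U \<oplus>\<^bsub>Infl\<^esub> phi g U"
proof -
  have fg: "f + g \<in> carrier kG" using kG.a_closed[OF f g] by simp
  show ?thesis
  proof (rule Ext_ext[OF Infl.abelian_group_axioms phi_hom[OF fg] _ _ U])
    show "(\<lambda>U. phi f U \<oplus>\<^bsub>Infl\<^esub> phi g U) \<in> hom (add_monoid Ext) (add_monoid Infl)"
      by (rule hom_add_sum[OF Infl.abelian_group_axioms phi_hom[OF f] phi_hom[OF g]])
    fix v w assume vw: "v \<in> carrier V" "w \<in> carrier M"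
    show "phi (f + g) (E.et v w) = phi f (E.et v w) \<oplus>\<^bsub>Infl\<^esub> phi g (E.et v w)"
      using L.et_add_right[OF vw(1) base_relabel_closed[OF vw(2) f] base_relabel_closed[OF vw(2) g]]
      unfolding Infl_eq phi_et[OF fg vw] phi_et[OF f vw] phi_et[OF g vw]
      by (simp add: right_relabel_add_right)
  qed
qed

text \<open>The balancing over \<open>kH\<close>, the crux of the forward map. Both sides are
  additive in \<open>U\<close> and, on elementary tensors, in \<open>a\<close>, so a single pair
  \<open>(g, h)\<close> remains, where the action is explicit.\<close>

lemma phi_smult:
  assumes a: "a \<in> carrier kH" and f: "f \<in> carrier kG" and U: "U \<in> carrier Ext"
  shows "phi f (a \<odot>\<^bsub>Ext\<^esub> U) = phi (\<iota> a \<otimes>\<^bsub>kG\<^esub> f) U"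
proof -
  have cl: "\<iota> a \<otimes>\<^bsub>kG\<^esub> f \<in> carrier kG" if "a \<in> carrier kH" for a
    by (rule kG.m_closed[OF iota_closed[OF that] f])
  show ?thesis
  proof (rule Ext_ext[OF Infl.abelian_group_axioms
        hom_add_comp[OF Ext_smult_hom[OF a] phi_hom[OF f]] phi_hom[OF cl[OF a]] _ U])
    fix v w assume vw: "v \<in> carrier V" "w \<in> carrier M"
    have et: "E.et v w \<in> carrier Ext" by (rule E_et_closed[OF vw])
    show "phi f (a \<odot>\<^bsub>Ext\<^esub> E.et v w) = phi (\<iota> a \<otimes>\<^bsub>kG\<^esub> f) (E.et v w)"
    proof (rule additive_single_ext[OF Infl.abelian_group_axioms, where S = "carrier H"
          and h = "\<lambda>a. phi f (a \<odot>\<^bsub>Ext\<^esub> E.et v w)" and k = "\<lambda>a. phi (\<iota> a \<otimes>\<^bsub>kG\<^esub> f) (E.et v w)"])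
      fix a b :: "(nat \<Rightarrow> nat) \<times> (nat \<Rightarrow> nat) \<Rightarrow>\<^sub>0 'k"
      assume "Poly_Mapping.keys a \<subseteq> carrier H"
      then have a: "a \<in> carrier kH" by simp
      show "phi f (a \<odot>\<^bsub>Ext\<^esub> E.et v w) \<in> carrier Infl"
        by (rule hom_add_closed[OF phi_hom[OF f] Ext_smult_closed[OF a et]])
      show "phi (\<iota> a \<otimes>\<^bsub>kG\<^esub> f) (E.et v w) \<in> carrier Infl"
        by (rule hom_add_closed[OF phi_hom[OF cl[OF a]] et])
      assume "Poly_Mapping.keys b \<subseteq> carrier H"
      then have b: "b \<in> carrier kH" by simp
      show "phi f ((a + b) \<odot>\<^bsub>Ext\<^esub> E.et v w) = phi f (a \<odot>\<^bsub>Ext\<^esub> E.et v w) \<oplus>\<^bsub>Infl\<^esub> phi f (b \<odot>\<^bsub>Ext\<^esub> E.et v w)"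
        unfolding Ext_smult_elem_add[OF a b vw]
        by (rule hom_add_add[OF phi_hom[OF f] Ext_smult_closed[OF a et] Ext_smult_closed[OF b et]])
      show "phi (\<iota> (a + b) \<otimes>\<^bsub>kG\<^esub> f) (E.et v w)
          = phi (\<iota> a \<otimes>\<^bsub>kG\<^esub> f) (E.et v w) \<oplus>\<^bsub>Infl\<^esub> phi (\<iota> b \<otimes>\<^bsub>kG\<^esub> f) (E.et v w)"
        using phi_add[OF cl[OF a] cl[OF b] et] kG.l_distr[OF iota_closed[OF a] iota_closed[OF b] f]
        by (simp add: lin_ext_add)
    next
      fix x :: "(nat \<Rightarrow> nat) \<times> (nat \<Rightarrow> nat)" and c :: 'k
      assume x: "x \<in> carrier H"
      obtain g h where gh: "x = (g, h)" by (cases x)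
      then have perm: "g permutes {1..p}" "h permutes {1..m}" using x by (auto simp: carrier_H)
      have ia: "\<iota> (Poly_Mapping.single x c) = Poly_Mapping.single (block_perm p (g, h)) c"
        by (simp add: gh lin_ext_single_scale)
      have w': "Poly_Mapping.single h 1 \<odot>\<^bsub>M\<^esub> w \<in> carrier M"
        by (rule single_M_closed[OF perm(2) vw(2)])
      have gc: "Poly_Mapping.single g c \<in> carrier (sym_algebra p)" using perm by simp
      let ?y = "right_relabel (base_lin p (Poly_Mapping.single h 1 \<odot>\<^bsub>M\<^esub> w)) f"
      have y: "?y \<in> carrier B" by (rule base_relabel_closed[OF w' f])
      have "phi f (Poly_Mapping.single x c \<odot>\<^bsub>Ext\<^esub> E.et v w) = L.et (Poly_Mapping.single g c \<odot>\<^bsub>V\<^esub> v) ?y"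
        unfolding gh Ext_smult_single[OF perm vw] by (rule phi_et[OF f single_V_closed[OF perm(1) vw(1)] w'])
      \<comment> \<open>Of the pair, \<open>h\<close> already acts on the matching; now
        \<open>g\<close> is moved from \<open>v\<close> across the tensor product over
        \<open>sym_algebra p\<close> to the top of the diagram. There the two combine into the
        bottom permutation \<open>block_perm p (g, h)\<close>.\<close>
      also have "\<dots> = L.et v (Poly_Mapping.single g c \<odot>\<^bsub>B\<^esub> ?y)"
        by (rule L.et_smult[OF vw(1) y gc])
      also have "Poly_Mapping.single g c \<odot>\<^bsub>B\<^esub> ?y = left_relabel (Poly_Mapping.single g c) ?y"
        using y gc by (intro diagram_bimodule_smult) simp_all
      also have "\<dots> = right_relabel (base_lin p w) (\<iota> (Poly_Mapping.single x c) \<otimes>\<^bsub>kG\<^esub> f)"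
        unfolding ia using vw(2) perm by (intro left_relabel_base[where m = m]) simp_all
      also have "L.et v \<dots> = phi (\<iota> (Poly_Mapping.single x c) \<otimes>\<^bsub>kG\<^esub> f) (E.et v w)"
        using phi_et[OF cl vw, of "Poly_Mapping.single x c"] x by simp
      finally show "phi f (Poly_Mapping.single x c \<odot>\<^bsub>Ext\<^esub> E.et v w)
          = phi (\<iota> (Poly_Mapping.single x c) \<otimes>\<^bsub>kG\<^esub> f) (E.et v w)" .
    qed (use a in simp)
  qed
qed

text \<open>Second lift, in the variables \<open>U\<close> and \<open>f\<close>;
  \<open>phi_add\<close> and \<open>phi_smult\<close> supply what the first lift does not.\<close>

lemma Phi_ex:
  obtains \<Phi> where "\<Phi> \<in> hom (add_monoid Ind) (add_monoid Infl)"
    "\<And>v w f. v \<in> carrier V \<Longrightarrow> w \<in> carrier M \<Longrightarrow> f \<in> carrier kG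
      \<Longrightarrow> \<Phi> (I.et (E.et v w) f) = L.et v (right_relabel (base_lin p w) f)"
proof -
  have "balanced kH Ext IB Infl (\<lambda>U f. phi f U)"
  proof (rule balancedI)
    fix U f assume U: "U \<in> carrier Ext" and "f \<in> carrier IB"
    then have f: "f \<in> carrier kG" by simp
    show "phi f U \<in> carrier Infl" by (rule hom_add_closed[OF phi_hom[OF f] U])
    show "phi f (U \<oplus>\<^bsub>Ext\<^esub> U') = phi f U \<oplus>\<^bsub>Infl\<^esub> phi f U'" if "U' \<in> carrier Ext" for U'
      by (rule hom_add_add[OF phi_hom[OF f] U that])
    show "phi (f \<oplus>\<^bsub>IB\<^esub> g) U = phi f U \<oplus>\<^bsub>Infl\<^esub> phi g U" if "g \<in> carrier IB" for g
      using phi_add[OF f _ U, of g] that by simp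
    show "phi f (a \<odot>\<^bsub>Ext\<^esub> U) = phi (a \<odot>\<^bsub>IB\<^esub> f) U" if "a \<in> carrier kH" for a
      using phi_smult[OF that f U] by simp
  qed
  from I.tensor_lift[OF Infl.abelian_group_axioms this, of "act_right IB", folded Ind_eq]
  obtain \<Phi> where Phi: "\<Phi> \<in> hom (add_monoid Ind) (add_monoid Infl)"
    and Phi_et: "\<And>U f. U \<in> carrier Ext \<Longrightarrow> f \<in> carrier IB \<Longrightarrow> \<Phi> (I.et U f) = phi f U"
    by blast
  show thesis
  proof (rule that[OF Phi])
    fix v w and f :: "(nat \<Rightarrow> nat) \<Rightarrow>\<^sub>0 'k"
    assume vw: "v \<in> carrier V" "w \<in> carrier M" and f: "f \<in> carrier kG"
    then have "f \<in> carrier IB" by simp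
    then show "\<Phi> (I.et (E.et v w) f) = L.et v (right_relabel (base_lin p w) f)"
      using Phi_et[OF E_et_closed[OF vw]] phi_et[OF f vw] by simp
  qed
qed

text \<open>Uniqueness for both tensor products in succession: for fixed \<open>f\<close>, composing
  with \<open>U \<mapsto> I.et U f\<close> pulls the question back to \<open>Ext\<close>.\<close>

lemma Ind_ext:
  assumes A: "abelian_group A" and h: "h \<in> hom (add_monoid Ind) (add_monoid A)" and k: "k \<in> hom (add_monoid Ind) (add_monoid A)"
    and eq: "\<And>v w f. v \<in> carrier V \<Longrightarrow> w \<in> carrier M \<Longrightarrow> f \<in> carrier kG
      \<Longrightarrow> h (I.et (E.et v w) f) = k (I.et (E.et v w) f)"
    and x: "x \<in> carrier Ind"
  shows "h x = k x"
proof (rule I.tensor_ext[OF A, where act = "act_right IB", folded Ind_eq, OF h k _ x])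
  fix U f assume U: "U \<in> carrier Ext" and f: "f \<in> carrier IB"
  then have f': "f \<in> carrier kG" by simp
  note et = I.et_hom_left[OF f, where act = "act_right IB", folded Ind_eq]
  show "h (I.et U f) = k (I.et U f)"
    by (rule Ext_ext[OF A hom_add_comp[OF et h] hom_add_comp[OF et k] _ U]) (rule eq[OF _ _ f'])
qed

section \<open>The inverse map\<close>

lemma single_matching_closed: "\<mu> \<in> perfect_matchings {1..m} \<Longrightarrow> Poly_Mapping.single \<mu> c \<in> carrier M"
  by simp

lemma single_perm_closed: "\<tau> permutes {1..r} \<Longrightarrow> Poly_Mapping.single \<tau> c \<in> carrier kG"
  by simp

lemma iota_smult_single:
  "Poly_Mapping.single gh c \<odot>\<^bsub>IB\<^esub> Poly_Mapping.single \<tau> d = Poly_Mapping.single (block_perm p gh \<circ> \<tau>) (c * d)"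
  by (simp add: lin_ext_single_scale group_algebra_mult_single sym_group_mult)

text \<open>The relation over \<open>kH\<close> on basis elements, with all scalars collected on the
  permutation. It is used with \<open>g = id\<close> to change the pair describing a diagram, with
  \<open>h = id\<close> to balance over \<open>sym_algebra p\<close>, and with both trivial to move
  scalars.\<close>

lemma I_et_block:
  assumes g: "g permutes {1..p}" and h: "h permutes {1..m}" and v: "v \<in> carrier V"
    and mu: "\<mu> \<in> perfect_matchings {1..m}" and t: "\<tau> permutes {1..r}"
  shows "I.et (E.et (Poly_Mapping.single g c \<odot>\<^bsub>V\<^esub> v) (Poly_Mapping.single ((\<lambda>e. h -` e) ` \<mu>) 1)) (Poly_Mapping.single \<tau> d)
    = I.et (E.et v (Poly_Mapping.single \<mu> 1)) (Poly_Mapping.single (block_perm p (g, h) \<circ> \<tau>) (c * d))"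
proof -
  have w: "Poly_Mapping.single \<mu> 1 \<in> carrier M" by (rule single_matching_closed[OF mu])
  have "(Poly_Mapping.single h 1 :: (nat \<Rightarrow> nat) \<Rightarrow>\<^sub>0 'k) \<odot>\<^bsub>M\<^esub> Poly_Mapping.single \<mu> 1
      = Poly_Mapping.single ((\<lambda>e. h -` e) ` \<mu>) 1"
    by (simp add: matching_module_smult_single)
  then have "E.et (Poly_Mapping.single g c \<odot>\<^bsub>V\<^esub> v) (Poly_Mapping.single ((\<lambda>e. h -` e) ` \<mu>) 1)
      = Poly_Mapping.single (g, h) c \<odot>\<^bsub>Ext\<^esub> E.et v (Poly_Mapping.single \<mu> 1)"
    using Ext_smult_single[OF g h v w, of c] by simp
  moreover have "Poly_Mapping.single (g, h) c \<in> carrier kH"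
    by (rule single_closed) (simp add: carrier_H g h)
  moreover have "Poly_Mapping.single \<tau> d \<in> carrier IB" using t by simp
  ultimately show ?thesis
    using I.et_smult[OF E_et_closed[OF v w], of "Poly_Mapping.single \<tau> d" "Poly_Mapping.single (g, h) c"]
    by (simp only: iota_smult_single)
qed

text \<open>Two pairs describing the same diagram differ by a \<open>\<rho>\<close> that acts on the
  matching and as \<open>block_perm p (id, \<rho>)\<close> on the permutation; the tensor product
  over \<open>kH\<close> identifies the two. So the inverse map will not depend on the chosen
  pairs.\<close>

lemma I_et_orbit:
  assumes eq: "relabel id \<tau> (base_diagram p \<mu>) = relabel id \<tau>' (base_diagram p \<mu>')"
    and mu: "\<mu> \<in> perfect_matchings {1..m}"
    and t: "\<tau> permutes {1..r}" and t': "\<tau>' permutes {1..r}" and v: "v \<in> carrier V"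
  shows "I.et (E.et v (Poly_Mapping.single \<mu>' 1)) (Poly_Mapping.single \<tau>' c)
    = I.et (E.et v (Poly_Mapping.single \<mu> 1)) (Poly_Mapping.single \<tau> c)"
proof -
  obtain \<rho> where rho: "\<rho> permutes {1..m}" "\<tau> = block_perm p (id, \<rho>) \<circ> \<tau>'" "\<mu>' = (\<lambda>e. \<rho> -` e) ` \<mu>"
    by (rule base_diagram_stabilizer[OF eq mu t t'])
  have "Poly_Mapping.single id 1 \<odot>\<^bsub>V\<^esub> v = v"
    using V.smult_one[OF v] by (simp add: group_algebra_def sym_group_one)
  then show ?thesis
    using I_et_block[OF permutes_id rho(1) v mu t', of 1 c] by (simp add: rho(2,3))
qed

text \<open>A pair \<open>(\<mu>, \<tau>)\<close> is chosen once for each diagram, but the resulting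
  formula is stated for every pair, so that no trace of the choice is left for later use.\<close>

lemma Psi_ex:
  obtains \<Psi> where "\<Psi> \<in> hom (add_monoid Infl) (add_monoid Ind)"
    "\<And>v \<mu> \<tau> c. v \<in> carrier V \<Longrightarrow> \<mu> \<in> perfect_matchings {1..m} \<Longrightarrow> \<tau> permutes {1..r}
      \<Longrightarrow> \<Psi> (L.et v (Poly_Mapping.single (relabel id \<tau> (base_diagram p \<mu>)) c))
        = I.et (E.et v (Poly_Mapping.single \<mu> 1)) (Poly_Mapping.single \<tau> c)"
proof -
  let ?D = "diagrams_pr p r p"
  have "\<forall>d\<in>?D. \<exists>\<mu> \<tau>. \<mu> \<in> perfect_matchings {1..m} \<and> \<tau> permutes {1..r} \<and> d = relabel id \<tau> (base_diagram p \<mu>)"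
    using base_diagram_orbit by blast
  then obtain mu tau where mu: "\<And>d. d \<in> ?D \<Longrightarrow> mu d \<in> perfect_matchings {1..m}"
    and tau: "\<And>d. d \<in> ?D \<Longrightarrow> tau d permutes {1..r}"
    and d: "\<And>d. d \<in> ?D \<Longrightarrow> d = relabel id (tau d) (base_diagram p (mu d))"
    by metis
  \<comment> \<open>The coefficient goes to the permutation, where \<open>I.et\<close> is additive
    in it. Summing over all of the finite set \<open>?D\<close>, and not over the support of
    \<open>x\<close>, then makes additivity in \<open>x\<close> termwise; absent diagrams contribute
    \<open>t v d 0\<close>, which is zero.\<close>
  define t where "t v d c = I.et (E.et v (Poly_Mapping.single (mu d) 1)) (Poly_Mapping.single (tau d) c)" for v d c
  define \<beta> where "\<beta> v x = (\<Oplus>\<^bsub>Ind\<^esub>d\<in>?D. t v d (Poly_Mapping.lookup x d))" for v x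
  have Ec: "E.et v (Poly_Mapping.single (mu d) 1) \<in> carrier Ext" if "v \<in> carrier V" "d \<in> ?D" for v d
    by (rule E_et_closed[OF that(1) single_matching_closed[OF mu[OF that(2)]]])
  have tc: "t v d c \<in> carrier Ind" if "v \<in> carrier V" "d \<in> ?D" for v d c
    unfolding t_def by (rule I_et_closed[OF Ec[OF that] single_perm_closed[OF tau[OF that(2)]]])
  have t_left: "t (v \<oplus>\<^bsub>V\<^esub> v') d c = t v d c \<oplus>\<^bsub>Ind\<^esub> t v' d c"
    if v: "v \<in> carrier V" "v' \<in> carrier V" and D: "d \<in> ?D" for v v' d c
  proof -
    have "E.et (v \<oplus>\<^bsub>V\<^esub> v') (Poly_Mapping.single (mu d) 1)
        = E.et v (Poly_Mapping.single (mu d) 1) \<oplus>\<^bsub>Ext\<^esub> E.et v' (Poly_Mapping.single (mu d) 1)"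
      using E.et_add_left[of v "Poly_Mapping.single (mu d) 1" v' act_ext] v mu[OF D]
      by (simp add: Ext_eq)
    then show ?thesis
      using I.et_add_left[OF Ec[OF v(1) D] _ Ec[OF v(2) D], of "Poly_Mapping.single (tau d) c" "act_right IB"]
        single_perm_closed[OF tau[OF D], of c]
      by (simp add: t_def Ind_eq)
  qed
  have t_right: "t v d (c + c') = t v d c \<oplus>\<^bsub>Ind\<^esub> t v d c'"
    if v: "v \<in> carrier V" and D: "d \<in> ?D" for v d c c'
    using I.et_add_right[OF Ec[OF v D], of "Poly_Mapping.single (tau d) c" "Poly_Mapping.single (tau d) c'" "act_right IB"]
      single_perm_closed[OF tau[OF D], of c] single_perm_closed[OF tau[OF D], of c']
    by (simp add: t_def Ind_eq single_add)
  have t_zero: "t v d 0 = \<zero>\<^bsub>Ind\<^esub>" if v: "v \<in> carrier V" and D: "d \<in> ?D" for v d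
    using I.et_zero_right[OF Ec[OF v D], of "act_right IB"] by (simp add: t_def Ind_eq)
  have t_Pi: "(\<lambda>d. t v d (Poly_Mapping.lookup x d)) \<in> ?D \<rightarrow> carrier Ind" if "v \<in> carrier V" for v x
    using tc[OF that] by blast
  have bc: "\<beta> v x \<in> carrier Ind" if "v \<in> carrier V" for v x
    unfolding \<beta>_def by (rule Ind.finsum_closed[OF t_Pi[OF that]])
  have b_left: "\<beta> (v \<oplus>\<^bsub>V\<^esub> v') x = \<beta> v x \<oplus>\<^bsub>Ind\<^esub> \<beta> v' x" if "v \<in> carrier V" "v' \<in> carrier V" for v v' x
    unfolding \<beta>_def Ind.finsum_addf[OF t_Pi[OF that(1)] t_Pi[OF that(2)], symmetric]
    using tc that by (intro Ind.finsum_cong') (auto simp: t_left)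
  have b_right: "\<beta> v (x + y) = \<beta> v x \<oplus>\<^bsub>Ind\<^esub> \<beta> v y" if "v \<in> carrier V" for v x y
    unfolding \<beta>_def Ind.finsum_addf[OF t_Pi[OF that] t_Pi[OF that], symmetric]
    using tc that by (intro Ind.finsum_cong') (auto simp: t_right lookup_add)
  have b_single: "\<beta> v (Poly_Mapping.single d c) = t v d c" if v: "v \<in> carrier V" and D: "d \<in> ?D" for v d c
  proof -
    have "\<beta> v (Poly_Mapping.single d c) = t v d (Poly_Mapping.lookup (Poly_Mapping.single d c) d)"
      unfolding \<beta>_def
    proof (rule Ind.finsum_single[OF finite_diagrams_pr D])
      show "t v d (Poly_Mapping.lookup (Poly_Mapping.single d c) d) \<in> carrier Ind" by (rule tc[OF v D])
      show "t v d' (Poly_Mapping.lookup (Poly_Mapping.single d c) d') = \<zero>\<^bsub>Ind\<^esub>" if "d' \<in> ?D - {d}" for d'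
      proof -
        have "d' \<in> ?D" "Poly_Mapping.lookup (Poly_Mapping.single d c) d' = 0"
          using that by (auto simp: lookup_single)
        then show ?thesis by (simp only: t_zero[OF v])
      qed
    qed
    then show ?thesis by simp
  qed
  have b_orbit: "\<beta> v (Poly_Mapping.single (relabel id \<tau> (base_diagram p \<mu>)) c)
      = I.et (E.et v (Poly_Mapping.single \<mu> 1)) (Poly_Mapping.single \<tau> c)"
    if v: "v \<in> carrier V" and m: "\<mu> \<in> perfect_matchings {1..m}" and t: "\<tau> permutes {1..r}" for v \<mu> \<tau> c
  proof -
    let ?d = "relabel id \<tau> (base_diagram p \<mu>)"
    have D: "?d \<in> ?D" by (rule relabel_in_diagrams_pr[OF base_diagram_in[OF m] permutes_id t])
    have "\<beta> v (Poly_Mapping.single ?d c) = t v ?d c" by (rule b_single[OF v D])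
    also have "\<dots> = I.et (E.et v (Poly_Mapping.single \<mu> 1)) (Poly_Mapping.single \<tau> c)"
      unfolding t_def by (rule I_et_orbit[OF d[OF D] m t tau[OF D] v])
    finally show ?thesis .
  qed
  have "balanced (sym_algebra p) V B Ind \<beta>"
  proof (rule balancedI)
    fix a :: "(nat \<Rightarrow> nat) \<Rightarrow>\<^sub>0 'k" and v x
    assume a: "a \<in> carrier (sym_algebra p)" and v: "v \<in> carrier V" and x: "x \<in> carrier B"
    have act: "a \<odot>\<^bsub>B\<^esub> y = left_relabel a y"
      if "a \<in> carrier (sym_algebra p)" "Poly_Mapping.keys y \<subseteq> ?D" for a y
      using that by (intro diagram_bimodule_smult) simp_all
    have single_D: "Poly_Mapping.keys (Poly_Mapping.single d c :: diagram \<Rightarrow>\<^sub>0 'k) \<subseteq> ?D" if "d \<in> ?D" for d c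
      using that by simp
    \<comment> \<open>Both sides are additive in \<open>x\<close> and in \<open>a\<close>, so the
      identity is needed for one diagram \<open>d'\<close> and one permutation \<open>s\<close>
      only, each with a coefficient.\<close>
    show "\<beta> (a \<odot>\<^bsub>V\<^esub> v) x = \<beta> v (a \<odot>\<^bsub>B\<^esub> x)"
    proof (rule additive_single_ext[OF Ind.abelian_group_axioms, where S = ?D
          and h = "\<lambda>x. \<beta> (a \<odot>\<^bsub>V\<^esub> v) x" and k = "\<lambda>x. \<beta> v (a \<odot>\<^bsub>B\<^esub> x)"])
      fix d' c assume D: "d' \<in> ?D"
      show "\<beta> (a \<odot>\<^bsub>V\<^esub> v) (Poly_Mapping.single d' c) = \<beta> v (a \<odot>\<^bsub>B\<^esub> Poly_Mapping.single d' c)"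
      proof (rule additive_single_ext[OF Ind.abelian_group_axioms, where S = "{\<sigma>. \<sigma> permutes {1..p}}"
            and h = "\<lambda>a. \<beta> (a \<odot>\<^bsub>V\<^esub> v) (Poly_Mapping.single d' c)"
            and k = "\<lambda>a. \<beta> v (a \<odot>\<^bsub>B\<^esub> Poly_Mapping.single d' c)"])
        fix a b :: "(nat \<Rightarrow> nat) \<Rightarrow>\<^sub>0 'k" assume "Poly_Mapping.keys a \<subseteq> {\<sigma>. \<sigma> permutes {1..p}}"
        then have a: "a \<in> carrier (sym_algebra p)" by simp
        show "\<beta> (a \<odot>\<^bsub>V\<^esub> v) (Poly_Mapping.single d' c) \<in> carrier Ind"
          by (rule bc[OF V.smult_closed[OF a v]])
        show "\<beta> v (a \<odot>\<^bsub>B\<^esub> Poly_Mapping.single d' c) \<in> carrier Ind" by (rule bc[OF v])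
        assume "Poly_Mapping.keys b \<subseteq> {\<sigma>. \<sigma> permutes {1..p}}"
        then have b: "b \<in> carrier (sym_algebra p)" by simp
        have ab: "a + b \<in> carrier (sym_algebra p)" using V.R.a_closed[OF a b] by simp
        show "\<beta> ((a + b) \<odot>\<^bsub>V\<^esub> v) (Poly_Mapping.single d' c)
            = \<beta> (a \<odot>\<^bsub>V\<^esub> v) (Poly_Mapping.single d' c) \<oplus>\<^bsub>Ind\<^esub> \<beta> (b \<odot>\<^bsub>V\<^esub> v) (Poly_Mapping.single d' c)"
          using V.smult_l_distr[OF a b v] b_left[OF V.smult_closed[OF a v] V.smult_closed[OF b v]] by simp
        show "\<beta> v ((a + b) \<odot>\<^bsub>B\<^esub> Poly_Mapping.single d' c)
            = \<beta> v (a \<odot>\<^bsub>B\<^esub> Poly_Mapping.single d' c) \<oplus>\<^bsub>Ind\<^esub> \<beta> v (b \<odot>\<^bsub>B\<^esub> Poly_Mapping.single d' c)"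
          unfolding act[OF a single_D[OF D]] act[OF b single_D[OF D]] act[OF ab single_D[OF D]] left_relabel_add_left
          by (rule b_right[OF v])
      next
        fix s and k :: 'k assume "s \<in> {\<sigma>. \<sigma> permutes {1..p}}"
        then have s: "s permutes {1..p}" by simp
        have sc: "Poly_Mapping.single s k \<in> carrier (sym_algebra p)" using s by simp
        let ?t = "block_perm p (s, id) \<circ> tau d'"
        have ids: "(\<lambda>e. id -` e) ` mu d' = mu d'" by simp
        have t: "?t permutes {1..r}"
          by (rule permutes_compose[OF tau[OF D] block_perm_permutes[OF s permutes_id]])
        \<comment> \<open>Top relabelling by \<open>s\<close> is traded for the bottom permutation
          \<open>block_perm p (s, id)\<close>, with the matching unchanged. The new pair need not be
          the one chosen for this diagram, which is why \<open>b_orbit\<close> and not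
          \<open>b_single\<close> is applied to it.\<close>
        have "relabel (inv' s) id d' = relabel id (tau d') (relabel (inv' s) id (base_diagram p ((\<lambda>e. id -` e) ` mu d')))"
          using arg_cong[OF d[OF D], of "relabel (inv' s) id"] by (simp add: relabel_relabel)
        also have "\<dots> = relabel id ?t (base_diagram p (mu d'))"
          unfolding relabel_base_diagram_left[OF mu[OF D] s permutes_id] by (simp add: relabel_relabel)
        finally have d': "relabel (inv' s) id d' = relabel id ?t (base_diagram p (mu d'))" .
        have "\<beta> (Poly_Mapping.single s k \<odot>\<^bsub>V\<^esub> v) (Poly_Mapping.single d' c)
            = I.et (E.et (Poly_Mapping.single s k \<odot>\<^bsub>V\<^esub> v) (Poly_Mapping.single ((\<lambda>e. id -` e) ` mu d') 1)) (Poly_Mapping.single (tau d') c)"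
          unfolding ids using b_single[OF single_V_closed[OF s v] D] by (simp add: t_def)
        also have "\<dots> = I.et (E.et v (Poly_Mapping.single (mu d') 1)) (Poly_Mapping.single ?t (k * c))"
          by (rule I_et_block[OF s permutes_id v mu[OF D] tau[OF D]])
        also have "\<dots> = \<beta> v (Poly_Mapping.single (relabel (inv' s) id d') (k * c))"
          unfolding d' by (rule b_orbit[OF v mu[OF D] t, symmetric])
        also have "Poly_Mapping.single (relabel (inv' s) id d') (k * c) = Poly_Mapping.single s k \<odot>\<^bsub>B\<^esub> Poly_Mapping.single d' c"
          unfolding act[OF sc single_D[OF D]]
          by (simp add: relabel_defs lin_ext_single_scale)
        finally show "\<beta> (Poly_Mapping.single s k \<odot>\<^bsub>V\<^esub> v) (Poly_Mapping.single d' c)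
            = \<beta> v (Poly_Mapping.single s k \<odot>\<^bsub>B\<^esub> Poly_Mapping.single d' c)" .
      qed (use a in simp)
    next
      fix x y :: "diagram \<Rightarrow>\<^sub>0 'k" assume x: "Poly_Mapping.keys x \<subseteq> ?D"
      show "\<beta> (a \<odot>\<^bsub>V\<^esub> v) x \<in> carrier Ind" by (rule bc[OF V.smult_closed[OF a v]])
      show "\<beta> v (a \<odot>\<^bsub>B\<^esub> x) \<in> carrier Ind" by (rule bc[OF v])
      show "\<beta> (a \<odot>\<^bsub>V\<^esub> v) (x + y) = \<beta> (a \<odot>\<^bsub>V\<^esub> v) x \<oplus>\<^bsub>Ind\<^esub> \<beta> (a \<odot>\<^bsub>V\<^esub> v) y"
        by (rule b_right[OF V.smult_closed[OF a v]])
      assume y: "Poly_Mapping.keys y \<subseteq> ?D"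
      have xy: "Poly_Mapping.keys (x + y) \<subseteq> ?D" using x y keys_add[of x y] by blast
      show "\<beta> v (a \<odot>\<^bsub>B\<^esub> (x + y)) = \<beta> v (a \<odot>\<^bsub>B\<^esub> x) \<oplus>\<^bsub>Ind\<^esub> \<beta> v (a \<odot>\<^bsub>B\<^esub> y)"
        unfolding act[OF a x] act[OF a y] act[OF a xy] left_relabel_add by (rule b_right[OF v])
    qed (use x in simp)
  qed (simp_all add: bc b_left b_right)
  from L.tensor_lift[OF Ind.abelian_group_axioms this, of "act_right B", folded Infl_eq]
  obtain \<Psi> where Psi: "\<Psi> \<in> hom (add_monoid Infl) (add_monoid Ind)"
    and Psi_et: "\<And>v x. v \<in> carrier V \<Longrightarrow> x \<in> carrier B \<Longrightarrow> \<Psi> (L.et v x) = \<beta> v x"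
    by blast
  show thesis
  proof (rule that[OF Psi])
    fix v \<mu> \<tau> and c :: 'k
    assume v: "v \<in> carrier V" and m: "\<mu> \<in> perfect_matchings {1..m}" and t: "\<tau> permutes {1..r}"
    have "Poly_Mapping.single (relabel id \<tau> (base_diagram p \<mu>)) c \<in> carrier B"
      using relabel_in_diagrams_pr[OF base_diagram_in[OF m] permutes_id t] by simp
    then show "\<Psi> (L.et v (Poly_Mapping.single (relabel id \<tau> (base_diagram p \<mu>)) c))
        = I.et (E.et v (Poly_Mapping.single \<mu> 1)) (Poly_Mapping.single \<tau> c)"
      unfolding Psi_et[OF v \<open>_ \<in> carrier B\<close>] by (intro b_orbit[OF v m t])
  qed
qed

section \<open>Equivariance and mutual inverseness of the two maps\<close>

lemma isomorphic:
  "modules_isomorphic kG (restrict_scalars (sym_to_brauer r) Infl) Ind"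
proof -
  obtain \<Phi> where Phi: "\<Phi> \<in> hom (add_monoid Ind) (add_monoid Infl)"
    and Phi_et: "\<And>v w f. v \<in> carrier V \<Longrightarrow> w \<in> carrier M \<Longrightarrow> f \<in> carrier kG
      \<Longrightarrow> \<Phi> (I.et (E.et v w) f) = L.et v (right_relabel (base_lin p w) f)"
    by (rule Phi_ex) blast
  obtain \<Psi> where Psi: "\<Psi> \<in> hom (add_monoid Infl) (add_monoid Ind)"
    and Psi_et: "\<And>v \<mu> \<tau> c. v \<in> carrier V \<Longrightarrow> \<mu> \<in> perfect_matchings {1..m} \<Longrightarrow> \<tau> permutes {1..r}
      \<Longrightarrow> \<Psi> (L.et v (Poly_Mapping.single (relabel id \<tau> (base_diagram p \<mu>)) c))
        = I.et (E.et v (Poly_Mapping.single \<mu> 1)) (Poly_Mapping.single \<tau> c)"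
    by (rule Psi_ex) blast
  have base_single: "right_relabel (base_lin p (Poly_Mapping.single \<mu> c)) (Poly_Mapping.single \<tau> d)
      = Poly_Mapping.single (relabel id \<tau> (base_diagram p \<mu>)) (c * d)" for \<mu> \<tau> and c d :: 'k
    by (simp add: relabel_defs lin_ext_single_scale)
  have Phi_smult: "\<Phi> (b \<odot>\<^bsub>Ind\<^esub> y) = sym_to_brauer r b \<odot>\<^bsub>Infl\<^esub> \<Phi> y"
    if b: "b \<in> carrier kG" and y: "y \<in> carrier Ind" for b y
  proof (rule Ind_ext[OF Infl.abelian_group_axioms hom_add_comp[OF Ind_smult_hom[OF b] Phi]
        hom_add_comp[OF Phi Infl_smult_hom[OF b]] _ y])
    fix v w f assume vw: "v \<in> carrier V" "w \<in> carrier M" and f: "f \<in> carrier kG"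
    have "\<Phi> (b \<odot>\<^bsub>Ind\<^esub> I.et (E.et v w) f) = L.et v (right_relabel (base_lin p w) (f \<otimes>\<^bsub>kG\<^esub> b))"
      unfolding Ind_smult_elem[OF b E_et_closed[OF vw] f] by (rule Phi_et[OF vw kG.m_closed[OF f b]])
    also have "\<dots> = sym_to_brauer r b \<odot>\<^bsub>Infl\<^esub> L.et v (right_relabel (base_lin p w) f)"
      unfolding Infl_smult_elem[OF b vw(1) base_relabel_closed[OF vw(2) f]] right_relabel_mult ..
    finally show "\<Phi> (b \<odot>\<^bsub>Ind\<^esub> I.et (E.et v w) f) = sym_to_brauer r b \<odot>\<^bsub>Infl\<^esub> \<Phi> (I.et (E.et v w) f)"
      unfolding Phi_et[OF vw f] .
  qed
  have Phi_Psi: "\<Phi> (\<Psi> x) = x" if "x \<in> carrier Infl" for x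
  proof (rule L.tensor_ext[OF Infl.abelian_group_axioms, where act = "act_right B" and k = "\<lambda>x. x",
        folded Infl_eq, OF hom_add_comp[OF Psi Phi] _ _ that])
    show "(\<lambda>x. x) \<in> hom (add_monoid Infl) (add_monoid Infl)" by (rule hom_add_monoidI) simp_all
    fix v x assume v: "v \<in> carrier V" and x: "x \<in> carrier B"
    note et = L.et_hom_right[OF v, where act = "act_right B", folded Infl_eq]
    note h = hom_add_comp[OF et hom_add_comp[OF Psi Phi]]
    show "\<Phi> (\<Psi> (L.et v x)) = L.et v x"
    proof (rule additive_single_ext[OF Infl.abelian_group_axioms, where S = "diagrams_pr p r p"
          and h = "\<lambda>x. \<Phi> (\<Psi> (L.et v x))" and k = "L.et v"])
      fix d and c :: 'k assume "d \<in> diagrams_pr p r p"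
      then obtain \<mu> \<tau> where m: "\<mu> \<in> perfect_matchings {1..m}" and t: "\<tau> permutes {1..r}"
        and d: "d = relabel id \<tau> (base_diagram p \<mu>)"
        by (rule base_diagram_orbit)
      show "\<Phi> (\<Psi> (L.et v (Poly_Mapping.single d c))) = L.et v (Poly_Mapping.single d c)"
        unfolding d Psi_et[OF v m t] Phi_et[OF v single_matching_closed[OF m] single_perm_closed[OF t]]
          base_single by simp
    qed (use x hom_add_closed[OF h] hom_add_add[OF h] hom_add_closed[OF et] hom_add_add[OF et] in simp_all)
  qed
  have Psi_Phi: "\<Psi> (\<Phi> y) = y" if "y \<in> carrier Ind" for y
  proof (rule Ind_ext[OF Ind.abelian_group_axioms hom_add_comp[OF Phi Psi], where k = "\<lambda>y. y", OF _ _ that])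
    show "(\<lambda>y. y) \<in> hom (add_monoid Ind) (add_monoid Ind)" by (rule hom_add_monoidI) simp_all
    fix v w and f :: "(nat \<Rightarrow> nat) \<Rightarrow>\<^sub>0 'k"
    assume v: "v \<in> carrier V" and w: "w \<in> carrier M" and f: "f \<in> carrier kG"
    have fI: "f \<in> carrier IB" using f by simp
    note etw = E.et_hom_right[where act = act_ext, folded Ext_eq, of v]
    have etw: "E.et v \<in> hom (add_monoid scalarsM) (add_monoid Ext)" using etw v by simp
    note ew = hom_add_comp[OF etw I.et_hom_left[OF fI, where act = "act_right IB", folded Ind_eq]]
    note hw = hom_add_comp[OF ew hom_add_comp[OF Phi Psi]]
    \<comment> \<open>Since \<open>\<Psi>\<close> is described only on tensors with a multiple of
      one diagram, both \<open>w\<close> and \<open>f\<close> are broken into monomials before it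
      can be evaluated.\<close>
    show "\<Psi> (\<Phi> (I.et (E.et v w) f)) = I.et (E.et v w) f"
    proof (rule additive_single_ext[OF Ind.abelian_group_axioms, where S = "perfect_matchings {1..m}"
          and h = "\<lambda>w. \<Psi> (\<Phi> (I.et (E.et v w) f))" and k = "\<lambda>w. I.et (E.et v w) f"])
      fix \<mu> and c :: 'k assume m: "\<mu> \<in> perfect_matchings {1..m}"
      have wc: "Poly_Mapping.single \<mu> c \<in> carrier M" for c by (rule single_matching_closed[OF m])
      note ef = I.et_hom_right[OF E_et_closed[OF v wc[of c]], where act = "act_right IB", folded Ind_eq]
      note hf = hom_add_comp[OF ef hom_add_comp[OF Phi Psi]]
      show "\<Psi> (\<Phi> (I.et (E.et v (Poly_Mapping.single \<mu> c)) f)) = I.et (E.et v (Poly_Mapping.single \<mu> c)) f"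
      proof (rule additive_single_ext[OF Ind.abelian_group_axioms, where S = "carrier S"
            and h = "\<lambda>f. \<Psi> (\<Phi> (I.et (E.et v (Poly_Mapping.single \<mu> c)) f))"
            and k = "\<lambda>f. I.et (E.et v (Poly_Mapping.single \<mu> c)) f"])
        fix \<tau> and d :: 'k assume "\<tau> \<in> carrier S"
        then have t: "\<tau> permutes {1..r}" by simp
        have ids: "(\<lambda>e. id -` e) ` \<mu> = \<mu>" by simp
        have block_id: "block_perm p (id, id) = id" by (auto simp: block_perm_def)
        \<comment> \<open>\<open>\<Psi>\<close> returns the coefficient \<open>c * d\<close>
          entirely on the permutation. To match this, \<open>c\<close> is carried from the matching
          to \<open>v\<close> over the ground ring, and from there to \<open>\<tau>\<close> over
          \<open>kH\<close>.\<close>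
        have "E.et (Poly_Mapping.single id c \<odot>\<^bsub>V\<^esub> v) (Poly_Mapping.single \<mu> 1)
            = E.et v (Poly_Mapping.single id c \<odot>\<^bsub>M\<^esub> Poly_Mapping.single \<mu> 1)"
          using E.et_smult[of v "Poly_Mapping.single \<mu> 1" c] v wc[of 1]
          by (simp add: ring_of_type_algebra_def)
        also have "Poly_Mapping.single id c \<odot>\<^bsub>M\<^esub> Poly_Mapping.single \<mu> 1 = Poly_Mapping.single \<mu> c"
          by (simp add: matching_module_smult_single)
        finally have scale: "E.et (Poly_Mapping.single id c \<odot>\<^bsub>V\<^esub> v) (Poly_Mapping.single \<mu> 1) = E.et v (Poly_Mapping.single \<mu> c)" .
        have "I.et (E.et v (Poly_Mapping.single \<mu> c)) (Poly_Mapping.single \<tau> d)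
            = I.et (E.et v (Poly_Mapping.single \<mu> 1)) (Poly_Mapping.single \<tau> (c * d))"
          by (rule I_et_block[OF permutes_id permutes_id v m t, of c d, unfolded ids block_id scale id_comp])
        moreover have "\<Psi> (\<Phi> (I.et (E.et v (Poly_Mapping.single \<mu> c)) (Poly_Mapping.single \<tau> d)))
            = I.et (E.et v (Poly_Mapping.single \<mu> 1)) (Poly_Mapping.single \<tau> (c * d))"
          unfolding Phi_et[OF v wc single_perm_closed[OF t]] base_single by (rule Psi_et[OF v m t])
        ultimately show "\<Psi> (\<Phi> (I.et (E.et v (Poly_Mapping.single \<mu> c)) (Poly_Mapping.single \<tau> d)))
            = I.et (E.et v (Poly_Mapping.single \<mu> c)) (Poly_Mapping.single \<tau> d)" by simp
      qed (use f hom_add_closed[OF hf] hom_add_add[OF hf] hom_add_closed[OF ef] hom_add_add[OF ef] in simp_all)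
    qed (use w hom_add_closed[OF hw] hom_add_add[OF hw] hom_add_closed[OF ew] hom_add_add[OF ew] in simp_all)
  qed
  show ?thesis
  \<comment> \<open>\<open>\<Phi>\<close> takes the part of the linear map \<open>g\<close>; of
    \<open>\<Psi>\<close> only additivity is asked, besides its inverting
    \<open>\<Phi>\<close>.\<close>
  proof (rule modules_isomorphicI)
    show "b \<odot>\<^bsub>Ind\<^esub> y \<in> carrier Ind" if "b \<in> carrier kG" "y \<in> carrier Ind" for b y
      by (rule hom_add_closed[OF Ind_smult_hom[OF that(1)] that(2)])
    show "\<Phi> \<in> module_hom kG Ind (restrict_scalars (sym_to_brauer r) Infl)"
      using hom_add_closed[OF Phi] hom_add_add[OF Phi] Phi_smult by (simp add: module_hom_def)
    show "\<Psi> \<in> hom (add_monoid (restrict_scalars (sym_to_brauer r) Infl)) (add_monoid Ind)"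
      using hom_add_closed[OF Psi] hom_add_add[OF Psi] by (intro hom_add_monoidI) simp_all
  qed (simp_all add: Phi_Psi Psi_Phi)
qed

end

theorem theorem7p2p4:
  fixes \<delta> :: "'k::field" and p r :: nat
    and V :: "((nat \<Rightarrow> nat) \<Rightarrow>\<^sub>0 'k, 'v) module"
  assumes "p \<le> r"
    and "right_module (sym_algebra p) V"
  shows "modules_isomorphic (sym_algebra r)
    (restrict_scalars (sym_to_brauer r) (inflation \<delta> p r V))
    (induction_product p (r - p) V (matching_module (r - p)))"
proof -
  interpret inflation_restriction \<delta> p "r - p" V
    by (rule inflation_restriction.intro) (rule assms(2))
  \<comment> \<open>The row length in the locale is \<open>p + (r - p)\<close>, which is
    \<open>r\<close> because \<open>p \<le> r\<close>.\<close>
  show ?thesis using isomorphic assms(1) by simp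
qed

end
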